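(* The operator $\mathcal{A}_1:\mathcal{D}(\mathcal{A}_1)\subset\mathcal{H}_1\to\mathcal{H}_1$ is the infinitesimal generator of a $C_0$-semigroup of contractions $\{e^{t\mathcal{A}_1}\}_{t\ge 0}$ on $\mathcal{H}_1$. Accordingly, for the abstract Cauchy problem $\frac{d}{dt}U=\mathcal{A}_1U$ for $t>0$, $U(0)=U_0$: if $U_0\in\mathcal{H}_1$, then the problem has a unique mild solution $U(t)=e^{t\mathcal{A}_1}U_0$, and $U\in C(\mathbb{R}^+,\mathcal{H}_1)$; if $U_0\in\mathcal{D}(\mathcal{A}_1)$, then $U(t)=e^{t\mathcal{A}_1}U_0$ is a classical solution of the problem and $U\in C(\mathbb{R}^+,\mathcal{D}(\mathcal{A}_1))\cap C^1(\mathbb{R}^+,\mathcal{H}_1)$.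
   Context: Let $L>0$, let $\rho,\rho_1,\rho_2,\rho_3,\alpha,\kappa,b,\tau,\sigma,\beta,\gamma>0$ and $m\in\mathbb{R}\setminus\{0\}$ be constants, and let $\mathbb{R}^+=[0,\infty)$. All functions are complex-valued on $(0,L)$; $L^2=L^2(0,L)$, $H^1=H^1(0,L)$, $H^2=H^2(0,L)$, $H_0^1=H_0^1(0,L)$; $(\cdot,\cdot)$ and $\|\cdot\|$ denote the inner product and norm of $L^2$. Let $L_*^2=\{\omega\in L^2:\int_0^L\omega\,dx=0\}$ and $H_*^1=H^1\cap L_*^2$. Put $$\mathcal{H}_1=H_*^1\times L_*^2\times H_*^1\times L_*^2\times H_0^1\times L^2\times L^2\times L^2,$$ with elements $U=(u,v,\varphi,\Phi,\psi,\Psi,\theta,q)$; it is a Hilbert space with the inner product inducing the norm $$\|U\|_{\mathcal{H}_1}^2=\rho\|v\|^2+\alpha\|u_x\|^2+\rho_1\|\Phi\|^2+\rho_2\|\Psi\|^2+b\|\psi_x\|^2+\beta\|\varphi-u\|^2+\kappa\|\varphi_x+\psi\|^2+\rho_3\|\theta\|^2+\tau\|q\|^2.$$ The linear operator $\mathcal{A}_1$ has domain $$\mathcal{D}(\mathcal{A}_1)=\{U\in\mathcal{H}_1: v,\Phi\in H_*^1;\ u_x,\varphi_x,\theta,\Psi\in H_0^1;\ \psi\in H^2;\ q\in H^1\}$$ and is given by $$\mathcal{A}_1U=\begin{pmatrix} v\\ \rho^{-1}[\alpha u_{xx}+\beta(\varphi-u)-\gamma v]\\ \Phi\\ \rho_1^{-1}[\kappa(\varphi_x+\psi)_x-\beta(\varphi-u)-m\theta_x]\\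 \Psi\\ \rho_2^{-1}[b\psi_{xx}-\kappa(\varphi_x+\psi)+m\theta]\\ \rho_3^{-1}[-q_x-m(\Phi_x+\Psi)]\\ \tau^{-1}(-\sigma q-\theta_x)\end{pmatrix}.$$ $\mathcal{D}(\mathcal{A}_1)$ carries the graph norm. *)

theory Defs
  imports "HOL-Analysis.Analysis"
begin

section \<open>Complex vector spaces\<close>

class complex_vector = real_vector +
  fixes scaleC :: "complex \<Rightarrow> 'a \<Rightarrow> 'a" (infixr "*\<^sub>C" 75)
  assumes scaleC_add_right: "c *\<^sub>C (x + y) = c *\<^sub>C x + c *\<^sub>C y"
    and scaleC_add_left: "(c + d) *\<^sub>C x = c *\<^sub>C x + d *\<^sub>C x"
    and scaleC_scaleC: "c *\<^sub>C (d *\<^sub>C x) = (c * d) *\<^sub>C x"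
    and scaleC_of_real: "complex_of_real r *\<^sub>C x = r *\<^sub>R x"

instantiation prod :: (complex_vector, complex_vector) complex_vector
begin

definition scaleC_prod_def: "c *\<^sub>C z = (c *\<^sub>C fst z, c *\<^sub>C snd z)"

instance
  by standard
    (auto simp: scaleC_prod_def scaleC_add_right scaleC_add_left scaleC_scaleC scaleC_of_real
      scaleR_prod_def)

end


section \<open>Strongly continuous semigroups on a normed space\<close>

text \<open>
  The state space depends on the interval length and its norm on the physical constants, so it
  cannot be a type.  A normed space is therefore given here by a carrier set \<open>X\<close> (a complex linear
  subspace of the ambient type) and a norm \<open>N\<close> on it.  All limits are taken with respect to \<open>N\<close>,
  never with respect to a norm that the ambient type may happen to have.
\<close>

definition bounded_linear_op :: "'a::complex_vector set \<Rightarrow> ('a \<Rightarrow> real) \<Rightarrow> ('a \<Rightarrow> 'a) \<Rightarrow> bool" where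
  "bounded_linear_op X N S \<longleftrightarrow>
     (\<forall>x\<in>X. S x \<in> X) \<and>
     (\<forall>x\<in>X. \<forall>y\<in>X. S (x + y) = S x + S y) \<and>
     (\<forall>c. \<forall>x\<in>X. S (c *\<^sub>C x) = c *\<^sub>C S x) \<and>
     (\<exists>M. \<forall>x\<in>X. N (S x) \<le> M * N x)"

definition C0_semigroup :: "'a::complex_vector set \<Rightarrow> ('a \<Rightarrow> real) \<Rightarrow> (real \<Rightarrow> 'a \<Rightarrow> 'a) \<Rightarrow> bool" where
  "C0_semigroup X N T \<longleftrightarrow>
     (\<forall>t\<ge>0. bounded_linear_op X N (T t)) \<and>
     (\<forall>x\<in>X. T 0 x = x) \<and>
     (\<forall>s\<ge>0. \<forall>t\<ge>0. \<forall>x\<in>X. T (s + t) x = T s (T t x)) \<and>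
     (\<forall>x\<in>X. ((\<lambda>t. N (T t x - x)) \<longlongrightarrow> 0) (at_right 0))"

definition C0_contraction_semigroup ::
    "'a::complex_vector set \<Rightarrow> ('a \<Rightarrow> real) \<Rightarrow> (real \<Rightarrow> 'a \<Rightarrow> 'a) \<Rightarrow> bool" where
  "C0_contraction_semigroup X N T \<longleftrightarrow>
     C0_semigroup X N T \<and> (\<forall>t\<ge>0. \<forall>x\<in>X. N (T t x) \<le> N x)"

text \<open>The operator with domain \<open>D\<close> acting as \<open>A\<close> is the generator of \<open>T\<close>; the values of \<open>A\<close>
  outside \<open>D\<close> are irrelevant.\<close>

definition infinitesimal_generator ::
    "'a::complex_vector set \<Rightarrow> ('a \<Rightarrow> real) \<Rightarrow> (real \<Rightarrow> 'a \<Rightarrow> 'a) \<Rightarrow> 'a set \<Rightarrow> ('a \<Rightarrow> 'a) \<Rightarrow> bool" where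
  "infinitesimal_generator X N T D A \<longleftrightarrow>
     D = {x \<in> X. \<exists>y\<in>X. ((\<lambda>h. N ((1 / h) *\<^sub>R (T h x - x) - y)) \<longlongrightarrow> 0) (at_right 0)} \<and>
     (\<forall>x\<in>D. A x \<in> X \<and> ((\<lambda>h. N ((1 / h) *\<^sub>R (T h x - x) - A x)) \<longlongrightarrow> 0) (at_right 0))"

definition graph_norm :: "('a::complex_vector \<Rightarrow> real) \<Rightarrow> ('a \<Rightarrow> 'a) \<Rightarrow> 'a \<Rightarrow> real" where
  "graph_norm N A x = N x + N (A x)"

definition continuous_into ::
    "real set \<Rightarrow> 'a::complex_vector set \<Rightarrow> ('a \<Rightarrow> real) \<Rightarrow> (real \<Rightarrow> 'a) \<Rightarrow> bool" where
  "continuous_into J X N u \<longleftrightarrow>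
     (\<forall>t\<in>J. u t \<in> X \<and> ((\<lambda>s. N (u s - u t)) \<longlongrightarrow> 0) (at t within J))"

definition has_derivative_into ::
    "real set \<Rightarrow> ('a::complex_vector \<Rightarrow> real) \<Rightarrow> (real \<Rightarrow> 'a) \<Rightarrow> 'a \<Rightarrow> real \<Rightarrow> bool" where
  "has_derivative_into J N u d t \<longleftrightarrow>
     ((\<lambda>s. N ((1 / (s - t)) *\<^sub>R (u s - u t) - d)) \<longlongrightarrow> 0) (at t within J)"

text \<open>At an endpoint belonging to \<open>J\<close> the derivative is one-sided.\<close>

definition C1_into ::
    "real set \<Rightarrow> 'a::complex_vector set \<Rightarrow> ('a \<Rightarrow> real) \<Rightarrow> (real \<Rightarrow> 'a) \<Rightarrow> bool" where
  "C1_into J X N u \<longleftrightarrow>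
     continuous_into J X N u \<and>
     (\<exists>u'. continuous_into J X N u' \<and> (\<forall>t\<in>J. has_derivative_into J N u (u' t) t))"

text \<open>Riemann integral over \<open>[a,b]\<close>: as in the library's Henstock-Kurzweil integral, but with
  gauges of constant radius and with convergence measured by \<open>N\<close>.\<close>

definition has_riemann_integral_into ::
    "('a::complex_vector \<Rightarrow> real) \<Rightarrow> (real \<Rightarrow> 'a) \<Rightarrow> real \<Rightarrow> real \<Rightarrow> 'a \<Rightarrow> bool" where
  "has_riemann_integral_into N u a b y \<longleftrightarrow>
     (\<forall>e>0. \<exists>d>0. \<forall>p. p tagged_division_of {a..b} \<and> (\<lambda>x. ball x d) fine p \<longrightarrow>
        N ((\<Sum>(x, K)\<in>p. measure lborel K *\<^sub>R u x) - y) < e)"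

text \<open>Mild solution of \<open>U' = A U\<close>, \<open>U(0) = U\<^sub>0\<close>:  \<open>U\<close> is continuous and, for all \<open>t \<ge> 0\<close>, the
  integral of \<open>U\<close> over \<open>[0,t]\<close> lies in the domain and \<open>U(t) = U\<^sub>0 + A (\<integral>\<^sub>0\<^sup>t U(s) ds)\<close>
  (Engel and Nagel, One-Parameter Semigroups for Linear Evolution Equations, II.6.3).\<close>

definition mild_solution ::
    "'a::complex_vector set \<Rightarrow> ('a \<Rightarrow> real) \<Rightarrow> 'a set \<Rightarrow> ('a \<Rightarrow> 'a) \<Rightarrow> 'a \<Rightarrow> (real \<Rightarrow> 'a) \<Rightarrow> bool" where
  "mild_solution X N D A U\<^sub>0 U \<longleftrightarrow>
     continuous_into {0..} X N U \<and>
     (\<forall>t\<ge>0. \<exists>I\<in>D. has_riemann_integral_into N U 0 t I \<and> U t = U\<^sub>0 + A I)"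

text \<open>Classical solution as in Pazy, Semigroups of Linear Operators and Applications to Partial
  Differential Equations, Section 4.1: continuous on \<open>[0,\<infinity>)\<close>, continuously differentiable with
  values in the domain for \<open>t > 0\<close>, where the equation holds.\<close>

definition classical_solution ::
    "'a::complex_vector set \<Rightarrow> ('a \<Rightarrow> real) \<Rightarrow> 'a set \<Rightarrow> ('a \<Rightarrow> 'a) \<Rightarrow> 'a \<Rightarrow> (real \<Rightarrow> 'a) \<Rightarrow> bool" where
  "classical_solution X N D A U\<^sub>0 U \<longleftrightarrow>
     continuous_into {0..} X N U \<and> C1_into {0<..} X N U \<and>
     (\<forall>t>0. U t \<in> D \<and> has_derivative_into {0<..} N U (A (U t)) t) \<and>
     U 0 = U\<^sub>0"


section \<open>Complex \<open>L\<^sup>2\<close> functions on the real line\<close>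

definition square_integrable :: "(real \<Rightarrow> complex) \<Rightarrow> bool" where
  "square_integrable f \<longleftrightarrow>
     f \<in> borel_measurable lborel \<and> integrable lborel (\<lambda>x. (cmod (f x))\<^sup>2)"

lemma square_integrable_0: "square_integrable (\<lambda>_. 0)"
  by (simp add: square_integrable_def)

lemma square_integrable_add:
  assumes "square_integrable f" "square_integrable g"
  shows "square_integrable (\<lambda>x. f x + g x)"
proof -
  have [measurable]: "f \<in> borel_measurable lborel" "g \<in> borel_measurable lborel"
    using assms by (auto simp: square_integrable_def)
  have "integrable lborel (\<lambda>x. 2 * (cmod (f x))\<^sup>2 + 2 * (cmod (g x))\<^sup>2)"
    using assms by (auto simp: square_integrable_def)
  then have "integrable lborel (\<lambda>x. (cmod (f x + g x))\<^sup>2)"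
  proof (rule Bochner_Integration.integrable_bound)
    show "AE x in lborel. norm ((cmod (f x + g x))\<^sup>2)
        \<le> norm (2 * (cmod (f x))\<^sup>2 + 2 * (cmod (g x))\<^sup>2)"
    proof (rule AE_I2)
      fix x
      have "(cmod (f x + g x))\<^sup>2 \<le> (cmod (f x) + cmod (g x))\<^sup>2"
        by (intro power_mono norm_triangle_ineq) simp
      also have "\<dots> \<le> 2 * (cmod (f x))\<^sup>2 + 2 * (cmod (g x))\<^sup>2"
        using zero_le_power2[of "cmod (f x) - cmod (g x)"]
        unfolding power2_diff power2_sum by linarith
      finally show "norm ((cmod (f x + g x))\<^sup>2) \<le> norm (2 * (cmod (f x))\<^sup>2 + 2 * (cmod (g x))\<^sup>2)"
        by simp
    qed
  qed measurable
  then show ?thesis by (simp add: square_integrable_def)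
qed

lemma square_integrable_mult:
  assumes "square_integrable f"
  shows "square_integrable (\<lambda>x. c * f x)"
proof -
  have [measurable]: "f \<in> borel_measurable lborel"
    using assms by (auto simp: square_integrable_def)
  show ?thesis
    using assms by (auto simp: square_integrable_def norm_mult power_mult_distrib)
qed

lemma integrable_inner_square_integrable:
  assumes "square_integrable f" "square_integrable g"
  shows "integrable lborel (\<lambda>x. f x \<bullet> g x)"
proof -
  have [measurable]: "f \<in> borel_measurable lborel" "g \<in> borel_measurable lborel"
    using assms by (auto simp: square_integrable_def)
  have "integrable lborel (\<lambda>x. (cmod (f x))\<^sup>2 + (cmod (g x))\<^sup>2)"
    using assms by (auto simp: square_integrable_def)
  then show ?thesis
  proof (rule Bochner_Integration.integrable_bound)
    show "AE x in lborel. norm (f x \<bullet> g x) \<le> norm ((cmod (f x))\<^sup>2 + (cmod (g x))\<^sup>2)"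
    proof (rule AE_I2)
      fix x
      have "\<bar>f x \<bullet> g x\<bar> \<le> cmod (f x) * cmod (g x)" by (rule Cauchy_Schwarz_ineq2)
      also have "\<dots> \<le> (cmod (f x))\<^sup>2 + (cmod (g x))\<^sup>2"
      proof -
        have "0 \<le> (cmod (f x) - cmod (g x))\<^sup>2" "0 \<le> cmod (f x) * cmod (g x)" by auto
        then show ?thesis unfolding power2_diff by linarith
      qed
      finally show "norm (f x \<bullet> g x) \<le> norm ((cmod (f x))\<^sup>2 + (cmod (g x))\<^sup>2)" by simp
    qed
  qed measurable
qed

definition l2_rel :: "(real \<Rightarrow> complex) \<Rightarrow> (real \<Rightarrow> complex) \<Rightarrow> bool" where
  "l2_rel f g \<longleftrightarrow> square_integrable f \<and> square_integrable g \<and> (AE x in lborel. f x = g x)"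

quotient_type l2 = "real \<Rightarrow> complex" / partial: l2_rel
  morphisms rep_l2 abs_l2
proof (rule part_equivpI)
  show "\<exists>f. l2_rel f f"
    by (auto simp: l2_rel_def intro!: exI[of _ "\<lambda>_. 0"] square_integrable_0)
  show "symp l2_rel"
    by (auto simp: symp_def l2_rel_def elim: AE_mp)
  show "transp l2_rel"
    unfolding transp_def l2_rel_def by (auto elim: AE_mp)
qed

instantiation l2 :: complex_vector
begin

lift_definition zero_l2 :: l2 is "\<lambda>_. 0"
  by (simp add: l2_rel_def square_integrable_0)

lift_definition plus_l2 :: "l2 \<Rightarrow> l2 \<Rightarrow> l2" is "\<lambda>f g x. f x + g x"
  unfolding l2_rel_def by (auto intro: square_integrable_add elim!: AE_mp)

lift_definition scaleC_l2 :: "complex \<Rightarrow> l2 \<Rightarrow> l2" is "\<lambda>c f x. c * f x"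
  unfolding l2_rel_def by (auto intro: square_integrable_mult elim!: AE_mp)

definition scaleR_l2 :: "real \<Rightarrow> l2 \<Rightarrow> l2" where
  "scaleR_l2 r f = complex_of_real r *\<^sub>C f"

definition uminus_l2 :: "l2 \<Rightarrow> l2" where
  "uminus_l2 f = (- 1) *\<^sub>C f"

definition minus_l2 :: "l2 \<Rightarrow> l2 \<Rightarrow> l2" where
  "minus_l2 f g = f + (- 1) *\<^sub>C g"

instance
proof
  fix f g h :: l2 and c d :: complex and r s :: real
  show add_assoc: "f + g + h = f + (g + h)"
    by transfer (auto simp: l2_rel_def add.assoc intro!: square_integrable_add)
  show "f + g = g + f"
    by transfer (auto simp: l2_rel_def add.commute intro!: square_integrable_add)
  show "0 + f = f"
    by transfer (auto simp: l2_rel_def)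
  show "- f + f = 0"
    unfolding uminus_l2_def
    by transfer (auto simp: l2_rel_def square_integrable_0)
  show "f - g = f + - g"
    by (simp add: minus_l2_def uminus_l2_def)
  show dr: "c *\<^sub>C (f + g) = c *\<^sub>C f + c *\<^sub>C g" for c and f g :: l2
    by transfer (auto simp: l2_rel_def distrib_left intro!: square_integrable_add square_integrable_mult)
  show dl: "(c + d) *\<^sub>C f = c *\<^sub>C f + d *\<^sub>C f" for c d and f :: l2
    by transfer (auto simp: l2_rel_def distrib_right
        intro!: square_integrable_add square_integrable_mult[of _ "c + d" for c d, simplified distrib_right]
          square_integrable_mult)
  show as: "c *\<^sub>C (d *\<^sub>C f) = (c * d) *\<^sub>C f" for c d and f :: l2
    by transfer (auto simp: l2_rel_def mult.assoc intro!: square_integrable_mult)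
  show "complex_of_real r *\<^sub>C f = r *\<^sub>R f"
    by (simp add: scaleR_l2_def)
  show "r *\<^sub>R (f + g) = r *\<^sub>R f + r *\<^sub>R g"
    by (simp add: scaleR_l2_def dr)
  show "(r + s) *\<^sub>R f = r *\<^sub>R f + s *\<^sub>R f"
    by (simp add: scaleR_l2_def dl)
  show "r *\<^sub>R s *\<^sub>R f = (r * s) *\<^sub>R f"
    by (simp add: scaleR_l2_def as)
  show "1 *\<^sub>R f = f"
    unfolding scaleR_l2_def by transfer (auto simp: l2_rel_def)
qed

end

text \<open>The library class \<open>real_inner\<close> asks for the real part of the \<open>L\<^sup>2\<close> inner product (\<open>\<bullet>\<close> on
  \<open>complex\<close> is \<open>Re (z * cnj w)\<close>); the norm is the usual \<open>L\<^sup>2\<close> norm.\<close>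

instantiation l2 :: real_inner
begin

lift_definition inner_l2 :: "l2 \<Rightarrow> l2 \<Rightarrow> real" is "\<lambda>f g. LINT x|lborel. f x \<bullet> g x"
  unfolding l2_rel_def square_integrable_def
  by (rule integral_cong_AE) (auto elim!: AE_mp)

lift_definition norm_l2 :: "l2 \<Rightarrow> real" is "\<lambda>f. sqrt (LINT x|lborel. (cmod (f x))\<^sup>2)"
  unfolding l2_rel_def square_integrable_def
  by (rule arg_cong[where f = sqrt], rule integral_cong_AE) (auto elim!: AE_mp)

definition sgn_l2 :: "l2 \<Rightarrow> l2" where
  "sgn_l2 f = inverse (norm f) *\<^sub>R f"

definition dist_l2 :: "l2 \<Rightarrow> l2 \<Rightarrow> real" where
  "dist_l2 f g = norm (f - g)"

definition uniformity_l2 :: "(l2 \<times> l2) filter" where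
  "uniformity_l2 = (INF e\<in>{0<..}. principal {(f, g). dist f g < e})"

definition open_l2 :: "l2 set \<Rightarrow> bool" where
  "open_l2 S \<longleftrightarrow> (\<forall>x\<in>S. \<forall>\<^sub>F (x', y) in uniformity. x' = x \<longrightarrow> y \<in> S)"

instance
proof
  fix f g h :: l2 and r :: real and S :: "l2 set"
  show "sgn f = f /\<^sub>R norm f" by (rule sgn_l2_def)
  show "dist f g = norm (f - g)" by (rule dist_l2_def)
  show "(uniformity :: (l2 \<times> l2) filter) = (INF e\<in>{0<..}. principal {(f, g). dist f g < e})"
    by (rule uniformity_l2_def)
  show "open S \<longleftrightarrow> (\<forall>x\<in>S. \<forall>\<^sub>F (x', y) in uniformity. x' = x \<longrightarrow> y \<in> S)"
    by (rule open_l2_def)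
  show "f \<bullet> g = g \<bullet> f"
    by transfer (simp add: inner_commute)
  show "(f + g) \<bullet> h = f \<bullet> h + g \<bullet> h"
    by transfer (simp add: l2_rel_def inner_add_left integrable_inner_square_integrable)
  show "(r *\<^sub>R f) \<bullet> g = r * (f \<bullet> g)"
    unfolding scaleR_l2_def
    by transfer (simp add: scaleR_conv_of_real[symmetric])
  show "0 \<le> f \<bullet> f"
    by transfer simp
  show "(f \<bullet> f = 0) = (f = 0)"
  proof transfer
    fix f assume "l2_rel f f"
    then have "square_integrable f" by (simp add: l2_rel_def)
    then have "(LINT x|lborel. f x \<bullet> f x) = 0 \<longleftrightarrow> (AE x in lborel. f x \<bullet> f x = 0)"
      by (intro integral_nonneg_eq_0_iff_AE integrable_inner_square_integrable) auto
    then show "((LINT x|lborel. f x \<bullet> f x) = 0) = l2_rel f (\<lambda>_. 0)"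
      using \<open>square_integrable f\<close> by (simp add: l2_rel_def square_integrable_0)
  qed
  show "norm f = sqrt (f \<bullet> f)"
    by transfer (simp add: dot_square_norm)
qed

end


section \<open>Function spaces on \<open>(0, L)\<close>\<close>

text \<open>\<open>L\<^sup>2(0,L)\<close> is identified with the classes in \<open>L\<^sup>2(\<real>)\<close> vanishing almost everywhere outside
  \<open>(0,L)\<close> (extension by zero).  Consequently the norm of \<^typ>\<open>l2\<close> restricts to the norm of
  \<open>L\<^sup>2(0,L)\<close>.  Derivatives below are derivatives on \<open>(0,L)\<close>, extended by zero, not
  derivatives of the extended function.\<close>

definition L2_space :: "real \<Rightarrow> l2 set" where
  "L2_space L = {f. AE x in lborel. x \<notin> {0<..<L} \<longrightarrow> rep_l2 f x = 0}"

definition L2_mean_zero :: "real \<Rightarrow> l2 set" where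
  "L2_mean_zero L = {f \<in> L2_space L. (LINT x:{0<..<L}|lborel. rep_l2 f x) = 0}"

definition smooth :: "(real \<Rightarrow> complex) \<Rightarrow> bool" where
  "smooth f \<longleftrightarrow> (\<forall>k x. ((\<lambda>g y. vector_derivative g (at y)) ^^ k) f differentiable at x)"

definition test_function :: "real \<Rightarrow> (real \<Rightarrow> complex) \<Rightarrow> bool" where
  "test_function L \<eta> \<longleftrightarrow> smooth \<eta> \<and>
     compact (closure {x. \<eta> x \<noteq> 0}) \<and> closure {x. \<eta> x \<noteq> 0} \<subseteq> {0<..<L}"

definition weak_derivative :: "real \<Rightarrow> l2 \<Rightarrow> l2 \<Rightarrow> bool" where
  "weak_derivative L u w \<longleftrightarrow> (\<forall>\<eta>. test_function L \<eta> \<longrightarrow>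
     (LINT x:{0<..<L}|lborel. rep_l2 u x * vector_derivative \<eta> (at x)) =
       - (LINT x:{0<..<L}|lborel. rep_l2 w x * \<eta> x))"

definition H1_space :: "real \<Rightarrow> l2 set" where
  "H1_space L = {u \<in> L2_space L. \<exists>w\<in>L2_space L. weak_derivative L u w}"

text \<open>Meaningful for \<open>u \<in> H\<^sup>1(0,L)\<close> only, where the weak derivative is unique.\<close>

definition Dx :: "real \<Rightarrow> l2 \<Rightarrow> l2" where
  "Dx L u = (THE w. w \<in> L2_space L \<and> weak_derivative L u w)"

definition H1_norm :: "real \<Rightarrow> l2 \<Rightarrow> real" where
  "H1_norm L u = sqrt ((norm u)\<^sup>2 + (norm (Dx L u))\<^sup>2)"

text \<open>The closure of the test functions in \<open>H\<^sup>1(0,L)\<close>.\<close>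

definition H10_space :: "real \<Rightarrow> l2 set" where
  "H10_space L = {u \<in> H1_space L. \<forall>e>0. \<exists>\<eta>. test_function L \<eta> \<and> H1_norm L (u - abs_l2 \<eta>) < e}"

definition H2_space :: "real \<Rightarrow> l2 set" where
  "H2_space L = {u \<in> H1_space L. Dx L u \<in> H1_space L}"

definition H1_mean_zero :: "real \<Rightarrow> l2 set" where
  "H1_mean_zero L = H1_space L \<inter> L2_mean_zero L"


section \<open>The thermoelastic system\<close>

text \<open>States are \<open>U = (u, v, \<phi>, \<Phi>, \<psi>, \<Psi>, \<theta>, q)\<close>.\<close>

type_synonym state = "l2 \<times> l2 \<times> l2 \<times> l2 \<times> l2 \<times> l2 \<times> l2 \<times> l2"

definition state_space :: "real \<Rightarrow> state set" where
  "state_space L =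
     H1_mean_zero L \<times> L2_mean_zero L \<times> H1_mean_zero L \<times> L2_mean_zero L \<times>
     H10_space L \<times> L2_space L \<times> L2_space L \<times> L2_space L"

definition state_norm ::
    "real \<Rightarrow> real \<Rightarrow> real \<Rightarrow> real \<Rightarrow> real \<Rightarrow> real \<Rightarrow> real \<Rightarrow> real \<Rightarrow> real \<Rightarrow> real \<Rightarrow> state \<Rightarrow> real" where
  "state_norm L \<rho> \<rho>\<^sub>1 \<rho>\<^sub>2 \<rho>\<^sub>3 \<alpha> \<kappa> b \<tau> \<beta> = (\<lambda>(u, v, \<phi>, \<Phi>, \<psi>, \<Psi>, \<theta>, q).
     sqrt (\<rho> * (norm v)\<^sup>2 + \<alpha> * (norm (Dx L u))\<^sup>2 + \<rho>\<^sub>1 * (norm \<Phi>)\<^sup>2 + \<rho>\<^sub>2 * (norm \<Psi>)\<^sup>2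
       + b * (norm (Dx L \<psi>))\<^sup>2 + \<beta> * (norm (\<phi> - u))\<^sup>2 + \<kappa> * (norm (Dx L \<phi> + \<psi>))\<^sup>2
       + \<rho>\<^sub>3 * (norm \<theta>)\<^sup>2 + \<tau> * (norm q)\<^sup>2))"

definition A1_domain :: "real \<Rightarrow> state set" where
  "A1_domain L = {(u, v, \<phi>, \<Phi>, \<psi>, \<Psi>, \<theta>, q).
     (u, v, \<phi>, \<Phi>, \<psi>, \<Psi>, \<theta>, q) \<in> state_space L \<and>
     v \<in> H1_mean_zero L \<and> \<Phi> \<in> H1_mean_zero L \<and>
     Dx L u \<in> H10_space L \<and> Dx L \<phi> \<in> H10_space L \<and> \<theta> \<in> H10_space L \<and> \<Psi> \<in> H10_space L \<and>
     \<psi> \<in> H2_space L \<and> q \<in> H1_space L}"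

definition A1 ::
    "real \<Rightarrow> real \<Rightarrow> real \<Rightarrow> real \<Rightarrow> real \<Rightarrow> real \<Rightarrow> real \<Rightarrow> real \<Rightarrow> real \<Rightarrow> real \<Rightarrow> real \<Rightarrow> real \<Rightarrow> real
      \<Rightarrow> state \<Rightarrow> state" where
  "A1 L \<rho> \<rho>\<^sub>1 \<rho>\<^sub>2 \<rho>\<^sub>3 \<alpha> \<kappa> b \<tau> \<sigma> \<beta> \<gamma> m = (\<lambda>(u, v, \<phi>, \<Phi>, \<psi>, \<Psi>, \<theta>, q).
     ( v,
       (1 / \<rho>) *\<^sub>R (\<alpha> *\<^sub>R Dx L (Dx L u) + \<beta> *\<^sub>R (\<phi> - u) - \<gamma> *\<^sub>R v),
       \<Phi>,
       (1 / \<rho>\<^sub>1) *\<^sub>R (\<kappa> *\<^sub>R Dx L (Dx L \<phi> + \<psi>) - \<beta> *\<^sub>R (\<phi> - u) - m *\<^sub>R Dx L \<theta>),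
       \<Psi>,
       (1 / \<rho>\<^sub>2) *\<^sub>R (b *\<^sub>R Dx L (Dx L \<psi>) - \<kappa> *\<^sub>R (Dx L \<phi> + \<psi>) + m *\<^sub>R \<theta>),
       (1 / \<rho>\<^sub>3) *\<^sub>R (- Dx L q - m *\<^sub>R (Dx L \<Phi> + \<Psi>)),
       (1 / \<tau>) *\<^sub>R (- \<sigma> *\<^sub>R q - Dx L \<theta>) ))"

end

theory Submission
  imports Defs
begin

text \<open>
  The energy norm makes \<open>J U = (\<rho>\<^bsup>1/2\<^esup> v, \<alpha>\<^bsup>1/2\<^esup> u\<^sub>x, \<dots>, \<beta>\<^bsup>1/2\<^esup> (\<phi> - u), \<kappa>\<^bsup>1/2\<^esup> (\<phi>\<^sub>x + \<psi>), \<dots>)\<close> an isometry of the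
  state space onto a closed subspace of \<open>L\<^sup>2(0,L)\<^sup>9\<close>, and \<open>J A U = (B + P) J U\<close> with \<open>B\<close> first order and
  skew-symmetric, \<open>P\<close> bounded and dissipative.  Up to decoupled blocks \<open>B\<close> is built from a closed
  operator \<open>T\<close> on \<open>H\<^sub>0\<^sup>1\<close> and its adjoint, so the range condition for \<open>B\<close> is an orthogonal projection
  onto the graph of \<open>T\<close> (von Neumann); a contraction argument adds \<open>P\<close>.  For a maximal dissipative
  operator the powers of the resolvent converge to the semigroup by the Crandall--Liggett estimate.
\<close>

section \<open>Orthogonal projection\<close>

text \<open>The state space is a set with a norm of its own, so limits, integrals and projections
  are carried out in the Hilbert type \<open>model\<close> and pulled back through \<open>J\<close>.
  The energy coordinates also avoid second order elliptic problems: every derivative in B couples a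
  component in \<open>H1\<close> with one in \<open>H10\<close>, so boundary terms vanish and
  solvability becomes a matter of adjoints. The price is that the nine coordinates are not
  independent and forget the mean zero conditions. The resolvent equation is therefore solved in the
  full product, and \<open>A_range\<close> shows that data coming from a state force a solution
  coming from a state in the domain. The contraction argument for P works only for small parameters,
  whence the bound \<delta> on the resolvents used. The whole semigroup construction needs only the
  real inner product; complex linearity is recovered at the end, because resolvents commute with
  every bounded operator that commutes with the generator.\<close>

lemma hilbert_projection:
  fixes S :: "'a::{real_inner,banach} set"
  assumes S: "subspace S" "closed S"
  shows "\<exists>p\<in>S. \<forall>s\<in>S. (x - p) \<bullet> s = 0"
proof -
  define Q where "Q = (\<lambda>s. (norm (x - s))\<^sup>2) ` S"
  have bdd: "bdd_below Q"
    unfolding Q_def by (rule bdd_belowI[of _ 0]) auto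
  have "0 \<in> S" using S subspace_0 by blast
  then have ne: "Q \<noteq> {}" by (auto simp: Q_def)
  define d where "d = Inf Q"
  have dle: "d \<le> (norm (x - s))\<^sup>2" if "s \<in> S" for s
    unfolding d_def using bdd that by (intro cInf_lower) (auto simp: Q_def)
  have "\<exists>s\<in>S. (norm (x - s))\<^sup>2 < d + 1 / real (Suc n)" for n
    using cInf_lessD[OF ne, of "d + 1 / real (Suc n)"] by (auto simp: d_def Q_def)
  then obtain s where s: "\<And>n. s n \<in> S" "\<And>n. (norm (x - s n))\<^sup>2 < d + 1 / real (Suc n)"
    by metis
  \<comment> \<open>Parallelogram identity: the midpoint lies in \<open>S\<close>, so its squared
    distance to \<open>x\<close> is at least \<open>d\<close>.\<close>
  have par: "(norm (s n - s k))\<^sup>2 \<le> 2 / real (Suc n) + 2 / real (Suc k)" for n k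
  proof -
    have "(1/2) *\<^sub>R (s n + s k) \<in> S" using S s(1) by (intro subspace_mul subspace_add)
    then have "d \<le> (norm (x - (1/2) *\<^sub>R (s n + s k)))\<^sup>2" by (rule dle)
    moreover have "(norm (s n - s k))\<^sup>2 + 4 * (norm (x - (1/2) *\<^sub>R (s n + s k)))\<^sup>2
        = 2 * (norm (x - s n))\<^sup>2 + 2 * (norm (x - s k))\<^sup>2"
      by (simp add: power2_norm_eq_inner inner_diff_left inner_diff_right inner_add_left
          inner_add_right inner_commute algebra_simps)
    ultimately show ?thesis using s(2)[of n] s(2)[of k] by simp
  qed
  have "Cauchy s"
  proof (rule metric_CauchyI)
    fix e :: real assume "0 < e"
    then obtain M where M: "4 / e\<^sup>2 < real M" using reals_Archimedean2 by blast
    have "dist (s n) (s k) < e" if "M \<le> n" "M \<le> k" for n k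
    proof -
      have M0: "0 < real M" using M \<open>0 < e\<close> by (smt (verit) divide_pos_pos zero_less_power)
      have "2 / real (Suc n) \<le> 2 / real M" "2 / real (Suc k) \<le> 2 / real M"
        using that M0 by (auto intro!: divide_left_mono)
      then have "(norm (s n - s k))\<^sup>2 \<le> 4 / real M" using par[of n k] by simp
      also have "\<dots> < e\<^sup>2" using M M0 \<open>0 < e\<close> by (simp add: field_simps)
      finally have "norm (s n - s k) < e"
        using \<open>0 < e\<close> power2_less_imp_less less_imp_le by blast
      then show ?thesis by (simp add: dist_norm)
    qed
    then show "\<exists>M. \<forall>m\<ge>M. \<forall>n\<ge>M. dist (s m) (s n) < e" by blast
  qed
  then obtain p where p: "s \<longlonglongrightarrow> p" using Cauchy_convergent_iff convergent_def by blast
  have pS: "p \<in> S" using S(2) s(1) p closed_sequentially by blast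
  have "(norm (x - p))\<^sup>2 \<le> d"
  proof (rule LIMSEQ_le[where X = "\<lambda>n. (norm (x - s n))\<^sup>2" and Y = "\<lambda>n. d + 1 / real (Suc n)"])
    show "(\<lambda>n. (norm (x - s n))\<^sup>2) \<longlonglongrightarrow> (norm (x - p))\<^sup>2"
      by (intro tendsto_intros p)
    show "(\<lambda>n. d + 1 / real (Suc n)) \<longlonglongrightarrow> d"
      using tendsto_add[OF tendsto_const[of d] LIMSEQ_inverse_real_of_nat] by (simp add: inverse_eq_divide)
  qed (use s(2) in \<open>auto intro: less_imp_le\<close>)
  then have min: "(norm (x - p))\<^sup>2 \<le> (norm (x - p - t *\<^sub>R w))\<^sup>2" if "w \<in> S" for t w
    using dle[of "p + t *\<^sub>R w"] that pS S order_trans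
    by (simp only: subspace_add subspace_mul diff_diff_add) blast
  have "(x - p) \<bullet> w = 0" if "w \<in> S" for w
  proof (rule ccontr)
    assume ne: "(x - p) \<bullet> w \<noteq> 0"
    then have w: "0 < w \<bullet> w" by auto
    \<comment> \<open>The minimiser of the quadratic in \<open>t\<close> expanded in the next
      step.\<close>
    define t where "t = ((x - p) \<bullet> w) / (w \<bullet> w)"
    have "(norm (x - p - t *\<^sub>R w))\<^sup>2 = (norm (x - p))\<^sup>2 - 2 * t * ((x - p) \<bullet> w) + t * t * (w \<bullet> w)"
      by (simp add: power2_norm_eq_inner inner_diff_left inner_diff_right inner_commute algebra_simps)
    then have "2 * t * ((x - p) \<bullet> w) \<le> t * t * (w \<bullet> w)" using min[OF that, of t] by simp
    then have "((x - p) \<bullet> w)\<^sup>2 \<le> 0" using w by (simp add: t_def power2_eq_square field_simps)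
    then show False using ne by simp
  qed
  with pS show ?thesis by blast
qed

lemma subspace_closure:
  fixes S :: "'a::real_normed_vector set"
  assumes "subspace S"
  shows "subspace (closure S)"
proof (rule subspaceI)
  show "0 \<in> closure S" using assms closure_subset subspace_0 by blast
next
  fix x y assume "x \<in> closure S" "y \<in> closure S"
  then obtain f g where "\<And>n. f n \<in> S" "f \<longlonglongrightarrow> x" "\<And>n. g n \<in> S" "g \<longlonglongrightarrow> y"
    by (auto simp: closure_sequential)
  then show "x + y \<in> closure S"
    unfolding closure_sequential
    by (intro exI[of _ "\<lambda>n. f n + g n"]) (auto intro: tendsto_add subspace_add[OF assms])
next
  fix x and c :: real assume "x \<in> closure S"
  then obtain f where "\<And>n. f n \<in> S" "f \<longlonglongrightarrow> x" by (auto simp: closure_sequential)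
  then show "c *\<^sub>R x \<in> closure S"
    unfolding closure_sequential
    by (intro exI[of _ "\<lambda>n. c *\<^sub>R f n"]) (auto intro: tendsto_scaleR subspace_mul[OF assms])
qed

text \<open>The error of projecting the integral onto \<open>S\<close> is orthogonal to every value
  of \<open>f\<close>, hence to the integral and to its projection, and so to itself.\<close>

lemma integral_in_closed_subspace:
  fixes f :: "real \<Rightarrow> 'a::{real_inner,banach}"
  assumes S: "subspace S" "closed S" and f: "continuous_on {a..b} f" "\<And>t. t \<in> {a..b} \<Longrightarrow> f t \<in> S"
  shows "integral {a..b} f \<in> S"
proof -
  obtain p where p: "p \<in> S" "\<And>s. s \<in> S \<Longrightarrow> (integral {a..b} f - p) \<bullet> s = 0"
    using hilbert_projection[OF S] by blast
  let ?d = "integral {a..b} f - p"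
  have "?d \<bullet> integral {a..b} f = integral {a..b} (\<lambda>t. ?d \<bullet> f t)"
    using integral_linear[OF integrable_continuous_real[OF f(1)] bounded_linear_inner_right[of ?d]]
    by (simp add: o_def)
  also have "\<dots> = integral {a..b} (\<lambda>t. 0)"
    using p(2) f(2) by (intro integral_cong) auto
  finally have "?d \<bullet> ?d = 0" using p by (simp add: inner_diff_right)
  then show ?thesis using p by simp
qed

section \<open>The semigroup of a maximal dissipative operator\<close>

lemma sqrt_convex_comb_le:
  fixes p q x y :: real
  assumes "0 \<le> p" "0 \<le> q" "p + q = 1" "0 \<le> x" "0 \<le> y"
  shows "p * sqrt x + q * sqrt y \<le> sqrt (p * x + q * y)"
proof (rule real_le_rsqrt)
  have "p * x + q * y - (p * sqrt x + q * sqrt y)\<^sup>2 = p * q * (sqrt x - sqrt y)\<^sup>2"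
  proof -
    have "q = 1 - p" "(sqrt x)\<^sup>2 = x" "(sqrt y)\<^sup>2 = y" using assms by auto
    then show ?thesis
      by (simp add: power2_sum power2_diff power_mult_distrib) (simp add: algebra_simps power2_eq_square)
  qed
  moreover have "0 \<le> p * q * (sqrt x - sqrt y)\<^sup>2" using assms by simp
  ultimately show "(p * sqrt x + q * sqrt y)\<^sup>2 \<le> p * x + q * y" by linarith
qed

text \<open>A squared time lag plus a variance. For the walk that moves from (m, n) to (m, n - 1)
  with probability l/(l+k) and to (m - 1, n) with probability k/(l+k), the lag m l - n k has
  increments of mean 0 and variance l k, which is exactly the mean loss of the other two
  terms.\<close>

definition rad :: "real \<Rightarrow> nat \<Rightarrow> real \<Rightarrow> nat \<Rightarrow> real" where
  "rad l m k n = (real m * l - real n * k)\<^sup>2 + real m * l\<^sup>2 + real n * k\<^sup>2"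

lemma rad_nonneg: "0 \<le> rad l m k n"
  by (simp add: rad_def)

lemma rad_harmonic:
  assumes "0 < l" "0 < k"
  shows "l / (l + k) * rad l (Suc m) k n + k / (l + k) * rad l m k (Suc n) = rad l (Suc m) k (Suc n)"
proof -
  have "l * rad l (Suc m) k n + k * rad l m k (Suc n) = (l + k) * rad l (Suc m) k (Suc n)"
    by (simp add: rad_def power2_eq_square algebra_simps)
  moreover have "l / (l + k) * rad l (Suc m) k n + k / (l + k) * rad l m k (Suc n)
      = (l * rad l (Suc m) k n + k * rad l m k (Suc n)) / (l + k)"
    by (simp add: add_divide_distrib)
  ultimately show ?thesis using assms by simp
qed

text \<open>The carrier \<open>Y\<close> is explicit because the operator will act on the image of
  the state space inside a larger Hilbert type. Solvability is asked only below \<delta>, which is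
  what a bounded perturbation argument supplies.\<close>

locale m_dissipative =
  fixes Y D :: "'h::{real_inner,banach} set" and A :: "'h \<Rightarrow> 'h" and \<delta> :: real
  assumes Y: "subspace Y" "closed Y" and D: "subspace D" "D \<subseteq> Y"
    and A_add: "x \<in> D \<Longrightarrow> y \<in> D \<Longrightarrow> A (x + y) = A x + A y"
    and A_scale: "x \<in> D \<Longrightarrow> A (r *\<^sub>R x) = r *\<^sub>R A x"
    and A_in: "x \<in> D \<Longrightarrow> A x \<in> Y"
    and dissipative: "x \<in> D \<Longrightarrow> A x \<bullet> x \<le> 0"
    and \<delta>: "0 < \<delta>"
    and range: "0 < l \<Longrightarrow> l < \<delta> \<Longrightarrow> y \<in> Y \<Longrightarrow> \<exists>x\<in>D. x - l *\<^sub>R A x = y"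
begin

section \<open>Resolvents of a maximal dissipative operator\<close>

lemma D_Y: "x \<in> D \<Longrightarrow> x \<in> Y"
  using D by blast

lemma D_add: "x \<in> D \<Longrightarrow> y \<in> D \<Longrightarrow> x + y \<in> D"
  and D_diff: "x \<in> D \<Longrightarrow> y \<in> D \<Longrightarrow> x - y \<in> D"
  and D_scale: "x \<in> D \<Longrightarrow> r *\<^sub>R x \<in> D"
  and D_0: "0 \<in> D"
  using D by (auto simp: subspace_add subspace_diff subspace_mul subspace_0)

lemma Y_add: "x \<in> Y \<Longrightarrow> y \<in> Y \<Longrightarrow> x + y \<in> Y"
  and Y_diff: "x \<in> Y \<Longrightarrow> y \<in> Y \<Longrightarrow> x - y \<in> Y"
  and Y_scale: "x \<in> Y \<Longrightarrow> r *\<^sub>R x \<in> Y"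
  using Y by (auto simp: subspace_add subspace_diff subspace_mul)

lemma A_0: "A 0 = 0"
  using A_scale[OF D_0, of 0] by simp

lemma A_diff: "x \<in> D \<Longrightarrow> y \<in> D \<Longrightarrow> A (x - y) = A x - A y"
  using A_add[of x "(-1) *\<^sub>R y"] A_scale[of y "-1"] D_scale[of y "-1"] by simp

text \<open>Testing x - l A x with \<open>x\<close> produces the dissipative term with a favourable
  sign; Cauchy-Schwarz does the rest.\<close>

lemma norm_le_resolvent:
  assumes "x \<in> D" "0 \<le> l"
  shows "norm x \<le> norm (x - l *\<^sub>R A x)"
proof -
  have "norm x * norm x \<le> (x - l *\<^sub>R A x) \<bullet> x"
    using mult_nonneg_nonpos[OF \<open>0 \<le> l\<close> dissipative[OF \<open>x \<in> D\<close>]]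
    by (simp add: inner_diff_left norm_eq_sqrt_inner)
  also have "\<dots> \<le> norm (x - l *\<^sub>R A x) * norm x" by (rule norm_cauchy_schwarz)
  finally show ?thesis by (cases "x = 0") auto
qed

definition R :: "real \<Rightarrow> 'h \<Rightarrow> 'h" where
  "R l y = (THE x. x \<in> D \<and> x - l *\<^sub>R A x = y)"

lemma R_eqI:
  assumes "x \<in> D" "x - l *\<^sub>R A x = y" "0 \<le> l"
  shows "R l y = x"
  unfolding R_def
proof (rule the_equality)
  fix z assume z: "z \<in> D \<and> z - l *\<^sub>R A z = y"
  have "norm (z - x) \<le> norm (z - x - l *\<^sub>R A (z - x))"
    using z assms by (intro norm_le_resolvent D_diff) auto
  also have "z - x - l *\<^sub>R A (z - x) = (z - l *\<^sub>R A z) - (x - l *\<^sub>R A x)"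
    using z assms(1) by (simp add: A_diff scaleR_diff_right algebra_simps)
  finally show "z = x" using z assms by simp
qed (use assms in simp)

lemma
  assumes "0 < l" "l < \<delta>" "y \<in> Y"
  shows R_D: "R l y \<in> D" and R_eq: "R l y - l *\<^sub>R A (R l y) = y"
proof -
  obtain x where "x \<in> D" "x - l *\<^sub>R A x = y" using range assms by blast
  moreover from this have "R l y = x" using assms by (intro R_eqI) auto
  ultimately show "R l y \<in> D" "R l y - l *\<^sub>R A (R l y) = y" by auto
qed

lemma R_Y: "0 < l \<Longrightarrow> l < \<delta> \<Longrightarrow> y \<in> Y \<Longrightarrow> R l y \<in> Y"
  using R_D D_Y by blast

lemma norm_R_le: "0 < l \<Longrightarrow> l < \<delta> \<Longrightarrow> y \<in> Y \<Longrightarrow> norm (R l y) \<le> norm y"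
  using norm_le_resolvent[OF R_D, of l y l] R_eq[of l y] by simp

lemma R_add: "0 < l \<Longrightarrow> l < \<delta> \<Longrightarrow> x \<in> Y \<Longrightarrow> y \<in> Y \<Longrightarrow> R l (x + y) = R l x + R l y"
  using arg_cong2[OF R_eq[of l x] R_eq[of l y], of "(+)"]
  by (intro R_eqI) (auto simp: A_add R_D D_add scaleR_add_right add_diff_add[symmetric])

lemma R_scale: "0 < l \<Longrightarrow> l < \<delta> \<Longrightarrow> x \<in> Y \<Longrightarrow> R l (r *\<^sub>R x) = r *\<^sub>R R l x"
  using arg_cong[OF R_eq[of l x], of "\<lambda>z. r *\<^sub>R z"]
  by (intro R_eqI) (auto simp: A_scale R_D D_scale scaleR_diff_right mult.commute)

lemma A_R_eq: "0 < l \<Longrightarrow> l < \<delta> \<Longrightarrow> y \<in> Y \<Longrightarrow> l *\<^sub>R A (R l y) = R l y - y"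
  using R_eq[of l y] by (simp add: algebra_simps)

text \<open>The resolvent equation gives \<open>A (R l x)\<close> as (R l x - x) / l, which stays in
  \<open>D\<close> for \<open>x\<close> in \<open>D\<close>; it then solves the equation that
  characterises \<open>R l (A x)\<close>.\<close>

lemma A_R:
  assumes "0 < l" "l < \<delta>" "x \<in> D"
  shows "A (R l x) = R l (A x)"
proof (rule R_eqI[symmetric])
  have e: "A (R l x) = (1/l) *\<^sub>R (R l x - x)"
    using A_R_eq[OF assms(1,2) D_Y[OF assms(3)]] assms(1) by (metis pth_1 divide_self_if
        less_irrefl mult.commute times_divide_eq_left scaleR_scaleR mult_1)
  have RD: "R l x - x \<in> D" using assms by (intro D_diff R_D D_Y) auto
  then show "A (R l x) \<in> D" unfolding e by (rule D_scale)
  have "l *\<^sub>R A (A (R l x)) = A (R l x - x)"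
    unfolding e using A_scale[OF RD, of "1/l"] assms(1) by simp
  then show "A (R l x) - l *\<^sub>R A (A (R l x)) = A x"
    using assms by (simp add: A_diff R_D D_Y)
qed (use assms in auto)

text \<open>In a Hilbert space maximality forces density: a vector orthogonal to \<open>D\<close> is
  \<open>x - l A x\<close> for some \<open>x \<in> D\<close>, and testing with \<open>x\<close> gives \<open>x = 0\<close>.\<close>

lemma dense: "Y \<subseteq> closure D"
proof
  fix y assume y: "y \<in> Y"
  obtain p where p: "p \<in> closure D" "\<And>s. s \<in> closure D \<Longrightarrow> (y - p) \<bullet> s = 0"
    using hilbert_projection[OF subspace_closure[OF D(1)] closed_closure] by blast
  have "closure D \<subseteq> Y" using D Y closure_minimal by blast
  then have "y - p \<in> Y" using y p Y_diff by blast
  then obtain x where x: "x \<in> D" "x - (\<delta>/2) *\<^sub>R A x = y - p"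
    using range[of "\<delta>/2" "y - p"] \<delta> by auto
  have "(x - (\<delta>/2) *\<^sub>R A x) \<bullet> x = 0" using p(2)[of x] x closure_subset by auto
  then have "x \<bullet> x \<le> 0"
    using mult_nonneg_nonpos[of "\<delta>/2", OF _ dissipative[OF x(1)]] \<delta> by (simp add: inner_diff_left)
  then have "x = 0" by (meson inner_eq_zero_iff inner_ge_zero order_antisym)
  then show "y \<in> closure D" using x p A_0 by simp
qed

lemma approx:
  assumes "y \<in> Y" "0 < e"
  obtains x where "x \<in> D" "norm (y - x) < e"
  using dense assms by (metis subsetD closure_approachable dist_norm norm_minus_commute)

text \<open>The n-th iterate of the backward Euler step, an approximation of the orbit of
  \<open>x\<close> at time n l.\<close>

definition E :: "real \<Rightarrow> nat \<Rightarrow> 'h \<Rightarrow> 'h" where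
  "E l n x = (R l ^^ n) x"

lemma E_0 [simp]: "E l 0 x = x"
  and E_Suc: "E l (Suc n) x = R l (E l n x)"
  and E_plus: "E l (m + n) x = E l m (E l n x)"
  by (simp_all add: E_def funpow_add)

context
  fixes l assumes l: "0 < l" "l < \<delta>"
begin

lemma E_Y: "x \<in> Y \<Longrightarrow> E l n x \<in> Y"
  by (induction n) (auto simp: E_Suc l R_Y)

lemma E_D: "x \<in> D \<Longrightarrow> E l n x \<in> D"
  by (induction n) (auto simp: E_Suc l R_D D_Y)

lemma norm_E_le: "x \<in> Y \<Longrightarrow> norm (E l n x) \<le> norm x"
  by (induction n) (auto simp: E_Suc l E_Y intro: order_trans[OF norm_R_le])

lemma E_add: "x \<in> Y \<Longrightarrow> y \<in> Y \<Longrightarrow> E l n (x + y) = E l n x + E l n y"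
  by (induction n) (auto simp: E_Suc l E_Y R_add)

lemma E_scale: "x \<in> Y \<Longrightarrow> E l n (r *\<^sub>R x) = r *\<^sub>R E l n x"
  by (induction n) (auto simp: E_Suc l E_Y R_scale)

lemma E_diff: "x \<in> Y \<Longrightarrow> y \<in> Y \<Longrightarrow> E l n (x - y) = E l n x - E l n y"
  using E_add[of x "(-1) *\<^sub>R y" n] E_scale[of y n "-1"] Y_scale[of y "-1"] by simp

lemma A_E: "x \<in> D \<Longrightarrow> A (E l n x) = E l n (A x)"
  by (induction n) (auto simp: E_Suc l A_R E_D)

text \<open>Since \<open>A\<close> commutes with the iterates, the increment of each step is bounded
  by l times \<open>norm (A x)\<close>, uniformly in \<open>n\<close>.\<close>

lemma E_step: "x \<in> D \<Longrightarrow> E l (Suc n) x = E l n x + l *\<^sub>R E l (Suc n) (A x)"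
  using A_R_eq[OF l, of "E l n x"] A_E[of x "Suc n"] by (simp add: E_Suc E_Y D_Y)

lemma E_lipschitz:
  assumes "x \<in> D"
  shows "norm (E l n x - x) \<le> real n * l * norm (A x)"
proof (induction n)
  case (Suc n)
  have "E l (Suc n) x - x = (E l n x - x) + l *\<^sub>R E l (Suc n) (A x)"
    using E_step[OF assms, of n] by simp
  then have "norm (E l (Suc n) x - x) \<le> norm (E l n x - x) + norm (l *\<^sub>R E l (Suc n) (A x))"
    by (simp only: norm_triangle_ineq)
  also have "\<dots> \<le> real n * l * norm (A x) + l * norm (A x)"
    using Suc norm_E_le[OF A_in[OF assms], of "Suc n"] l by (intro add_mono) auto
  finally show ?case by (simp add: algebra_simps)
qed simp

text \<open>\<open>A x\<close> need not lie in \<open>D\<close>, so its iterates have no Lipschitz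
  bound of their own. A nearby \<open>y\<close> in \<open>D\<close> supplies one; the distance to
  \<open>y\<close> is paid twice, at time 0 and, contracted, along the iterates.\<close>

lemma E_tangent:
  assumes x: "x \<in> D" and y: "y \<in> D"
  shows "norm (E l n x - x - (real n * l) *\<^sub>R A x)
    \<le> (real n * l) * (2 * norm (A x - y) + (real n * l) * norm (A y))"
proof -
  have lip: "norm (E l k (A x) - A x) \<le> 2 * norm (A x - y) + real n * l * norm (A y)"
    if "k \<le> n" for k
  proof -
    have "E l k (A x) - A x = E l k (A x - y) + (E l k y - y) + (y - A x)"
      by (simp add: E_diff A_in x y D_Y)
    then have "norm (E l k (A x) - A x) \<le> norm (E l k (A x - y)) + norm (E l k y - y) + norm (y - A x)"
      by (metis norm_triangle_le norm_triangle_ineq add.commute add_right_mono)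
    moreover have "norm (E l k (A x - y)) \<le> norm (A x - y)"
      by (intro norm_E_le Y_diff A_in x D_Y y)
    moreover have "norm (E l k y - y) \<le> real n * l * norm (A y)"
      using E_lipschitz[OF y, of k] that l
      by (smt (verit) mult_right_mono norm_ge_zero of_nat_le_iff)
    ultimately show ?thesis by (simp add: norm_minus_commute)
  qed
  \<comment> \<open>The induction runs over \<open>k\<close> with the error rate frozen at its value
    for \<open>n\<close>, so that equal contributions add up.\<close>
  have "norm (E l k x - x - (real k * l) *\<^sub>R A x)
      \<le> (real k * l) * (2 * norm (A x - y) + (real n * l) * norm (A y))" if "k \<le> n" for k
    using that
  proof (induction k)
    case (Suc k)
    have "E l (Suc k) x - x - (real (Suc k) * l) *\<^sub>R A x
        = (E l k x - x - (real k * l) *\<^sub>R A x) + l *\<^sub>R (E l (Suc k) (A x) - A x)"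
      using E_step[OF x, of k] by (simp add: algebra_simps)
    then have "norm (E l (Suc k) x - x - (real (Suc k) * l) *\<^sub>R A x)
        \<le> norm (E l k x - x - (real k * l) *\<^sub>R A x) + norm (l *\<^sub>R (E l (Suc k) (A x) - A x))"
      by (simp only: norm_triangle_ineq)
    also have "norm (l *\<^sub>R (E l (Suc k) (A x) - A x))
        \<le> l * (2 * norm (A x - y) + real n * l * norm (A y))"
      using lip[OF Suc.prems] l by simp
    finally show ?case using Suc by (simp add: algebra_simps)
  qed simp
  then show ?thesis by blast
qed

end

text \<open>Kobayashi's form of the Crandall--Liggett estimate.  Dissipativity with parameter
  \<open>l k / (l + k)\<close> bounds the difference at \<open>(m, n)\<close> by a convex combination of those at
  \<open>(m, n - 1)\<close> and \<open>(m - 1, n)\<close>; \<open>rad\<close> is harmonic for this recursion, and the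
  square root is concave.\<close>

lemma E_E_step:
  assumes l: "0 < l" "l < \<delta>" and k: "0 < k" "k < \<delta>" and x: "x \<in> D"
  shows "norm (E l (Suc m) x - E k (Suc n) x)
    \<le> l / (l + k) * norm (E l (Suc m) x - E k n x) + k / (l + k) * norm (E l m x - E k (Suc n) x)"
proof -
  define p where "p = E l (Suc m) x"
  define q where "q = E k (Suc n) x"
  define c where "c = l * k / (l + k)"
  have pq: "p \<in> D" "q \<in> D" using l k x by (auto simp: p_def q_def E_D)
  have Ap: "l *\<^sub>R A p = p - E l m x"
    unfolding p_def E_Suc using l x by (intro A_R_eq E_Y D_Y) auto
  have Aq: "k *\<^sub>R A q = q - E k n x"
    unfolding q_def E_Suc using k x by (intro A_R_eq E_Y D_Y) auto
  have "norm (p - q) \<le> norm (p - q - c *\<^sub>R A (p - q))"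
    using l k pq by (intro norm_le_resolvent D_diff) (auto simp: c_def)
  also have "c *\<^sub>R A (p - q) = (k / (l + k)) *\<^sub>R (l *\<^sub>R A p) - (l / (l + k)) *\<^sub>R (k *\<^sub>R A q)"
    using pq by (simp add: A_diff c_def scaleR_diff_right mult.commute)
  also have "p - q - \<dots> = (1 - k / (l + k)) *\<^sub>R p - (1 - l / (l + k)) *\<^sub>R q
      + (k / (l + k)) *\<^sub>R E l m x - (l / (l + k)) *\<^sub>R E k n x"
    unfolding Ap Aq by (simp add: algebra_simps)
  also have "1 - k / (l + k) = l / (l + k)" using l k by (simp add: field_simps)
  also have "1 - l / (l + k) = k / (l + k)" using l k by (simp add: field_simps)
  also have "(l / (l + k)) *\<^sub>R p - (k / (l + k)) *\<^sub>R q + (k / (l + k)) *\<^sub>R E l m x - (l / (l + k)) *\<^sub>R E k n x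
     = (l / (l + k)) *\<^sub>R (p - E k n x) + (k / (l + k)) *\<^sub>R (E l m x - q)"
    by (simp add: algebra_simps)
  also have "norm \<dots> \<le> norm ((l / (l + k)) *\<^sub>R (p - E k n x)) + norm ((k / (l + k)) *\<^sub>R (E l m x - q))"
    by (rule norm_triangle_ineq)
  also have "\<dots> = l / (l + k) * norm (p - E k n x) + k / (l + k) * norm (E l m x - q)"
    using l k by simp
  finally show ?thesis unfolding p_def q_def .
qed

lemma kobayashi:
  assumes l: "0 < l" "l < \<delta>" and k: "0 < k" "k < \<delta>" and x: "x \<in> D"
  shows "norm (E l m x - E k n x) \<le> sqrt (rad l m k n) * norm (A x)"
proof (induction "m + n" arbitrary: m n)
  case 0 then show ?case by (simp add: rad_nonneg)
next
  case (Suc s)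
  show ?case
  proof (cases m)
    case 0
    \<comment> \<open>With one count equal to 0 no step can be removed; there \<open>rad\<close>
      dominates the squared elapsed time, and the Lipschitz bound suffices.\<close>
    have "real n * k \<le> sqrt (rad l 0 k n)" by (rule real_le_rsqrt) (simp add: rad_def)
    then show ?thesis
      using E_lipschitz[OF k x, of n] 0 mult_right_mono[OF _ norm_ge_zero[of "A x"]]
      by (simp add: norm_minus_commute) (meson order_trans)
  next
    case m: (Suc m')
    show ?thesis
    proof (cases n)
      case 0
      have "real m * l \<le> sqrt (rad l m k 0)" by (rule real_le_rsqrt) (simp add: rad_def)
      then show ?thesis
        using E_lipschitz[OF l x, of m] 0 mult_right_mono[OF _ norm_ge_zero[of "A x"]]
        by simp (meson order_trans)
    next
      case n: (Suc n')
      have "norm (E l m x - E k n x)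
          \<le> l / (l + k) * norm (E l m x - E k n' x) + k / (l + k) * norm (E l m' x - E k n x)"
        unfolding m n by (rule E_E_step[OF l k x])
      also have "\<dots> \<le> l / (l + k) * (sqrt (rad l m k n') * norm (A x))
          + k / (l + k) * (sqrt (rad l m' k n) * norm (A x))"
        using Suc m n l k by (intro add_mono mult_left_mono) auto
      also have "\<dots> = (l / (l + k) * sqrt (rad l m k n') + k / (l + k) * sqrt (rad l m' k n)) * norm (A x)"
        by (simp add: algebra_simps)
      also have "\<dots> \<le> sqrt (rad l m k n) * norm (A x)"
      proof (rule mult_right_mono)
        have "l / (l + k) * sqrt (rad l m k n') + k / (l + k) * sqrt (rad l m' k n)
            \<le> sqrt (l / (l + k) * rad l m k n' + k / (l + k) * rad l m' k n)"
          using l k by (intro sqrt_convex_comb_le rad_nonneg) (auto simp: add_divide_distrib[symmetric])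
        also have "\<dots> = sqrt (rad l m k n)"
          unfolding m n using l k by (subst rad_harmonic) auto
        finally show "l / (l + k) * sqrt (rad l m k n') + k / (l + k) * sqrt (rad l m' k n)
            \<le> sqrt (rad l m k n)" .
      qed simp
      finally show ?thesis .
    qed
  qed
qed

end

lemma Cauchy_of_dist_le_add:
  fixes s :: "nat \<Rightarrow> 'a::metric_space"
  assumes le: "\<And>i j. dist (s i) (s j) \<le> g i + g j" and g: "g \<longlonglongrightarrow> (0::real)"
  shows "Cauchy s"
proof (rule metric_CauchyI)
  fix e :: real assume "0 < e"
  then obtain M where M: "\<And>n. n \<ge> M \<Longrightarrow> g n < e / 2"
    using order_tendstoD(2)[OF g, of "e/2"] by (auto simp: eventually_sequentially)
  have "dist (s m) (s n) < e" if "M \<le> m" "M \<le> n" for m n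
    using le[of m n] M[OF that(1)] M[OF that(2)] by linarith
  then show "\<exists>M. \<forall>m\<ge>M. \<forall>n\<ge>M. dist (s m) (s n) < e" by blast
qed

text \<open>Connects the library derivative with the difference quotients by which derivatives of
  solutions are defined.\<close>

lemma has_vector_derivative_quotient_iff:
  "(f has_vector_derivative d) (at t within J) \<longleftrightarrow>
    ((\<lambda>s. (1 / (s - t)) *\<^sub>R (f s - f t) - d) \<longlongrightarrow> 0) (at t within J)"
proof -
  have "norm (f s - f t - (s - t) *\<^sub>R d) / norm (s - t) = norm ((1 / (s - t)) *\<^sub>R (f s - f t) - d)"
    if "s \<noteq> t" for s
  proof -
    have "f s - f t - (s - t) *\<^sub>R d = (s - t) *\<^sub>R ((1 / (s - t)) *\<^sub>R (f s - f t) - d)"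
      using that by (simp add: scaleR_diff_right)
    then show ?thesis using that by (simp only: norm_scaleR) simp
  qed
  then have "((\<lambda>s. norm (f s - f t - (s - t) *\<^sub>R d) / norm (s - t)) \<longlongrightarrow> 0) (at t within J) \<longleftrightarrow>
      ((\<lambda>s. norm ((1 / (s - t)) *\<^sub>R (f s - f t) - d)) \<longlongrightarrow> 0) (at t within J)"
    by (intro Lim_cong_within) auto
  then show ?thesis
    unfolding has_vector_derivative_def has_derivative_iff_norm tendsto_norm_zero_iff
    by (simp add: bounded_linear_scaleR_left)
qed

section \<open>The limit semigroup and its generator\<close>

context m_dissipative
begin

text \<open>Rounding \<open>t\<close> down to a multiple of \<open>h n\<close>, instead of using the step \<open>t / n\<close>, makes \<open>T 0\<close> the identity
  also outside \<open>D\<close>.\<close>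

definition h :: "nat \<Rightarrow> real" where
  "h n = \<delta> / real (n + 2)"

definition steps :: "real \<Rightarrow> nat \<Rightarrow> nat" where
  "steps t n = nat \<lfloor>t / h n\<rfloor>"

definition T :: "real \<Rightarrow> 'h \<Rightarrow> 'h" where
  "T t x = lim (\<lambda>n. E (h n) (steps t n) x)"

text \<open>The shift by 2 in \<open>h\<close> keeps every step strictly below \<delta>, including
  \<open>h 0\<close>, so that all resolvents involved exist.\<close>

lemma h: "0 < h n" "h n < \<delta>"
  using \<delta> by (auto simp: h_def divide_less_eq)

lemma h_lim: "h \<longlonglongrightarrow> 0"
proof -
  have "(\<lambda>n. \<delta> / real (n + 2)) \<longlonglongrightarrow> 0"
    using LIMSEQ_ignore_initial_segment[OF lim_const_over_n[of \<delta>], of 2] by simp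
  then show ?thesis by (simp add: h_def[abs_def])
qed

lemma steps_bounds:
  assumes "0 \<le> t"
  shows "real (steps t n) * h n \<le> t" "t - h n \<le> real (steps t n) * h n"
proof -
  have "0 \<le> t / h n" using assms h[of n] by simp
  then have "real (steps t n) \<le> t / h n" "t / h n - 1 \<le> real (steps t n)"
    unfolding steps_def by linarith+
  then show "real (steps t n) * h n \<le> t" "t - h n \<le> real (steps t n) * h n"
    using h[of n] by (auto simp: field_simps)
qed

lemma steps_lim: "0 \<le> t \<Longrightarrow> (\<lambda>n. real (steps t n) * h n) \<longlonglongrightarrow> t"
proof (rule tendsto_sandwich[of "\<lambda>n. t - h n" _ _ "\<lambda>_. t"])
  show "(\<lambda>n. t - h n) \<longlonglongrightarrow> t"
    using tendsto_diff[OF tendsto_const h_lim, of t] by simp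
qed (use steps_bounds in auto)

text \<open>The time error after \<open>m\<close> steps of size \<open>h n\<close> plus the standard
  deviation contributed by \<open>rad\<close>. Subadditivity of the square root lets each gap
  involve a single discretisation.\<close>

definition gap :: "real \<Rightarrow> nat \<Rightarrow> nat \<Rightarrow> real" where
  "gap t m n = \<bar>real m * h n - t\<bar> + sqrt (real m * h n * h n)"

lemma E_h_close:
  assumes x: "x \<in> D"
  shows "norm (E (h i) m x - E (h j) n x) \<le> (gap t m i + gap t n j) * norm (A x)"
proof -
  have add: "sqrt (a + b) \<le> sqrt a + sqrt b" if "0 \<le> a" "0 \<le> b" for a b
    using that by (intro real_le_lsqrt) (auto simp: power2_sum)
  have "sqrt (rad (h i) m (h j) n)
      \<le> sqrt ((real m * h i - real n * h j)\<^sup>2) + sqrt (real m * (h i)\<^sup>2) + sqrt (real n * (h j)\<^sup>2)"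
    unfolding rad_def using h[of i] h[of j]
    by (intro order_trans[OF add] add_mono add order_refl) auto
  also have "\<dots> = \<bar>real m * h i - real n * h j\<bar> + sqrt (real m * h i * h i) + sqrt (real n * h j * h j)"
    by (simp add: power2_eq_square mult.assoc)
  also have "\<dots> \<le> gap t m i + gap t n j"
    unfolding gap_def by linarith
  finally show ?thesis
    using kobayashi[OF h[of i] h[of j] x, of m n] mult_right_mono[OF _ norm_ge_zero[of "A x"]]
    by (meson order_trans)
qed

lemma gap_lim:
  assumes "(\<lambda>n. real (m n) * h n) \<longlonglongrightarrow> t"
  shows "(\<lambda>n. gap t (m n) n * C) \<longlonglongrightarrow> 0"
proof -
  have "(\<lambda>n. gap t (m n) n * C) \<longlonglongrightarrow> (\<bar>t - t\<bar> + sqrt (t * 0)) * C"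
    unfolding gap_def by (intro tendsto_intros assms h_lim)
  then show ?thesis by simp
qed

lemma E_convergent_D:
  assumes "x \<in> D" "0 \<le> t"
  shows "Cauchy (\<lambda>n. E (h n) (steps t n) x)"
  using E_h_close[OF assms(1), where t = t] gap_lim[OF steps_lim[OF assms(2)], of "norm (A x)"]
  by (intro Cauchy_of_dist_le_add[where g = "\<lambda>n. gap t (steps t n) n * norm (A x)"])
    (auto simp: dist_norm distrib_right)

text \<open>On \<open>D\<close> the estimate \<open>kobayashi\<close> gives a Cauchy sequence; the
  iterates are contractions uniformly in \<open>n\<close>, so density carries this over to
  \<open>Y\<close>.\<close>

lemma T_lim:
  assumes "x \<in> Y" "0 \<le> t"
  shows "(\<lambda>n. E (h n) (steps t n) x) \<longlonglongrightarrow> T t x"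
proof -
  have "Cauchy (\<lambda>n. E (h n) (steps t n) x)"
  proof (rule metric_CauchyI)
    fix e :: real assume "0 < e"
    then obtain y where y: "y \<in> D" "norm (x - y) < e / 3" using approx assms by (metis divide_pos_pos zero_less_numeral)
    obtain M where M: "\<And>m n. m \<ge> M \<Longrightarrow> n \<ge> M \<Longrightarrow>
        norm (E (h m) (steps t m) y - E (h n) (steps t n) y) < e / 3"
      using metric_CauchyD[OF E_convergent_D[OF y(1) assms(2)], of "e/3"] \<open>0 < e\<close>
      by (auto simp: dist_norm)
    have "dist (E (h m) (steps t m) x) (E (h n) (steps t n) x) < e" if "m \<ge> M" "n \<ge> M" for m n
    proof -
      have *: "norm (E (h k) (steps t k) x - E (h k) (steps t k) y) < e / 3" for k
        using norm_E_le[OF h Y_diff[OF assms(1) D_Y[OF y(1)]], of k "steps t k"] y(2)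
        by (simp add: E_diff[OF h assms(1) D_Y[OF y(1)]])
      have "norm (E (h m) (steps t m) x - E (h n) (steps t n) x)
        \<le> norm (E (h m) (steps t m) x - E (h m) (steps t m) y)
          + norm (E (h m) (steps t m) y - E (h n) (steps t n) y)
          + norm (E (h n) (steps t n) x - E (h n) (steps t n) y)"
        by norm
      then show ?thesis using *[of m] *[of n] M[OF that] unfolding dist_norm by linarith
    qed
    then show "\<exists>M. \<forall>m\<ge>M. \<forall>n\<ge>M. dist (E (h m) (steps t m) x) (E (h n) (steps t n) x) < e" by blast
  qed
  then show ?thesis
    unfolding T_def using Cauchy_convergent_iff convergent_LIMSEQ_iff by blast
qed

text \<open>Only the limiting elapsed time matters. The semigroup law needs this freedom, since
  \<open>steps s n + steps t n\<close> may differ from \<open>steps (s + t) n\<close> by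
  rounding.\<close>

lemma T_lim_D:
  assumes x: "x \<in> D" and t: "0 \<le> t" and m: "(\<lambda>n. real (m n) * h n) \<longlonglongrightarrow> t"
  shows "(\<lambda>n. E (h n) (m n) x) \<longlonglongrightarrow> T t x"
proof -
  have "(\<lambda>n. E (h n) (m n) x - E (h n) (steps t n) x) \<longlonglongrightarrow> 0"
  proof (rule Lim_null_comparison)
    show "\<forall>\<^sub>F n in sequentially. norm (E (h n) (m n) x - E (h n) (steps t n) x)
        \<le> gap t (m n) n * norm (A x) + gap t (steps t n) n * norm (A x)"
      using E_h_close[OF x, where t = t] by (intro always_eventually) (simp add: distrib_right)
    show "(\<lambda>n. gap t (m n) n * norm (A x) + gap t (steps t n) n * norm (A x)) \<longlonglongrightarrow> 0"
      using tendsto_add[OF gap_lim[OF m] gap_lim[OF steps_lim[OF t]]] by simp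
  qed
  from tendsto_add[OF this T_lim[OF D_Y[OF x] t]] show ?thesis by simp
qed

lemma T_Y: "x \<in> Y \<Longrightarrow> 0 \<le> t \<Longrightarrow> T t x \<in> Y"
  by (rule closed_sequentially[OF Y(2) E_Y[OF h] T_lim])

lemma T_0: "x \<in> Y \<Longrightarrow> T 0 x = x"
  using T_lim[of x 0] by (simp add: steps_def LIMSEQ_const_iff)

lemma norm_T_le: "x \<in> Y \<Longrightarrow> 0 \<le> t \<Longrightarrow> norm (T t x) \<le> norm x"
  using norm_E_le[OF h] by (intro LIMSEQ_le_const2[OF tendsto_norm[OF T_lim]]) auto

lemma T_add: "x \<in> Y \<Longrightarrow> y \<in> Y \<Longrightarrow> 0 \<le> t \<Longrightarrow> T t (x + y) = T t x + T t y"
  using tendsto_add[OF T_lim[of x t] T_lim[of y t]]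
  by (intro LIMSEQ_unique[OF T_lim]) (auto simp: E_add[OF h] Y_add)

lemma T_scale: "x \<in> Y \<Longrightarrow> 0 \<le> t \<Longrightarrow> T t (r *\<^sub>R x) = r *\<^sub>R T t x"
  using tendsto_scaleR[OF tendsto_const[of r] T_lim[of x t]]
  by (intro LIMSEQ_unique[OF T_lim]) (auto simp: E_scale[OF h] Y_scale)

lemma T_diff: "x \<in> Y \<Longrightarrow> y \<in> Y \<Longrightarrow> 0 \<le> t \<Longrightarrow> T t (x - y) = T t x - T t y"
  using T_add[of x "(-1) *\<^sub>R y" t] T_scale[of y t "-1"] Y_scale[of y "-1"] by simp

lemma T_dist: "x \<in> Y \<Longrightarrow> y \<in> Y \<Longrightarrow> 0 \<le> t \<Longrightarrow> norm (T t x - T t y) \<le> norm (x - y)"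
  using norm_T_le[OF Y_diff, of x y t] by (simp add: T_diff)

text \<open>By uniqueness of resolvents, \<open>K\<close> commutes with them, hence with their
  powers and the limit. Taking for \<open>K\<close> the multiplication by a complex scalar makes the
  real construction complex linear.\<close>

lemma T_commute:
  assumes K: "bounded_linear K" "\<And>y. y \<in> Y \<Longrightarrow> K y \<in> Y" "\<And>x. x \<in> D \<Longrightarrow> K x \<in> D"
      "\<And>x. x \<in> D \<Longrightarrow> A (K x) = K (A x)"
    and x: "x \<in> Y" and t: "0 \<le> t"
  shows "T t (K x) = K (T t x)"
proof -
  interpret K: bounded_linear K by (rule K)
  have R: "R l (K y) = K (R l y)" if "0 < l" "l < \<delta>" "y \<in> Y" for l y
    using arg_cong[OF R_eq[OF that], of K] that R_D[OF that]
    by (intro R_eqI K) (auto simp: K.diff K.scaleR K(4))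
  have E: "E (h n) m (K x) = K (E (h n) m x)" for n m
    by (induction m) (auto simp: E_Suc R h E_Y[OF h] x)
  show ?thesis
    using K.tendsto[OF T_lim[OF x t]] by (intro LIMSEQ_unique[OF T_lim]) (auto simp: E K x t)
qed

lemma T_plus:
  assumes s: "0 \<le> s" and t: "0 \<le> t" and x: "x \<in> Y"
  shows "T (s + t) x = T s (T t x)"
proof -
  have D: "T (s + t) y = T s (T t y)" if y: "y \<in> D" for y
  proof -
    have "(\<lambda>n. real (steps s n + steps t n) * h n) \<longlonglongrightarrow> s + t"
      using tendsto_add[OF steps_lim[OF s] steps_lim[OF t]] by (simp add: distrib_right)
    then have lim: "(\<lambda>n. E (h n) (steps s n + steps t n) y) \<longlonglongrightarrow> T (s + t) y"
      using s t y by (intro T_lim_D) auto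
    \<comment> \<open>Replacing the inner iterate by its limit costs no more than its error, as the
      outer iterates are contractions.\<close>
    have "(\<lambda>n. E (h n) (steps s n) (E (h n) (steps t n) y - T t y)) \<longlonglongrightarrow> 0"
    proof (rule Lim_null_comparison)
      show "\<forall>\<^sub>F n in sequentially. norm (E (h n) (steps s n) (E (h n) (steps t n) y - T t y))
          \<le> norm (E (h n) (steps t n) y - T t y)"
        by (intro always_eventually allI norm_E_le h Y_diff E_Y T_Y D_Y y t)
      show "(\<lambda>n. norm (E (h n) (steps t n) y - T t y)) \<longlonglongrightarrow> 0"
        using T_lim[OF D_Y[OF y] t] LIM_zero tendsto_norm_zero by blast
    qed
    from tendsto_add[OF this T_lim[OF T_Y[OF D_Y[OF y] t] s]]
    have "(\<lambda>n. E (h n) (steps s n + steps t n) y) \<longlonglongrightarrow> T s (T t y)"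
      by (simp add: E_plus E_diff[OF h] E_Y[OF h] T_Y D_Y y t)
    with lim show ?thesis by (rule LIMSEQ_unique)
  qed
  have "norm (T (s + t) x - T s (T t x)) \<le> e" if e: "0 < e" for e
  proof -
    obtain y where y: "y \<in> D" "norm (x - y) < e / 2" by (rule approx[OF x half_gt_zero[OF e]])
    have "norm (T (s + t) x - T (s + t) y) \<le> norm (x - y)"
      using s t x y by (intro T_dist) (auto simp: D_Y)
    moreover have "norm (T s (T t y) - T s (T t x)) \<le> norm (y - x)"
      using T_dist[OF T_Y[OF D_Y[OF y(1)] t] T_Y[OF x t] s] T_dist[OF D_Y[OF y(1)] x t] by linarith
    ultimately show ?thesis
      using norm_triangle_ineq[of "T (s + t) x - T (s + t) y" "T s (T t y) - T s (T t x)"] D[OF y(1)] y(2)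
      by (simp add: norm_minus_commute)
  qed
  then have "norm (T (s + t) x - T s (T t x)) \<le> 0" by (metis add_0 field_le_epsilon)
  then show ?thesis by simp
qed

lemma T_tangent_0:
  assumes x: "x \<in> D" and y: "y \<in> D" and t: "0 \<le> t"
  shows "norm (T t x - x - t *\<^sub>R A x) \<le> t * (2 * norm (A x - y) + t * norm (A y))"
proof (rule LIMSEQ_le)
  show "(\<lambda>n. norm (E (h n) (steps t n) x - x - (real (steps t n) * h n) *\<^sub>R A x))
      \<longlonglongrightarrow> norm (T t x - x - t *\<^sub>R A x)"
    by (intro tendsto_intros T_lim D_Y x t steps_lim)
  show "(\<lambda>n. real (steps t n) * h n * (2 * norm (A x - y) + real (steps t n) * h n * norm (A y)))
      \<longlonglongrightarrow> t * (2 * norm (A x - y) + t * norm (A y))"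
    by (intro tendsto_intros steps_lim t)
qed (use E_tangent[OF h x y] in auto)

lemma T_lipschitz_0:
  assumes x: "x \<in> D" and t: "0 \<le> t"
  shows "norm (T t x - x) \<le> t * norm (A x)"
proof (rule LIMSEQ_le)
  show "(\<lambda>n. norm (E (h n) (steps t n) x - x)) \<longlonglongrightarrow> norm (T t x - x)"
    by (intro tendsto_intros T_lim D_Y x t)
  show "(\<lambda>n. real (steps t n) * h n * norm (A x)) \<longlonglongrightarrow> t * norm (A x)"
    by (intro tendsto_intros steps_lim t)
qed (use E_lipschitz[OF h x] in auto)

text \<open>Only orbits that start in \<open>D\<close> are known to be Lipschitz in time; a nearby
  one controls the orbit of \<open>x\<close>.\<close>

lemma T_close:
  assumes x: "x \<in> Y" and y: "y \<in> D" and s: "0 \<le> s" and t: "0 \<le> t"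
  shows "norm (T s x - T t x) \<le> 2 * norm (x - y) + \<bar>s - t\<bar> * norm (A y)"
proof -
  have *: "norm (T s x - T t x) \<le> 2 * norm (x - y) + (s - t) * norm (A y)"
    if "t \<le> s" "0 \<le> t" for s t
  proof -
    have "norm (T s x - T t x) = norm (T t (T (s - t) x) - T t x)"
      using T_plus[of t "s - t" x] that x by simp
    also have "\<dots> \<le> norm (T (s - t) x - x)" using that x by (intro T_dist T_Y) auto
    also have "\<dots> \<le> norm (T (s - t) x - T (s - t) y) + norm (T (s - t) y - y) + norm (x - y)"
      by norm
    also have "\<dots> \<le> norm (x - y) + (s - t) * norm (A y) + norm (x - y)"
      using that x y by (intro add_mono T_dist T_lipschitz_0 order_refl) (auto simp: D_Y)
    finally show ?thesis by simp
  qed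
  show ?thesis
    using *[of t s] *[of s t] s t by (cases "t \<le> s") (auto simp: norm_minus_commute abs_if)
qed

lemma T_continuous:
  assumes x: "x \<in> Y"
  shows "continuous_on {0..} (\<lambda>t. T t x)"
  unfolding continuous_on_iff
proof (intro ballI allI impI)
  fix t e :: real assume t: "t \<in> {0..}" and e: "0 < e"
  obtain y where y: "y \<in> D" "norm (x - y) < e / 4" using approx[OF x, of "e/4"] e by auto
  define d where "d = e / (2 * (norm (A y) + 1))"
  have n: "0 < 2 * (norm (A y) + 1)" by (simp add: add_nonneg_pos)
  then have d: "0 < d" "d * norm (A y) \<le> e / 2"
    using e by (auto simp: d_def field_simps)
  have "dist (T s x) (T t x) < e" if "s \<in> {0..}" "dist s t < d" for s
  proof -
    have "\<bar>s - t\<bar> * norm (A y) \<le> d * norm (A y)"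
      using that by (intro mult_right_mono) (auto simp: dist_real_def)
    then show ?thesis
      using T_close[OF x y(1), of s t] that t y d by (simp add: dist_norm)
  qed
  then show "\<exists>d>0. \<forall>s\<in>{0..}. dist s t < d \<longrightarrow> dist (T s x) (T t x) < e" using d by blast
qed

text \<open>For s \<ge> t the semigroup law reduces the claim to time 0. For s < t the roles are
  exchanged, and moving the derivative from time s to time t costs a second error of the same size;
  hence the doubled constants.\<close>

lemma T_tangent:
  assumes x: "x \<in> D" and y: "y \<in> D" and s: "0 \<le> s" and t: "0 \<le> t"
  shows "norm (T s x - T t x - (s - t) *\<^sub>R T t (A x))
    \<le> \<bar>s - t\<bar> * (4 * norm (A x - y) + 2 * \<bar>s - t\<bar> * norm (A y))"
proof -
  have *: "norm (T s x - T t x - (s - t) *\<^sub>R T t (A x)) \<le> (s - t) * (2 * norm (A x - y) + (s - t) * norm (A y))"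
    if "t \<le> s" "0 \<le> t" for s t
  proof -
    have "T s x - T t x - (s - t) *\<^sub>R T t (A x) = T t (T (s - t) x - x - (s - t) *\<^sub>R A x)"
      using T_plus[of t "s - t" x] that x by (simp add: T_diff T_scale T_Y D_Y A_in Y_diff Y_scale)
    also have "norm \<dots> \<le> norm (T (s - t) x - x - (s - t) *\<^sub>R A x)"
      using that x by (intro norm_T_le Y_diff Y_scale T_Y D_Y A_in) auto
    also have "\<dots> \<le> (s - t) * (2 * norm (A x - y) + (s - t) * norm (A y))"
      using that by (intro T_tangent_0 x y) auto
    finally show ?thesis .
  qed
  show ?thesis
  proof (cases "t \<le> s")
    case True
    have "(s - t) * (2 * norm (A x - y) + (s - t) * norm (A y))
        \<le> \<bar>s - t\<bar> * (4 * norm (A x - y) + 2 * \<bar>s - t\<bar> * norm (A y))"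
      using True by (intro mult_mono add_mono mult_right_mono) auto
    then show ?thesis using *[OF True t] by linarith
  next
    case False
    have "T s x - T t x - (s - t) *\<^sub>R T t (A x)
        = - (T t x - T s x - (t - s) *\<^sub>R T s (A x)) + (t - s) *\<^sub>R (T t (A x) - T s (A x))"
      by (simp add: algebra_simps)
    then have "norm (T s x - T t x - (s - t) *\<^sub>R T t (A x))
        \<le> norm (T t x - T s x - (t - s) *\<^sub>R T s (A x)) + norm ((t - s) *\<^sub>R (T t (A x) - T s (A x)))"
      by (metis norm_minus_cancel norm_triangle_ineq)
    also have "\<dots> \<le> (t - s) * (2 * norm (A x - y) + (t - s) * norm (A y))
        + (t - s) * (2 * norm (A x - y) + (t - s) * norm (A y))"
      using *[of s t] T_close[OF A_in[OF x] y t s] False s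
      by (intro add_mono) (auto intro: mult_left_mono)
    finally show ?thesis using False by (simp add: algebra_simps)
  qed
qed

lemma T_derivative:
  assumes x: "x \<in> D" and t: "0 \<le> t"
  shows "((\<lambda>t. T t x) has_vector_derivative T t (A x)) (at t within {0..})"
  unfolding has_vector_derivative_def has_derivative_within_alt
proof (intro conjI allI impI)
  show "bounded_linear (\<lambda>r. r *\<^sub>R T t (A x))" by (rule bounded_linear_scaleR_left)
  fix e :: real assume e: "0 < e"
  obtain y where y: "y \<in> D" "norm (A x - y) < e / 8" using approx[OF A_in[OF x], of "e/8"] e by auto
  \<comment> \<open>The approximation error uses up one half of \<open>e\<close>; this radius keeps
    the part depending on time below the other half, and the added 1 covers A y = 0.\<close>
  define d where "d = e / (4 * (norm (A y) + 1))"
  have n: "0 < 4 * (norm (A y) + 1)" by (simp add: add_nonneg_pos)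
  then have d: "0 < d" "2 * d * norm (A y) \<le> e / 2"
    using e by (auto simp: d_def field_simps)
  have "norm (T s x - T t x - (s - t) *\<^sub>R T t (A x)) \<le> e * norm (s - t)"
    if "s \<in> {0..}" "norm (s - t) < d" for s
  proof -
    have "\<bar>s - t\<bar> * norm (A y) \<le> d * norm (A y)"
      using that by (intro mult_right_mono) auto
    then have "4 * norm (A x - y) + 2 * \<bar>s - t\<bar> * norm (A y) \<le> e" using y d by simp
    then have "\<bar>s - t\<bar> * (4 * norm (A x - y) + 2 * \<bar>s - t\<bar> * norm (A y)) \<le> \<bar>s - t\<bar> * e"
      by (intro mult_left_mono) auto
    then show ?thesis
      using T_tangent[OF x y(1), of s t] that t by (simp add: mult.commute)
  qed
  then show "\<exists>d>0. \<forall>y\<in>{0..}. norm (y - t) < d \<longrightarrow>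
      norm (T y x - T t x - (y - t) *\<^sub>R T t (A x)) \<le> e * norm (y - t)"
    using d by blast
qed

lemma T_quotient:
  assumes x: "x \<in> D"
  shows "((\<lambda>k. (1 / k) *\<^sub>R (T k x - x)) \<longlongrightarrow> A x) (at_right 0)"
proof -
  have "((\<lambda>t. T t x) has_vector_derivative A x) (at_right 0)"
    using T_derivative[OF x, of 0] T_0[OF A_in[OF x]]
    by (auto intro: has_vector_derivative_within_subset)
  then show ?thesis
    using LIM_zero_cancel by (auto simp: has_vector_derivative_quotient_iff T_0 D_Y x)
qed

text \<open>The difference quotients define a dissipative extension of \<open>A\<close>; as \<open>1 - l A\<close> is already
  onto, the extension is not proper.\<close>

lemma generator_unique:
  assumes x: "x \<in> Y" and y: "y \<in> Y"
    and lim: "((\<lambda>k. (1 / k) *\<^sub>R (T k x - x)) \<longlongrightarrow> y) (at_right 0)"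
  shows "x \<in> D" "y = A x"
proof -
  define l where "l = \<delta> / 2"
  have l: "0 < l" "l < \<delta>" using \<delta> by (auto simp: l_def)
  obtain z where z: "z \<in> D" "z - l *\<^sub>R A z = x - l *\<^sub>R y"
    using range[OF l, of "x - l *\<^sub>R y"] x y Y_diff Y_scale by blast
  define w where "w = x - z"
  have w: "w \<in> Y" using x z by (auto simp: w_def Y_diff D_Y)
  have "((\<lambda>k. w - l *\<^sub>R ((1 / k) *\<^sub>R (T k x - x) - (1 / k) *\<^sub>R (T k z - z))) \<longlongrightarrow> w - l *\<^sub>R (y - A z)) (at_right 0)"
    by (intro tendsto_intros lim T_quotient z)
  moreover have "w - l *\<^sub>R (y - A z) = 0" using z by (simp add: w_def algebra_simps)
  ultimately have lim0: "((\<lambda>k. norm (w - l *\<^sub>R ((1 / k) *\<^sub>R (T k x - x) - (1 / k) *\<^sub>R (T k z - z)))) \<longlongrightarrow> 0) (at_right 0)"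
    by (simp add: tendsto_norm_zero)
  have "norm w \<le> norm (w - l *\<^sub>R ((1 / k) *\<^sub>R (T k x - x) - (1 / k) *\<^sub>R (T k z - z)))" if k: "0 < k" for k
  proof -
    \<comment> \<open>Difference quotients of a contraction semigroup are dissipative: the
      coefficient 1 + l/k of \<open>w\<close> exceeds the coefficient l/k of \<open>T k w\<close> by
      1.\<close>
    have "w - l *\<^sub>R ((1 / k) *\<^sub>R (T k x - x) - (1 / k) *\<^sub>R (T k z - z)) = w - (l / k) *\<^sub>R (T k w - w)"
      using k x z by (simp add: w_def T_diff D_Y algebra_simps)
    also have "\<dots> = (1 + l / k) *\<^sub>R w - (l / k) *\<^sub>R T k w"
      by (simp add: algebra_simps)
    finally have "norm (w - l *\<^sub>R ((1 / k) *\<^sub>R (T k x - x) - (1 / k) *\<^sub>R (T k z - z)))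
        = norm ((1 + l / k) *\<^sub>R w - (l / k) *\<^sub>R T k w)" by simp
    moreover have "norm ((1 + l / k) *\<^sub>R w) - norm ((l / k) *\<^sub>R T k w) \<le> norm ((1 + l / k) *\<^sub>R w - (l / k) *\<^sub>R T k w)"
      by (rule norm_triangle_ineq2)
    moreover have "norm ((1 + l / k) *\<^sub>R w) = norm w + (l / k) * norm w"
      using k l by (simp add: distrib_right)
    moreover have "norm ((l / k) *\<^sub>R T k w) \<le> (l / k) * norm w"
      using k l norm_T_le[OF w, of k] by (simp add: divide_right_mono)
    ultimately show ?thesis by linarith
  qed
  then have "norm w \<le> 0"
    by (intro tendsto_lowerbound[OF lim0] eventually_mono[OF eventually_at_right_less[of 0]]) auto
  then have "x = z" by (simp add: w_def)
  then show "x \<in> D" "y = A x" using z l by auto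
qed

text \<open>The difference quotients at \<open>T t x\<close> are the images under \<open>T t\<close>
  of those at \<open>x\<close>, so they converge; \<open>generator_unique\<close> then yields
  membership in \<open>D\<close> and the value together.\<close>

lemma T_D:
  assumes x: "x \<in> D" and t: "0 \<le> t"
  shows "T t x \<in> D" "A (T t x) = T t (A x)"
proof -
  have "((\<lambda>k. (1 / k) *\<^sub>R (T k x - x) - A x) \<longlongrightarrow> 0) (at_right 0)"
    by (rule LIM_zero[OF T_quotient[OF x]])
  then have "((\<lambda>k. (1 / k) *\<^sub>R (T k (T t x) - T t x) - T t (A x)) \<longlongrightarrow> 0) (at_right 0)"
  proof (rule Lim_null_comparison[rotated, OF tendsto_norm_zero])
    show "\<forall>\<^sub>F k in at_right 0. norm ((1 / k) *\<^sub>R (T k (T t x) - T t x) - T t (A x))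
        \<le> norm ((1 / k) *\<^sub>R (T k x - x) - A x)"
      unfolding eventually_at_filter
    proof (intro always_eventually allI impI)
      fix k :: real assume "k \<in> {0<..}"
      then have k: "0 \<le> k" by simp
      have "T k (T t x) = T t (T k x)"
        using T_plus[OF k t D_Y[OF x]] T_plus[OF t k D_Y[OF x]] by (simp add: add.commute)
      then have "(1 / k) *\<^sub>R (T k (T t x) - T t x) - T t (A x) = T t ((1 / k) *\<^sub>R (T k x - x) - A x)"
        using t k x by (simp add: T_diff T_scale T_Y Y_diff Y_scale D_Y A_in)
      then show "norm ((1 / k) *\<^sub>R (T k (T t x) - T t x) - T t (A x)) \<le> norm ((1 / k) *\<^sub>R (T k x - x) - A x)"
        using t k x by (simp add: norm_T_le T_Y Y_diff Y_scale D_Y A_in)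
    qed
  qed
  then have "((\<lambda>k. (1 / k) *\<^sub>R (T k (T t x) - T t x)) \<longlongrightarrow> T t (A x)) (at_right 0)"
    by (rule LIM_zero_cancel)
  from generator_unique[OF _ _ this] show "T t x \<in> D" "A (T t x) = T t (A x)"
    using x t by (auto simp: T_Y D_Y A_in)
qed

end

section \<open>Closed graph, integrals of orbits and mild solutions\<close>

context m_dissipative
begin

lemma R_diff: "0 < l \<Longrightarrow> l < \<delta> \<Longrightarrow> x \<in> Y \<Longrightarrow> y \<in> Y \<Longrightarrow> R l (x - y) = R l x - R l y"
  using R_add[of l x "(-1) *\<^sub>R y"] R_scale[of l y "-1"] Y_scale[of y "-1"] by simp

text \<open>\<open>x n\<close> is the resolvent applied to x n - l A (x n), and the resolvent is
  continuous with values in \<open>D\<close>.\<close>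

lemma graph_closed:
  assumes x: "\<And>n. x n \<in> D" "x \<longlonglongrightarrow> a" and y: "(\<lambda>n. A (x n)) \<longlonglongrightarrow> b"
  shows "a \<in> D" "A a = b"
proof -
  define l where "l = \<delta> / 2"
  have l: "0 < l" "l < \<delta>" using \<delta> by (auto simp: l_def)
  have z: "(\<lambda>n. x n - l *\<^sub>R A (x n)) \<longlonglongrightarrow> a - l *\<^sub>R b"
    by (intro tendsto_intros x y)
  have zY: "x n - l *\<^sub>R A (x n) \<in> Y" for n
    by (intro Y_diff Y_scale A_in D_Y x)
  have cY: "a - l *\<^sub>R b \<in> Y" by (rule closed_sequentially[OF Y(2) zY z])
  have Rx: "R l (x n - l *\<^sub>R A (x n)) = x n" for n
    using l x by (intro R_eqI) auto
  have "norm (x n - R l (a - l *\<^sub>R b)) \<le> norm (x n - l *\<^sub>R A (x n) - (a - l *\<^sub>R b))" for n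
    using norm_R_le[OF l Y_diff[OF zY[of n] cY]] unfolding R_diff[OF l zY cY] Rx .
  moreover have "(\<lambda>n. norm (x n - l *\<^sub>R A (x n) - (a - l *\<^sub>R b))) \<longlonglongrightarrow> 0"
    using z LIM_zero tendsto_norm_zero by blast
  ultimately have "(\<lambda>n. x n - R l (a - l *\<^sub>R b)) \<longlonglongrightarrow> 0"
    by (intro Lim_null_comparison[of "\<lambda>n. x n - R l (a - l *\<^sub>R b)"]) auto
  then have "R l (a - l *\<^sub>R b) = a"
    by (intro LIMSEQ_unique[OF LIM_zero_cancel x(2)])
  then show "a \<in> D" "A a = b" using R_D[OF l cY] R_eq[OF l cY] l by auto
qed

text \<open>The graph of \<open>A\<close> is a closed subspace containing the curve (T s x, T s (A
  x)), hence also its integral; the fundamental theorem of calculus evaluates the second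
  component.\<close>

lemma integral_T_D:
  assumes x: "x \<in> D" and t: "0 \<le> t"
  shows "integral {0..t} (\<lambda>s. T s x) \<in> D" "A (integral {0..t} (\<lambda>s. T s x)) = T t x - x"
proof -
  define G where "G = {(x, A x) | x. x \<in> D}"
  have G: "subspace G"
    unfolding G_def
    by (rule subspaceI) (auto simp: D_0 A_0 zero_prod_def D_add A_add D_scale A_scale)
  have "closed G"
    unfolding closed_sequential_limits
  proof (intro allI impI, elim conjE)
    fix p q assume p: "\<forall>n. p n \<in> G" "p \<longlonglongrightarrow> q"
    then have "\<exists>x. p n = (x, A x) \<and> x \<in> D" for n by (auto simp: G_def)
    then have "\<And>n. fst (p n) \<in> D" "\<And>n. snd (p n) = A (fst (p n))" by (metis fst_conv snd_conv)+
    with graph_closed[of "\<lambda>n. fst (p n)" "fst q" "snd q"] tendsto_fst[OF p(2)] tendsto_snd[OF p(2)]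
    show "q \<in> G" by (cases q) (auto simp: G_def)
  qed
  have c: "continuous_on {0..t} (\<lambda>s. T s y)" if "y \<in> Y" for y
    by (rule continuous_on_subset[OF T_continuous[OF that]]) auto
  have cp: "continuous_on {0..t} (\<lambda>s. (T s x, T s (A x)))"
    by (intro continuous_on_Pair c D_Y A_in x)
  have I: "integral {0..t} (\<lambda>s. (T s x, T s (A x))) \<in> G"
    using T_D[OF x] by (intro integral_in_closed_subspace G \<open>closed G\<close> cp) (auto simp: G_def)
  have "fst (integral {0..t} (\<lambda>s. (T s x, T s (A x)))) = integral {0..t} (\<lambda>s. T s x)"
    using integral_linear[OF integrable_continuous_real[OF cp] bounded_linear_fst] by (simp add: o_def)
  moreover have "snd (integral {0..t} (\<lambda>s. (T s x, T s (A x)))) = integral {0..t} (\<lambda>s. T s (A x))"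
    using integral_linear[OF integrable_continuous_real[OF cp] bounded_linear_snd] by (simp add: o_def)
  moreover have "((\<lambda>s. T s (A x)) has_integral T t x - T 0 x) {0..t}"
    by (intro fundamental_theorem_of_calculus t has_vector_derivative_within_subset[OF T_derivative[OF x]]) auto
  then have "integral {0..t} (\<lambda>s. T s (A x)) = T t x - x"
    using T_0[OF D_Y[OF x]] by (simp add: integral_unique)
  ultimately show "integral {0..t} (\<lambda>s. T s x) \<in> D" "A (integral {0..t} (\<lambda>s. T s x)) = T t x - x"
    using I by (auto simp: G_def)
qed

text \<open>The formula for points of \<open>D\<close> does not contain \<open>A x\<close>, so both
  of its sides converge along a sequence in \<open>D\<close> tending to \<open>x\<close>, and the
  closed graph identifies the limit.\<close>

lemma integral_T:
  assumes x: "x \<in> Y" and t: "0 \<le> t"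
  shows "integral {0..t} (\<lambda>s. T s x) \<in> D" "A (integral {0..t} (\<lambda>s. T s x)) = T t x - x"
proof -
  have "\<exists>y\<in>D. norm (x - y) < 1 / real (Suc n)" for n
    using approx[OF x, of "1 / real (Suc n)"] by auto
  then obtain y where y: "\<And>n. y n \<in> D" "\<And>n. norm (x - y n) < 1 / real (Suc n)" by metis
  have lim: "y \<longlonglongrightarrow> x"
  proof (rule LIM_zero_cancel, rule Lim_null_comparison[OF _ LIMSEQ_inverse_real_of_nat])
    show "\<forall>\<^sub>F n in sequentially. norm (y n - x) \<le> inverse (real (Suc n))"
      using y(2) by (intro always_eventually) (simp add: norm_minus_commute inverse_eq_divide less_imp_le)
  qed
  have c: "continuous_on {0..t} (\<lambda>s. T s y)" if "y \<in> Y" for y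
    by (rule continuous_on_subset[OF T_continuous[OF that]]) auto
  have T: "norm (T s (y n) - T s x) \<le> norm (y n - x)" if "0 \<le> s" for s n
    by (intro T_dist D_Y y x that)
  have n0: "(\<lambda>n. norm (y n - x)) \<longlonglongrightarrow> 0"
    using lim LIM_zero tendsto_norm_zero by blast
  have "(\<lambda>n. integral {0..t} (\<lambda>s. T s (y n)) - integral {0..t} (\<lambda>s. T s x)) \<longlonglongrightarrow> 0"
  proof (rule Lim_null_comparison)
    show "\<forall>\<^sub>F n in sequentially. norm (integral {0..t} (\<lambda>s. T s (y n)) - integral {0..t} (\<lambda>s. T s x))
        \<le> norm (y n - x) * (t - 0)"
    proof (intro always_eventually allI)
      fix n
      have "integral {0..t} (\<lambda>s. T s (y n)) - integral {0..t} (\<lambda>s. T s x) = integral {0..t} (\<lambda>s. T s (y n) - T s x)"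
        by (intro Henstock_Kurzweil_Integration.integral_diff[symmetric] integrable_continuous_real c D_Y y x)
      also have "norm \<dots> \<le> norm (y n - x) * (t - 0)"
        using T t by (intro integral_bound continuous_intros c D_Y y x) auto
      finally show "norm (integral {0..t} (\<lambda>s. T s (y n)) - integral {0..t} (\<lambda>s. T s x))
        \<le> norm (y n - x) * (t - 0)" .
    qed
    show "(\<lambda>n. norm (y n - x) * (t - 0)) \<longlonglongrightarrow> 0" using n0 tendsto_mult_left_zero by blast
  qed
  then have I: "(\<lambda>n. integral {0..t} (\<lambda>s. T s (y n))) \<longlonglongrightarrow> integral {0..t} (\<lambda>s. T s x)"
    by (rule LIM_zero_cancel)
  have "(\<lambda>n. T t (y n)) \<longlonglongrightarrow> T t x"
    by (rule LIM_zero_cancel, rule Lim_null_comparison[OF _ n0]) (use T[OF t] in auto)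
  then have "(\<lambda>n. A (integral {0..t} (\<lambda>s. T s (y n)))) \<longlonglongrightarrow> T t x - x"
    using integral_T_D[OF y(1) t] lim by (auto intro: tendsto_diff)
  from graph_closed[OF integral_T_D(1)[OF y(1) t] I this]
  show "integral {0..t} (\<lambda>s. T s x) \<in> D" "A (integral {0..t} (\<lambda>s. T s x)) = T t x - x" by auto
qed

text \<open>The primitive \<open>W\<close> of the difference of two mild solutions satisfies \<open>W' = A W\<close>, so
  dissipativity makes its norm nonincreasing.\<close>

lemma mild_unique:
  assumes x: "x \<in> Y" and V: "continuous_on {0..} V"
    and I: "\<And>t. 0 \<le> t \<Longrightarrow> (V has_integral I t) {0..t}" "\<And>t. 0 \<le> t \<Longrightarrow> I t \<in> D"
      "\<And>t. 0 \<le> t \<Longrightarrow> V t = x + A (I t)"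
    and t: "0 \<le> t"
  shows "V t = T t x"
proof -
  define u where "u s = V s - T s x" for s
  define W where "W s = integral {0..s} u" for s
  have c: "continuous_on {0..t} u"
    unfolding u_def
    by (intro continuous_intros continuous_on_subset[OF V] continuous_on_subset[OF T_continuous[OF x]]) auto
  have W: "W s \<in> D" "A (W s) = u s" if s: "0 \<le> s" for s
  proof -
    have "(\<lambda>r. T r x) integrable_on {0..s}"
      by (intro integrable_continuous_real continuous_on_subset[OF T_continuous[OF x]]) auto
    then have "W s = I s - integral {0..s} (\<lambda>r. T r x)"
      using I(1)[OF s] unfolding W_def u_def
      by (subst Henstock_Kurzweil_Integration.integral_diff) (auto simp: integral_unique)
    then show "W s \<in> D" "A (W s) = u s"
      using I(2,3)[OF s] integral_T[OF x s] by (auto simp: D_diff A_diff u_def)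
  qed
  have der: "(W has_vector_derivative u s) (at s within {0..t})" if "s \<in> {0..t}" for s
    unfolding W_def using integral_has_vector_derivative[OF c that] .
  have "((\<lambda>s. W s \<bullet> W s) has_real_derivative 2 * (u s \<bullet> W s)) (at s within {0..t})" if "s \<in> {0..t}" for s
    using has_derivative_inner[OF der[OF that, unfolded has_vector_derivative_def]
        der[OF that, unfolded has_vector_derivative_def]]
    by (rule has_derivative_imp_has_field_derivative) (simp add: inner_commute)
  then have "\<exists>z\<in>{0..t}. W t \<bullet> W t - W 0 \<bullet> W 0 = 2 * (u z \<bullet> W z) * (t - 0)"
    by (intro mvt_very_simple[OF t]) (auto simp: has_field_derivative_def)
  then obtain z where "z \<in> {0..t}" "W t \<bullet> W t - W 0 \<bullet> W 0 = 2 * (u z \<bullet> W z) * t" by auto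
  moreover from this have "u z \<bullet> W z \<le> 0"
    using dissipative[OF W(1), of z] W(2)[of z] by auto
  ultimately have "W t \<bullet> W t \<le> 0"
    using t by (simp add: W_def mult_nonpos_nonneg)
  then have "W t = 0" by (meson inner_eq_zero_iff inner_ge_zero order_antisym)
  then have "u t = 0" using W(2)[OF t] A_0 by simp
  then show ?thesis by (simp add: u_def)
qed

end

section \<open>Transport along an isometry\<close>

text \<open>The integral used for mild solutions admits only gauges of constant radius; uniform
  continuity provides one, with an error on each cell of at most \<open>c\<close> times its
  length.\<close>

lemma riemann_sum_tendsto:
  fixes f :: "real \<Rightarrow> 'a::banach"
  assumes f: "continuous_on {a..b} f" and "0 < e"
  obtains d where "0 < d" "\<And>p. p tagged_division_of {a..b} \<Longrightarrow> (\<lambda>x. ball x d) fine p \<Longrightarrow>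
      norm ((\<Sum>(x, K)\<in>p. measure lborel K *\<^sub>R f x) - integral {a..b} f) < e"
proof -
  define c where "c = e / (measure lborel {a..b} + 1)"
  have c: "0 < c" "c * measure lborel {a..b} < e"
    using \<open>0 < e\<close> by (auto simp: c_def field_simps add_pos_nonneg)
  obtain d where d: "0 < d" "\<And>x y. x \<in> {a..b} \<Longrightarrow> y \<in> {a..b} \<Longrightarrow> dist y x < d \<Longrightarrow> dist (f y) (f x) < c"
    using compact_uniformly_continuous[OF f compact_Icc] c(1) unfolding uniformly_continuous_on_def by metis
  show ?thesis
  proof (rule that[OF d(1)])
    fix p assume p: "p tagged_division_of {a..b}" and fine: "(\<lambda>x. ball x d) fine p"
    have fi: "f integrable_on {a..b}" by (rule integrable_continuous_real[OF f])
    have "norm (measure lborel K *\<^sub>R f x - integral K f) \<le> measure lborel K * c" if xK: "(x, K) \<in> p" for x K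
    proof -
      have K: "x \<in> K" "K \<subseteq> {a..b}" "K \<subseteq> ball x d" "\<exists>u v. K = cbox u v"
        using tagged_division_ofD(2,3,4)[OF p xK] fine xK by (auto simp: fine_def)
      then obtain u v where uv: "K = cbox u v" by blast
      have fK: "f integrable_on K" using integrable_on_subinterval[OF fi] K uv by simp
      have "((\<lambda>y. f x - f y) has_integral (measure lborel K *\<^sub>R f x - integral K f)) K"
        unfolding uv
        by (intro has_integral_diff has_integral_const integrable_integral fK[unfolded uv])
      moreover have "norm (f x - f y) \<le> c" if "y \<in> K" for y
        using d(2)[of y x] K that by (auto simp: dist_norm subset_iff dist_commute intro!: less_imp_le)
      ultimately have "norm (measure lborel K *\<^sub>R f x - integral K f) \<le> c * measure lborel K"
        unfolding uv using c by (intro has_integral_bound[of c]) auto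
      then show ?thesis by (simp add: mult.commute)
    qed
    then have "norm (\<Sum>(x, K)\<in>p. measure lborel K *\<^sub>R f x - integral K f) \<le> (\<Sum>(x, K)\<in>p. measure lborel K * c)"
      by (intro sum_norm_le) auto
    also have "\<dots> = measure lborel {a..b} * c"
      using additive_content_tagged_division[OF p[unfolded box_real(2)[symmetric]]]
      by (simp add: split_def flip: sum_distrib_right)
    also have "\<dots> < e" using c by (simp add: mult.commute)
    also have "(\<Sum>(x, K)\<in>p. measure lborel K *\<^sub>R f x - integral K f)
        = (\<Sum>(x, K)\<in>p. measure lborel K *\<^sub>R f x) - integral {a..b} f"
      using integral_combine_tagged_division_topdown[OF fi[unfolded box_real(2)[symmetric]]
          p[unfolded box_real(2)[symmetric]]]
      by (simp add: split_def sum_subtractf)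
    finally show "norm ((\<Sum>(x, K)\<in>p. measure lborel K *\<^sub>R f x) - integral {a..b} f) < e" .
  qed
qed

lemma bounded_linear_scaleC:
  fixes c :: complex
  assumes "\<And>x::'h::{real_normed_vector,complex_vector}. norm (c *\<^sub>C x) = cmod c * norm x"
  shows "bounded_linear (\<lambda>x::'h. c *\<^sub>C x)"
  by (rule bounded_linear_intro[where K = "cmod c"])
    (simp_all add: assms scaleC_add_right scaleC_of_real[symmetric] scaleC_scaleC mult.commute)

text \<open>The conclusion of the theorem as a property of any normed carrier and operator, so that
  it can be established through an isometry before the concrete system appears.\<close>

definition well_posed_on ::
    "'a::complex_vector set \<Rightarrow> ('a \<Rightarrow> real) \<Rightarrow> 'a set \<Rightarrow> ('a \<Rightarrow> 'a) \<Rightarrow> bool" where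
  "well_posed_on X N D A \<longleftrightarrow> (\<exists>T. C0_contraction_semigroup X N T \<and> infinitesimal_generator X N T D A \<and>
    (\<forall>U\<^sub>0\<in>X.
       mild_solution X N D A U\<^sub>0 (\<lambda>t. T t U\<^sub>0) \<and>
       (\<forall>V. mild_solution X N D A U\<^sub>0 V \<longrightarrow> (\<forall>t\<ge>0. V t = T t U\<^sub>0)) \<and>
       continuous_into {0..} X N (\<lambda>t. T t U\<^sub>0)) \<and>
    (\<forall>U\<^sub>0\<in>D.
       classical_solution X N D A U\<^sub>0 (\<lambda>t. T t U\<^sub>0) \<and>
       continuous_into {0..} D (graph_norm N A) (\<lambda>t. T t U\<^sub>0) \<and>
       C1_into {0..} X N (\<lambda>t. T t U\<^sub>0)))"

text \<open>Completeness of \<open>X\<close> under \<open>N\<close> enters only as closedness of the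
  image of \<open>J\<close>, the form needed for limits inside the Hilbert type.\<close>

locale isometric_model =
  fixes X D :: "'a::complex_vector set" and N :: "'a \<Rightarrow> real" and A :: "'a \<Rightarrow> 'a" and \<delta> :: real
    and J :: "'a \<Rightarrow> 'h::{real_inner,banach,complex_vector}"
  assumes X: "0 \<in> X" "x \<in> X \<Longrightarrow> y \<in> X \<Longrightarrow> x + y \<in> X" "x \<in> X \<Longrightarrow> c *\<^sub>C x \<in> X"
    and J: "x \<in> X \<Longrightarrow> y \<in> X \<Longrightarrow> J (x + y) = J x + J y" "x \<in> X \<Longrightarrow> J (c *\<^sub>C x) = c *\<^sub>C J x"
    and J_inj: "x \<in> X \<Longrightarrow> J x = 0 \<Longrightarrow> x = 0"
    and N: "x \<in> X \<Longrightarrow> N x = norm (J x)"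
    and J_closed: "closed (J ` X)"
    and norm_scaleC: "norm (c *\<^sub>C (h::'h)) = cmod c * norm h"
    and D: "D \<subseteq> X" "0 \<in> D" "x \<in> D \<Longrightarrow> y \<in> D \<Longrightarrow> x + y \<in> D" "x \<in> D \<Longrightarrow> c *\<^sub>C x \<in> D"
    and A: "x \<in> D \<Longrightarrow> y \<in> D \<Longrightarrow> A (x + y) = A x + A y" "x \<in> D \<Longrightarrow> A (c *\<^sub>C x) = c *\<^sub>C A x"
    and A_X: "x \<in> D \<Longrightarrow> A x \<in> X"
    and diss: "x \<in> D \<Longrightarrow> J (A x) \<bullet> J x \<le> 0"
    and \<delta>: "0 < \<delta>"
    and range: "0 < l \<Longrightarrow> l < \<delta> \<Longrightarrow> y \<in> X \<Longrightarrow> \<exists>x\<in>D. x - l *\<^sub>R A x = y"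
begin

lemma D_X: "x \<in> D \<Longrightarrow> x \<in> X"
  using D by blast

lemma X_scaleR: "x \<in> X \<Longrightarrow> r *\<^sub>R x \<in> X"
  using X(3)[of x "complex_of_real r"] by (simp add: scaleC_of_real)

lemma X_diff: "x \<in> X \<Longrightarrow> y \<in> X \<Longrightarrow> x - y \<in> X"
  using X(2)[of x "(-1) *\<^sub>R y"] X_scaleR[of y "-1"] by simp

lemma J_scaleR: "x \<in> X \<Longrightarrow> J (r *\<^sub>R x) = r *\<^sub>R J x"
  using J(2)[of x "complex_of_real r"] by (simp add: scaleC_of_real)

lemma J_diff: "x \<in> X \<Longrightarrow> y \<in> X \<Longrightarrow> J (x - y) = J x - J y"
  using J(1)[of x "(-1) *\<^sub>R y"] J_scaleR[of y "-1"] X_scaleR[of y "-1"] by simp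

lemma J_0: "J 0 = 0"
  using J_scaleR[OF X(1), of 0] by simp

lemma J_sum: "(\<And>i. i \<in> S \<Longrightarrow> f i \<in> X) \<Longrightarrow> sum f S \<in> X \<and> J (sum f S) = (\<Sum>i\<in>S. J (f i))"
  by (induction S rule: infinite_finite_induct) (auto simp: X J_0 J)

lemma inj: "inj_on J X"
proof (rule inj_onI)
  fix x y assume "x \<in> X" "y \<in> X" "J x = J y"
  then show "x = y" using J_inj[of "x - y"] by (simp add: J_diff X_diff)
qed

definition Ji :: "'h \<Rightarrow> 'a" where
  "Ji = inv_into X J"

lemma Ji_J: "x \<in> X \<Longrightarrow> Ji (J x) = x"
  unfolding Ji_def by (rule inv_into_f_f[OF inj])

lemma Ji_X: "y \<in> J ` X \<Longrightarrow> Ji y \<in> X"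
  unfolding Ji_def by (rule inv_into_into)

lemma J_Ji: "y \<in> J ` X \<Longrightarrow> J (Ji y) = y"
  unfolding Ji_def by (rule f_inv_into_f)

lemma D_scaleR: "x \<in> D \<Longrightarrow> r *\<^sub>R x \<in> D"
  using D(4)[of x "complex_of_real r"] by (simp add: scaleC_of_real)

lemma A_scaleR: "x \<in> D \<Longrightarrow> A (r *\<^sub>R x) = r *\<^sub>R A x"
  using A(2)[of x "complex_of_real r"] by (simp add: scaleC_of_real)

sublocale S: m_dissipative "J ` X" "J ` D" "\<lambda>y. J (A (Ji y))" \<delta>
proof
  show "subspace (J ` X)"
  proof (rule subspaceI)
    show "0 \<in> J ` X" using J_0 X(1) by (metis imageI)
    show "x + y \<in> J ` X" if "x \<in> J ` X" "y \<in> J ` X" for x y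
      using that by (auto simp: J[symmetric] X)
    show "c *\<^sub>R x \<in> J ` X" if "x \<in> J ` X" for c x
      using that by (auto simp: J_scaleR[symmetric] X_scaleR)
  qed
  show "subspace (J ` D)"
  proof (rule subspaceI)
    show "0 \<in> J ` D" using J_0 D(2) by (metis imageI)
    show "x + y \<in> J ` D" if "x \<in> J ` D" "y \<in> J ` D" for x y
      using that by (auto simp: J[symmetric] D D_X)
    show "c *\<^sub>R x \<in> J ` D" if "x \<in> J ` D" for c x
      using that by (auto simp: J_scaleR[symmetric] D_scaleR D_X)
  qed
  show "closed (J ` X)" by (rule J_closed)
  show "J ` D \<subseteq> J ` X" using D by auto
  fix x y assume xD: "x \<in> J ` D"
  then show "J (A (Ji x)) \<in> J ` X" "J (A (Ji x)) \<bullet> x \<le> 0"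
    by (auto simp: Ji_J D_X A_X diss)
  show "J (A (Ji (r *\<^sub>R x))) = r *\<^sub>R J (A (Ji x))" for r
    using xD by (auto simp: Ji_J D_X A_X A_scaleR J_scaleR X_scaleR simp flip: J_scaleR)
  show "J (A (Ji (x + y))) = J (A (Ji x)) + J (A (Ji y))" if "y \<in> J ` D"
    using that xD by (auto simp: Ji_J D_X A_X A J X simp flip: J(1))
next
  show "0 < \<delta>" by (rule \<delta>)
  fix l y assume "0 < l" "l < \<delta>" "y \<in> J ` X"
  then obtain z x where z: "z \<in> X" "y = J z" "x \<in> D" "x - l *\<^sub>R A x = z" using range by blast
  then have "J x - l *\<^sub>R J (A (Ji (J x))) = y"
    by (auto simp: Ji_J D_X A_X J_diff J_scaleR X_scaleR)
  then show "\<exists>x\<in>J ` D. x - l *\<^sub>R J (A (Ji x)) = y" using z by blast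
qed

definition T :: "real \<Rightarrow> 'a \<Rightarrow> 'a" where
  "T t x = Ji (S.T t (J x))"

lemma T_X: "x \<in> X \<Longrightarrow> 0 \<le> t \<Longrightarrow> T t x \<in> X"
  and J_T: "x \<in> X \<Longrightarrow> 0 \<le> t \<Longrightarrow> J (T t x) = S.T t (J x)"
  by (auto simp: T_def Ji_X J_Ji S.T_Y)

lemma J_eqI: "x \<in> X \<Longrightarrow> y \<in> X \<Longrightarrow> J x = J y \<Longrightarrow> x = y"
  using inj by (auto dest: inj_onD)

lemma J_A: "x \<in> D \<Longrightarrow> J (A x) = J (A (Ji (J x)))"
  by (simp add: Ji_J D_X)

lemma T_D: "x \<in> D \<Longrightarrow> 0 \<le> t \<Longrightarrow> T t x \<in> D"
  and A_T: "x \<in> D \<Longrightarrow> 0 \<le> t \<Longrightarrow> A (T t x) = T t (A x)"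
proof -
  assume x: "x \<in> D" and t: "0 \<le> t"
  from S.T_D[of "J x" t] x t have "S.T t (J x) \<in> J ` D" by simp
  then obtain y where y: "y \<in> D" "S.T t (J x) = J y" by blast
  then have "T t x = y" by (simp add: T_def Ji_J D_X)
  then show "T t x \<in> D" using y by simp
  then show "A (T t x) = T t (A x)"
    using S.T_D(2)[of "J x" t] x t
    by (intro J_eqI A_X T_X) (auto simp: J_T A_X D_X Ji_J J_A[of "T t x"])
qed

lemma N_diff: "x \<in> X \<Longrightarrow> y \<in> X \<Longrightarrow> N (x - y) = norm (J x - J y)"
  by (simp add: N X_diff J_diff)

lemma N_quotient: "x \<in> X \<Longrightarrow> y \<in> X \<Longrightarrow> z \<in> X \<Longrightarrow>
    N ((1 / k) *\<^sub>R (x - y) - z) = norm ((1 / k) *\<^sub>R (J x - J y) - J z)"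
  by (simp add: N_diff X_diff X_scaleR J_diff J_scaleR)

lemma continuous_into_iff:
  assumes "\<And>t. t \<in> S \<Longrightarrow> u t \<in> X"
  shows "continuous_into S X N u \<longleftrightarrow> continuous_on S (\<lambda>t. J (u t))"
proof -
  have "((\<lambda>s. N (u s - u t)) \<longlongrightarrow> 0) (at t within S) \<longleftrightarrow> ((\<lambda>s. J (u s)) \<longlongrightarrow> J (u t)) (at t within S)"
    if "t \<in> S" for t
  proof -
    have "((\<lambda>s. N (u s - u t)) \<longlongrightarrow> 0) (at t within S) \<longleftrightarrow>
        ((\<lambda>s. norm (J (u s) - J (u t))) \<longlongrightarrow> 0) (at t within S)"
      unfolding tendsto_def eventually_at_filter using assms that by (auto simp: N_diff elim!: eventually_mono)
    also have "\<dots> \<longleftrightarrow> ((\<lambda>s. J (u s)) \<longlongrightarrow> J (u t)) (at t within S)"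
      by (simp add: tendsto_norm_zero_iff Lim_null[symmetric])
    finally show ?thesis .
  qed
  then show ?thesis using assms by (auto simp: continuous_into_def continuous_on_def)
qed

lemma has_derivative_into_iff:
  assumes "\<And>t. t \<in> S \<Longrightarrow> u t \<in> X" "d \<in> X" "t \<in> S"
  shows "has_derivative_into S N u d t \<longleftrightarrow> ((\<lambda>t. J (u t)) has_vector_derivative J d) (at t within S)"
proof -
  have "has_derivative_into S N u d t \<longleftrightarrow>
      ((\<lambda>s. norm ((1 / (s - t)) *\<^sub>R (J (u s) - J (u t)) - J d)) \<longlongrightarrow> 0) (at t within S)"
    unfolding has_derivative_into_def tendsto_def eventually_at_filter using assms
    by (auto simp: N_quotient elim!: eventually_mono)
  then show ?thesis by (simp add: has_vector_derivative_quotient_iff tendsto_norm_zero_iff)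
qed

text \<open>\<open>J\<close> is additive on \<open>X\<close> only. Tags of a division lie in the
  interval, where \<open>u\<close> takes values in \<open>X\<close>, so every partial sum stays in
  \<open>X\<close>.\<close>

lemma N_riemann_sum:
  assumes u: "\<And>s. s \<in> {0..t} \<Longrightarrow> u s \<in> X" and y: "y \<in> X" and p: "p tagged_division_of {0..t}"
  shows "N ((\<Sum>(x, K)\<in>p. measure lborel K *\<^sub>R u x) - y) =
    norm ((\<Sum>(x, K)\<in>p. measure lborel K *\<^sub>R J (u x)) - J y)"
proof -
  have "(case i of (x, K) \<Rightarrow> measure lborel K *\<^sub>R u x) \<in> X" if "i \<in> p" for i
    using that tagged_division_ofD(2,3)[OF p, of "fst i" "snd i"]
    by (auto simp: split_def intro!: X_scaleR u)
  note * = J_sum[of p, OF this]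
  have "(\<Sum>i\<in>p. J (case i of (x, K) \<Rightarrow> measure lborel K *\<^sub>R u x)) = (\<Sum>(x, K)\<in>p. measure lborel K *\<^sub>R J (u x))"
    using tagged_division_ofD(2,3)[OF p]
    by (intro sum.cong refl) (fastforce intro!: J_scaleR u)
  with * show ?thesis using y by (simp add: N_diff)
qed

lemma mild_solution_T:
  assumes x: "x \<in> X"
  shows "mild_solution X N D A x (\<lambda>t. T t x)"
  unfolding mild_solution_def
proof (intro conjI allI impI)
  have cont: "continuous_on {0..} (\<lambda>t. J (T t x))"
    by (rule continuous_on_eq[OF S.T_continuous[of "J x"]]) (use x in \<open>auto simp: J_T\<close>)
  then show "continuous_into {0..} X N (\<lambda>t. T t x)"
    by (subst continuous_into_iff) (auto simp: T_X x)
  fix t :: real assume t: "0 \<le> t"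
  have eq: "integral {0..t} (\<lambda>s. J (T s x)) = integral {0..t} (\<lambda>s. S.T s (J x))"
    by (rule integral_cong) (simp add: J_T x)
  from S.integral_T[of "J x" t] x t obtain I where
    I: "I \<in> D" "integral {0..t} (\<lambda>s. J (T s x)) = J I" "J (A I) = S.T t (J x) - J x"
    by (auto simp: eq Ji_J D_X)
  have "has_riemann_integral_into N (\<lambda>t. T t x) 0 t I"
    unfolding has_riemann_integral_into_def
  proof (intro allI impI)
    have sum: "N ((\<Sum>(s, K)\<in>p. measure lborel K *\<^sub>R T s x) - I)
        = norm ((\<Sum>(s, K)\<in>p. measure lborel K *\<^sub>R J (T s x)) - J I)" if "p tagged_division_of {0..t}" for p
      using that x I(1) by (intro N_riemann_sum[of t]) (auto simp: T_X D_X)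
    fix e :: real assume "0 < e"
    have "continuous_on {0..t} (\<lambda>t. J (T t x))" by (rule continuous_on_subset[OF cont]) auto
    then obtain d where "0 < d" "\<And>p. p tagged_division_of {0..t} \<Longrightarrow> (\<lambda>x. ball x d) fine p \<Longrightarrow>
        norm ((\<Sum>(s, K)\<in>p. measure lborel K *\<^sub>R J (T s x)) - J I) < e"
      using riemann_sum_tendsto \<open>0 < e\<close> I(2) by metis
    then show "\<exists>d>0. \<forall>p. p tagged_division_of {0..t} \<and> (\<lambda>x. ball x d) fine p \<longrightarrow>
        N ((\<Sum>(s, K)\<in>p. measure lborel K *\<^sub>R T s x) - I) < e"
      by (intro exI[of _ d]) (simp add: sum)
  qed
  moreover have "T t x = x + A I"
    using x t I(1,3) by (intro J_eqI) (auto simp: J T_X X A_X J_T)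
  ultimately show "\<exists>I\<in>D. has_riemann_integral_into N (\<lambda>t. T t x) 0 t I \<and> T t x = x + A I"
    using I(1) by blast
qed

text \<open>A constant radius defines a gauge, so the integrals of a mild solution become
  Henstock-Kurzweil integrals after applying \<open>J\<close>, and uniqueness in the Hilbert type
  applies.\<close>

lemma mild_solution_unique:
  assumes x: "x \<in> X" and V: "mild_solution X N D A x V" and t: "0 \<le> t"
  shows "V t = T t x"
proof -
  have VX: "V s \<in> X" if "0 \<le> s" for s
    using V that by (auto simp: mild_solution_def continuous_into_def)
  obtain I where I: "\<And>t. 0 \<le> t \<Longrightarrow> I t \<in> D" "\<And>t. 0 \<le> t \<Longrightarrow> has_riemann_integral_into N V 0 t (I t)"
    "\<And>t. 0 \<le> t \<Longrightarrow> V t = x + A (I t)"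
    using V unfolding mild_solution_def by metis
  have "J (V t) = S.T t (J x)"
  proof (rule S.mild_unique[of "J x" "\<lambda>t. J (V t)" "\<lambda>t. J (I t)"])
    show "continuous_on {0..} (\<lambda>t. J (V t))"
      using V VX continuous_into_iff[of "{0..}" V] by (auto simp: mild_solution_def)
    fix t :: real assume t: "0 \<le> t"
    show "((\<lambda>t. J (V t)) has_integral J (I t)) {0..t}"
      unfolding has_integral_real
    proof (intro allI impI)
      have sum: "N ((\<Sum>(s, K)\<in>p. measure lborel K *\<^sub>R V s) - I t)
          = norm ((\<Sum>(s, K)\<in>p. measure lborel K *\<^sub>R J (V s)) - J (I t))" if "p tagged_division_of {0..t}" for p
        using that I(1)[OF t] by (intro N_riemann_sum[of t]) (auto simp: VX D_X)
      fix e :: real assume "0 < e"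
      then obtain d where d: "0 < d" "\<And>p. p tagged_division_of {0..t} \<Longrightarrow> (\<lambda>x. ball x d) fine p \<Longrightarrow>
          N ((\<Sum>(s, K)\<in>p. measure lborel K *\<^sub>R V s) - I t) < e"
        using I(2)[OF t] unfolding has_riemann_integral_into_def by metis
      then show "\<exists>\<gamma>. gauge \<gamma> \<and> (\<forall>p. p tagged_division_of {0..t} \<and> \<gamma> fine p \<longrightarrow>
          norm ((\<Sum>(s, K)\<in>p. measure lborel K *\<^sub>R J (V s)) - J (I t)) < e)"
        by (intro exI[of _ "\<lambda>x. ball x d"]) (auto simp: sum[symmetric])
    qed
    show "J (I t) \<in> J ` D" "J (V t) = J x + J (A (Ji (J (I t))))"
      using I(1,3)[OF t] x by (auto simp: Ji_J D_X J A_X)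
  qed (use x t in auto)
  then show ?thesis using x t VX by (intro J_eqI) (auto simp: J_T T_X)
qed

lemma semigroup_T: "C0_contraction_semigroup X N T"
  unfolding C0_contraction_semigroup_def C0_semigroup_def bounded_linear_op_def
proof (intro conjI allI impI ballI)
  fix t :: real assume t: "0 \<le> t"
  fix x assume x: "x \<in> X"
  show "T t x \<in> X" by (rule T_X[OF x t])
  show "T t (x + y) = T t x + T t y" if "y \<in> X" for y
    using x t that by (intro J_eqI) (auto simp: T_X X J_T J S.T_add)
  show "T t (c *\<^sub>C x) = c *\<^sub>C T t x" for c
  proof (rule J_eqI)
    \<comment> \<open>The hypotheses of \<open>S.T_commute\<close> for multiplication by
      \<open>c\<close>: both images are invariant, and the conjugated operator is complex
      homogeneous.\<close>
    have "c *\<^sub>C J z \<in> J ` X" if "z \<in> X" for z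
      using that by (metis J(2) X(3) imageI)
    moreover have "c *\<^sub>C J z \<in> J ` D" if "z \<in> D" for z
      using that by (metis J(2) D(4) D_X imageI)
    moreover have "J (A (Ji (c *\<^sub>C J z))) = c *\<^sub>C J (A (Ji (J z)))" if "z \<in> D" for z
      using that by (simp add: J(2)[symmetric] D_X A_X X Ji_J A)
    ultimately have "S.T t (c *\<^sub>C J x) = c *\<^sub>C S.T t (J x)"
      using x t by (intro S.T_commute bounded_linear_scaleC norm_scaleC) auto
    then show "J (T t (c *\<^sub>C x)) = J (c *\<^sub>C T t x)"
      using x t by (simp add: J_T J(2) X T_X)
  qed (use x t in \<open>auto simp: T_X X\<close>)
  show "N (T t x) \<le> N x"
    using x t by (auto simp: N T_X J_T S.norm_T_le)
  show "T (s + t) x = T s (T t x)" if "0 \<le> s" for s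
    using x t that by (intro J_eqI) (auto simp: T_X J_T S.T_plus)
next
  fix t :: real assume t: "0 \<le> t"
  show "\<exists>M. \<forall>x\<in>X. N (T t x) \<le> M * N x"
    using t by (intro exI[of _ 1]) (auto simp: N T_X J_T S.norm_T_le)
next
  fix x assume x: "x \<in> X"
  show T0: "T 0 x = x" using x by (simp add: T_def S.T_0 Ji_J)
  have "continuous_into {0..} X N (\<lambda>t. T t x)"
    using mild_solution_T[OF x] by (simp add: mild_solution_def)
  then have "((\<lambda>s. N (T s x - T 0 x)) \<longlongrightarrow> 0) (at 0 within {0..})"
    by (simp add: continuous_into_def)
  then show "((\<lambda>t. N (T t x - x)) \<longlongrightarrow> 0) (at_right 0)"
    unfolding T0 by (rule tendsto_within_subset) auto
qed

lemma generator_T: "infinitesimal_generator X N T D A"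
proof -
  have iff: "((\<lambda>h. N ((1 / h) *\<^sub>R (T h x - x) - y)) \<longlongrightarrow> 0) (at_right 0) \<longleftrightarrow>
      ((\<lambda>h. (1 / h) *\<^sub>R (S.T h (J x) - J x)) \<longlongrightarrow> J y) (at_right 0)" if "x \<in> X" "y \<in> X" for x y
  proof -
    have "((\<lambda>h. N ((1 / h) *\<^sub>R (T h x - x) - y)) \<longlongrightarrow> 0) (at_right 0) \<longleftrightarrow>
        ((\<lambda>h. norm ((1 / h) *\<^sub>R (S.T h (J x) - J x) - J y)) \<longlongrightarrow> 0) (at_right 0)"
      using that
      by (intro tendsto_cong eventually_mono[OF eventually_at_right_less[of 0]])
        (auto simp: N_quotient T_X J_T)
    then show ?thesis by (simp add: tendsto_norm_zero_iff Lim_null[symmetric])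
  qed
  have lim: "((\<lambda>h. N ((1 / h) *\<^sub>R (T h x - x) - A x)) \<longlongrightarrow> 0) (at_right 0)" if "x \<in> D" for x
    using S.T_quotient[of "J x"] that by (simp add: iff D_X A_X Ji_J)
  have "x \<in> D" if "x \<in> X" "y \<in> X" "((\<lambda>h. N ((1 / h) *\<^sub>R (T h x - x) - y)) \<longlongrightarrow> 0) (at_right 0)" for x y
    using S.generator_unique(1)[of "J x" "J y"] that inj D by (auto simp: iff dest: inj_onD)
  with lim show ?thesis
    unfolding infinitesimal_generator_def using D_X A_X by blast
qed

lemma derivative_T:
  assumes x: "x \<in> D" and t: "0 \<le> t"
  shows "((\<lambda>t. J (T t x)) has_vector_derivative J (A (T t x))) (at t within {0..})"
proof (rule has_vector_derivative_transform[where f = "\<lambda>t. S.T t (J x)"])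
  show "((\<lambda>t. S.T t (J x)) has_vector_derivative J (A (T t x))) (at t within {0..})"
    using S.T_derivative[of "J x" t] x t by (simp add: A_T J_T A_X Ji_J D_X)
qed (use x t in \<open>auto simp: J_T D_X\<close>)

theorem well_posed: "well_posed_on X N D A"
  unfolding well_posed_on_def
proof (intro exI[of _ T] conjI ballI allI impI semigroup_T generator_T mild_solution_T mild_solution_unique)
  have cont: "continuous_into {0..} X N (\<lambda>t. T t x)" if "x \<in> X" for x
    using mild_solution_T[OF that] by (simp add: mild_solution_def)
  then show "x \<in> X \<Longrightarrow> continuous_into {0..} X N (\<lambda>t. T t x)" for x .
  fix x assume x: "x \<in> D"
  \<comment> \<open>The derivative of the orbit of \<open>x\<close> is the orbit of
    \<open>A x\<close>; its continuity gives both the C^1 property and continuity in the graph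
    norm.\<close>
  have AT: "continuous_into {0..} X N (\<lambda>t. A (T t x))"
  proof (subst continuous_into_iff)
    have "continuous_on {0..} (\<lambda>t. J (T t (A x)))"
      using cont[OF A_X[OF x]] continuous_into_iff[of "{0..}" "\<lambda>t. T t (A x)"] T_X[OF A_X[OF x]] by auto
    then show "continuous_on {0..} (\<lambda>t. J (A (T t x)))"
      by (rule continuous_on_eq) (simp add: A_T x)
  qed (simp add: A_X T_D x)
  have der: "has_derivative_into S N (\<lambda>t. T t x) (A (T t x)) t" if "t \<in> S" "S \<subseteq> {0..}" for S t
    using that derivative_T[OF x, of t] x
    by (subst has_derivative_into_iff) (auto simp: T_X D_X A_X T_D intro: has_vector_derivative_within_subset)
  have sub: "continuous_into {0<..} X N u" if "continuous_into {0..} X N u" for u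
    using that unfolding continuous_into_def
    by (metis atLeast_iff greaterThan_iff less_imp_le subsetI tendsto_within_subset)
  show "C1_into {0..} X N (\<lambda>t. T t x)"
    unfolding C1_into_def using cont[OF D_X[OF x]] AT der by blast
  have "C1_into {0<..} X N (\<lambda>t. T t x)"
    unfolding C1_into_def using sub[OF cont[OF D_X[OF x]]] sub[OF AT] der[where S = "{0<..}"]
    by (auto simp: subset_iff)
  then show "classical_solution X N D A x (\<lambda>t. T t x)"
    unfolding classical_solution_def
    using cont[OF D_X[OF x]] der[where S = "{0<..}"] x semigroup_T T_D
    by (auto simp: C0_contraction_semigroup_def C0_semigroup_def D_X subset_iff)
  show "continuous_into {0..} D (graph_norm N A) (\<lambda>t. T t x)"
    unfolding continuous_into_def
  proof (intro ballI conjI)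
    fix t :: real assume t: "t \<in> {0..}"
    then show "T t x \<in> D" using T_D x by simp
    have "((\<lambda>s. N (T s x - T t x) + N (A (T s x) - A (T t x))) \<longlongrightarrow> 0 + 0) (at t within {0..})"
      using cont[OF D_X[OF x]] AT t by (intro tendsto_add) (auto simp: continuous_into_def)
    moreover have "\<forall>\<^sub>F s in at t within {0..}. graph_norm N A (T s x - T t x)
        = N (T s x - T t x) + N (A (T s x) - A (T t x))"
      unfolding eventually_at_filter
    proof (intro always_eventually allI impI)
      fix s :: real assume "s \<in> {0..}"
      then have s: "T s x \<in> D" "T t x \<in> D" using T_D x t by auto
      have "A (T s x - T t x) = A (T s x) - A (T t x)"
        using A(1)[OF s(1) D_scaleR[OF s(2), of "-1"]] A_scaleR[OF s(2), of "-1"] by simp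
      then show "graph_norm N A (T s x - T t x) = N (T s x - T t x) + N (A (T s x) - A (T t x))"
        by (simp add: graph_norm_def)
    qed
    ultimately show "((\<lambda>s. graph_norm N A (T s x - T t x)) \<longlongrightarrow> 0) (at t within {0..})"
      by (simp add: tendsto_cong)
  qed
qed

end

section \<open>The space \<open>L\<^sup>2(\<real>)\<close>\<close>

lemma l2_rel_rep: "l2_rel (rep_l2 u) (rep_l2 u)"
  using Quotient_l2 Quotient_rep_reflp by fastforce

lemma square_integrable_rep: "square_integrable (rep_l2 u)"
  using l2_rel_rep by (simp add: l2_rel_def)

lemma borel_rep [measurable]: "rep_l2 u \<in> borel_measurable borel"
  using square_integrable_rep[of u] by (simp add: square_integrable_def)

lemma integrable_rep_power2: "integrable lborel (\<lambda>x. (cmod (rep_l2 u x))\<^sup>2)"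
  using square_integrable_rep[of u] by (simp add: square_integrable_def)

lemma rep_abs: "square_integrable f \<Longrightarrow> AE x in lborel. rep_l2 (abs_l2 f) x = f x"
  using Quotient_rep_abs[OF Quotient_l2, of f] by (simp add: l2_rel_def)

lemma abs_rep: "abs_l2 (rep_l2 u) = u"
  by (rule Quotient_abs_rep[OF Quotient_l2])

lemma abs_eqI: "square_integrable f \<Longrightarrow> square_integrable g \<Longrightarrow> (AE x in lborel. f x = g x) \<Longrightarrow> abs_l2 f = abs_l2 g"
  using Quotient_rel_abs[OF Quotient_l2] by (simp add: l2_rel_def)

lemma l2_eqI: "(AE x in lborel. rep_l2 u x = rep_l2 v x) \<Longrightarrow> u = v"
  using abs_eqI[OF square_integrable_rep square_integrable_rep] by (metis abs_rep)

lemma rep_abs_op: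
  assumes "square_integrable f" "u = abs_l2 f"
  shows "AE x in lborel. rep_l2 u x = f x"
  using assms rep_abs by blast

lemma rep_add: "AE x in lborel. rep_l2 (u + v) x = rep_l2 u x + rep_l2 v x"
  by (rule rep_abs_op) (auto simp: plus_l2_def intro: square_integrable_add square_integrable_rep)

lemma rep_scaleC: "AE x in lborel. rep_l2 (c *\<^sub>C u) x = c * rep_l2 u x"
  by (rule rep_abs_op) (auto simp: scaleC_l2_def intro: square_integrable_mult square_integrable_rep)

lemma rep_0: "AE x in lborel. rep_l2 0 x = 0"
  by (rule rep_abs_op) (auto simp: zero_l2_def intro: square_integrable_0)

lemma rep_diff: "AE x in lborel. rep_l2 (u - v) x = rep_l2 u x - rep_l2 v x"
  using rep_add[of u "(-1) *\<^sub>C v"] rep_scaleC[of "-1" v] unfolding minus_l2_def by eventually_elim simp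

lemma abs_add: "square_integrable f \<Longrightarrow> square_integrable g \<Longrightarrow> abs_l2 (\<lambda>x. f x + g x) = abs_l2 f + abs_l2 g"
  using plus_l2.abs_eq by (simp add: l2_rel_def)

lemma abs_scaleC: "square_integrable f \<Longrightarrow> abs_l2 (\<lambda>x. c * f x) = c *\<^sub>C abs_l2 f"
  using scaleC_l2.abs_eq by (simp add: l2_rel_def)

lemma inner_l2_eq: "u \<bullet> v = (LINT x|lborel. rep_l2 u x \<bullet> rep_l2 v x)"
  by (simp add: inner_l2_def)

lemma norm_l2_eq: "(norm u)\<^sup>2 = (LINT x|lborel. (cmod (rep_l2 u x))\<^sup>2)"
  by (simp add: norm_l2_def)

lemma inner_abs: "square_integrable f \<Longrightarrow> u \<bullet> abs_l2 f = (LINT x|lborel. rep_l2 u x \<bullet> f x)"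
  unfolding inner_l2_eq
  by (intro integral_cong_AE) (use rep_abs[of f] in \<open>auto simp: square_integrable_def elim: AE_mp\<close>)

lemma nn_norm_l2: "(\<integral>\<^sup>+x. ennreal ((cmod (rep_l2 u x))\<^sup>2) \<partial>lborel) = ennreal ((norm u)\<^sup>2)"
  unfolding norm_l2_eq by (intro nn_integral_eq_integral integrable_rep_power2) auto

lemma norm_scaleC_l2: "norm (c *\<^sub>C (u::l2)) = cmod c * norm u"
proof -
  have "(norm (c *\<^sub>C u))\<^sup>2 = (LINT x|lborel. (cmod c)\<^sup>2 * (cmod (rep_l2 u x))\<^sup>2)"
    unfolding norm_l2_eq using rep_scaleC[of c u]
    by (intro integral_cong_AE) (auto simp: norm_mult power_mult_distrib elim!: AE_mp)
  also have "\<dots> = (cmod c * norm u)\<^sup>2" by (simp add: norm_l2_eq power_mult_distrib)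
  finally show ?thesis by (simp add: power2_eq_iff_nonneg)
qed

lemma inner_scaleC_l2: "(c *\<^sub>C u) \<bullet> v = u \<bullet> (cnj c *\<^sub>C (v::l2))"
  unfolding inner_l2_eq
proof (intro integral_cong_AE)
  show "AE x in lborel. rep_l2 (c *\<^sub>C u) x \<bullet> rep_l2 v x = rep_l2 u x \<bullet> rep_l2 (cnj c *\<^sub>C v) x"
    using rep_scaleC[of c u] rep_scaleC[of "cnj c" v]
    by eventually_elim (simp add: inner_complex_def algebra_simps)
qed auto

text \<open>Along a fast Cauchy subsequence the increments satisfy \<open>\<Sum> 2\<^sup>k |d\<^sub>k|\<^sup>2 < \<infinity>\<close> almost everywhere,
  which gives a pointwise limit; Fatou's lemma identifies it as the limit in \<open>L\<^sup>2\<close>.\<close>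

lemma summable_increments:
  fixes f :: "nat \<Rightarrow> complex"
  assumes "(\<Sum>k. ennreal (2 ^ k * (cmod (f (Suc k) - f k))\<^sup>2)) \<noteq> \<infinity>"
  shows "convergent f"
proof -
  have "summable (\<lambda>k. 2 ^ k * (cmod (f (Suc k) - f k))\<^sup>2)"
    using assms by (intro summable_suminf_not_top) auto
  then have "Bseq (\<lambda>k. 2 ^ k * (cmod (f (Suc k) - f k))\<^sup>2)"
    by (intro convergent_imp_Bseq summable_LIMSEQ_zero[THEN convergentI])
  then obtain C where C: "0 < C" "\<And>k. 2 ^ k * (cmod (f (Suc k) - f k))\<^sup>2 \<le> C"
    unfolding Bseq_def by auto
  \<comment> \<open>Boundedness of the weighted squares already bounds the increments by a geometric
    sequence of ratio 2^(-1/2).\<close>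
  have le: "cmod (f (Suc k) - f k) \<le> sqrt C * (1 / sqrt 2) ^ k" for k
  proof -
    have "(cmod (f (Suc k) - f k))\<^sup>2 \<le> C / 2 ^ k" using C(2)[of k] by (simp add: field_simps)
    then have "cmod (f (Suc k) - f k) \<le> sqrt (C / 2 ^ k)" by (rule real_le_rsqrt)
    then show ?thesis by (simp add: real_sqrt_divide real_sqrt_power power_one_over)
  qed
  have "summable (\<lambda>k. sqrt C * (1 / sqrt 2) ^ k)"
    by (intro summable_mult summable_geometric) simp
  then have "summable (\<lambda>k. f (Suc k) - f k)"
    by (rule summable_comparison_test') (rule le)
  then have "convergent (\<lambda>n. \<Sum>k<n. f (Suc k) - f k)" by (simp add: summable_iff_convergent)
  then have "convergent (\<lambda>n. f n - f 0)" by (simp add: sum_lessThan_telescope)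
  then have "convergent (\<lambda>n. (f n - f 0) + f 0)" by (intro convergent_add convergent_const)
  then show ?thesis by simp
qed

lemma fast_Cauchy_subseq:
  assumes "Cauchy (X :: nat \<Rightarrow> 'a::real_normed_vector)"
  obtains r where "strict_mono r" "\<And>k. norm (X (r (Suc k)) - X (r k)) < (1 / 2) ^ k"
proof -
  have "\<exists>M. \<forall>m\<ge>M. \<forall>n\<ge>M. norm (X m - X n) < (1 / 2) ^ k" for k
    using CauchyD[OF assms, of "(1 / 2) ^ k"] by auto
  then obtain M where M: "\<And>k m n. m \<ge> M k \<Longrightarrow> n \<ge> M k \<Longrightarrow> norm (X m - X n) < (1 / 2) ^ k" by metis
  \<comment> \<open>The \<open>Suc\<close> makes \<open>r\<close> strictly increasing, while the
    last summand alone keeps \<open>r k\<close> above \<open>M k\<close>.\<close>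
  define r where "r k = (\<Sum>j\<le>k. Suc (M j))" for k
  have Mr: "M k \<le> r k" for k
    unfolding r_def using member_le_sum[of k "{..k}" "\<lambda>j. Suc (M j)"] by simp
  have "norm (X (r (Suc k)) - X (r k)) < (1 / 2) ^ k" for k
    using Mr[of k] by (intro M) (auto simp: r_def)
  moreover have "strict_mono r" by (rule strict_monoI_Suc) (simp add: r_def)
  ultimately show ?thesis using that by blast
qed

instance l2 :: banach
proof
  fix X :: "nat \<Rightarrow> l2" assume X: "Cauchy X"
  obtain r where r: "strict_mono r" "\<And>k. norm (X (r (Suc k)) - X (r k)) < (1 / 2) ^ k"
    using fast_Cauchy_subseq[OF X] by blast
  define f where "f k = rep_l2 (X (r k))" for k
  have [measurable]: "f k \<in> borel_measurable borel" for k by (simp add: f_def)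
  have nn: "(\<integral>\<^sup>+x. ennreal ((cmod (f i x - f j x))\<^sup>2) \<partial>lborel) = ennreal ((norm (X (r i) - X (r j)))\<^sup>2)" for i j
    unfolding nn_norm_l2[symmetric] f_def using rep_diff[of "X (r i)" "X (r j)"]
    by (intro nn_integral_cong_AE) (auto elim!: AE_mp)
  have "(\<integral>\<^sup>+x. (\<Sum>k. ennreal (2 ^ k * (cmod (f (Suc k) x - f k x))\<^sup>2)) \<partial>lborel)
      = (\<Sum>k. \<integral>\<^sup>+x. ennreal (2 ^ k * (cmod (f (Suc k) x - f k x))\<^sup>2) \<partial>lborel)"
    by (intro nn_integral_suminf) measurable
  also have "\<dots> \<le> (\<Sum>k. ennreal ((1 / 2) ^ k))"
  proof (intro suminf_le summableI)
    fix k
    have "(\<integral>\<^sup>+x. ennreal (2 ^ k * (cmod (f (Suc k) x - f k x))\<^sup>2) \<partial>lborel)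
        = ennreal (2 ^ k) * ennreal ((norm (X (r (Suc k)) - X (r k)))\<^sup>2)"
      by (simp add: ennreal_mult nn_integral_cmult nn)
    \<comment> \<open>Squared increments decay like 4^(-k), so the weight 2^k still leaves a
      convergent geometric series.\<close>
    also have "\<dots> \<le> ennreal (2 ^ k) * ennreal (((1 / 2) ^ k)\<^sup>2)"
      using r(2)[of k] by (intro mult_left_mono ennreal_leI power_mono) auto
    also have "\<dots> = ennreal ((1 / 2) ^ k)"
      by (simp add: ennreal_mult[symmetric] power2_eq_square power_one_over)
    finally show "(\<integral>\<^sup>+x. ennreal (2 ^ k * (cmod (f (Suc k) x - f k x))\<^sup>2) \<partial>lborel) \<le> ennreal ((1 / 2) ^ k)" .
  qed
  also have "\<dots> = ennreal (\<Sum>k. (1 / 2) ^ k)"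
    by (intro suminf_ennreal2 summable_geometric) auto
  finally have "(\<integral>\<^sup>+x. (\<Sum>k. ennreal (2 ^ k * (cmod (f (Suc k) x - f k x))\<^sup>2)) \<partial>lborel) \<noteq> \<infinity>"
    by (metis ennreal_less_top infinity_ennreal_def less_top neq_top_trans)
  then have "AE x in lborel. (\<Sum>k. ennreal (2 ^ k * (cmod (f (Suc k) x - f k x))\<^sup>2)) \<noteq> \<infinity>"
    by (intro nn_integral_PInf_AE) measurable
  then have conv: "AE x in lborel. convergent (\<lambda>k. f k x)"
    by eventually_elim (rule summable_increments)
  define g where "g x = lim (\<lambda>k. f k x)" for x
  have [measurable]: "g \<in> borel_measurable borel"
    unfolding g_def[abs_def] by measurable
  have lim: "AE x in lborel. (\<lambda>k. f k x) \<longlonglongrightarrow> g x"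
    using conv by eventually_elim (simp add: g_def convergent_LIMSEQ_iff)
  have fatou: "(\<integral>\<^sup>+x. ennreal ((cmod (g x - f k x))\<^sup>2) \<partial>lborel) \<le> ennreal (e\<^sup>2)"
    if e: "0 \<le> e" "\<And>j. j \<ge> k \<Longrightarrow> norm (X (r j) - X (r k)) \<le> e" for e k
  proof -
    have "(\<integral>\<^sup>+x. ennreal ((cmod (g x - f k x))\<^sup>2) \<partial>lborel)
        = (\<integral>\<^sup>+x. liminf (\<lambda>j. ennreal ((cmod (f j x - f k x))\<^sup>2)) \<partial>lborel)"
    proof (rule nn_integral_cong_AE)
      show "AE x in lborel. ennreal ((cmod (g x - f k x))\<^sup>2) = liminf (\<lambda>j. ennreal ((cmod (f j x - f k x))\<^sup>2))"
        using lim
      proof eventually_elim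
        fix x assume "(\<lambda>j. f j x) \<longlonglongrightarrow> g x"
        then have "(\<lambda>j. ennreal ((cmod (f j x - f k x))\<^sup>2)) \<longlonglongrightarrow> ennreal ((cmod (g x - f k x))\<^sup>2)"
          by (intro tendsto_intros tendsto_ennrealI)
        then show "ennreal ((cmod (g x - f k x))\<^sup>2) = liminf (\<lambda>j. ennreal ((cmod (f j x - f k x))\<^sup>2))"
          by (intro lim_imp_Liminf[symmetric]) auto
      qed
    qed
    also have "\<dots> \<le> liminf (\<lambda>j. \<integral>\<^sup>+x. ennreal ((cmod (f j x - f k x))\<^sup>2) \<partial>lborel)"
      by (intro nn_integral_liminf) measurable
    also have "\<dots> = liminf (\<lambda>j. ennreal ((norm (X (r j) - X (r k)))\<^sup>2))" by (simp add: nn)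
    also have "\<dots> \<le> liminf (\<lambda>j. ennreal (e\<^sup>2))"
      using e by (intro Liminf_mono eventually_sequentiallyI[of k] ennreal_leI power_mono) auto
    also have "\<dots> = ennreal (e\<^sup>2)" by (simp add: Liminf_const)
    finally show ?thesis .
  qed
  have si: "square_integrable (\<lambda>x. g x - f k x)" if "0 \<le> e" "\<And>j. j \<ge> k \<Longrightarrow> norm (X (r j) - X (r k)) \<le> e" for e k
    unfolding square_integrable_def
  proof
    show "integrable lborel (\<lambda>x. (cmod (g x - f k x))\<^sup>2)"
      using fatou[OF that] by (intro integrableI_nonneg) (auto simp: top_unique less_top[symmetric] intro: order_le_less_trans)
  qed measurable
  have Cr: "\<exists>k0. \<forall>k\<ge>k0. \<forall>j\<ge>k. norm (X (r j) - X (r k)) \<le> e" if "0 < e" for e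
  proof -
    have "Cauchy (X \<circ> r)" using X r(1) by (rule Cauchy_subseq_Cauchy)
    from CauchyD[OF this that] obtain M where
      "\<And>m n. m \<ge> M \<Longrightarrow> n \<ge> M \<Longrightarrow> norm ((X \<circ> r) m - (X \<circ> r) n) < e" by blast
    then show ?thesis by (intro exI[of _ M]) (simp add: less_imp_le)
  qed
  obtain k1 where k1: "\<forall>k\<ge>k1. \<forall>j\<ge>k. norm (X (r j) - X (r k)) \<le> 1" using Cr[of 1] by auto
  \<comment> \<open>\<open>fatou\<close> controls differences only; adding one of the functions back
    shows that \<open>g\<close> itself is square integrable.\<close>
  have "square_integrable (\<lambda>x. (g x - f k1 x) + f k1 x)"
    using k1 unfolding f_def[of k1] by (intro square_integrable_add square_integrable_rep si[of 1 k1, unfolded f_def]) auto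
  then have sg: "square_integrable g" by simp
  have "(X \<circ> r) \<longlonglongrightarrow> abs_l2 g"
  proof (rule metric_LIMSEQ_I)
    fix e :: real assume e: "0 < e"
    then obtain k0 where k0: "\<forall>k\<ge>k0. \<forall>j\<ge>k. norm (X (r j) - X (r k)) \<le> e / 2" using Cr[of "e/2"] by auto
    have "dist ((X \<circ> r) k) (abs_l2 g) < e" if "k \<ge> k0" for k
    proof -
      have "ennreal ((norm (abs_l2 g - X (r k)))\<^sup>2) = (\<integral>\<^sup>+x. ennreal ((cmod (g x - f k x))\<^sup>2) \<partial>lborel)"
        unfolding nn_norm_l2[symmetric] f_def using rep_diff[of "abs_l2 g" "X (r k)"] rep_abs[OF sg]
        by (intro nn_integral_cong_AE) (auto elim!: AE_mp)
      also have "\<dots> \<le> ennreal ((e / 2)\<^sup>2)"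
        using k0 e that by (intro fatou) auto
      finally have "(norm (abs_l2 g - X (r k)))\<^sup>2 \<le> (e / 2)\<^sup>2" by (simp add: ennreal_le_iff)
      then have "norm (abs_l2 g - X (r k)) \<le> e / 2" by (rule power2_le_imp_le) (use e in simp)
      then show ?thesis using e by (simp add: dist_norm norm_minus_commute)
    qed
    then show "\<exists>no. \<forall>n\<ge>no. dist ((X \<circ> r) n) (abs_l2 g) < e" by blast
  qed
  then have "X \<longlonglongrightarrow> abs_l2 g"
    using Cauchy_converges_subseq[OF X r(1)] by (simp add: o_def)
  then show "convergent X" by (rule convergentI)
qed

section \<open>Test functions\<close>

abbreviation dv :: "(real \<Rightarrow> complex) \<Rightarrow> real \<Rightarrow> complex" where
  "dv f \<equiv> (\<lambda>x. vector_derivative f (at x))"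

text \<open>A set of differentiable functions closed under \<open>dv\<close> contains all iterated
  derivatives of its members, so no formula for the k-th derivative is needed.\<close>

lemma smooth_coinduct:
  assumes "f \<in> S" and S: "\<And>g. g \<in> S \<Longrightarrow> (\<forall>x. g differentiable at x) \<and> dv g \<in> S"
  shows "smooth f"
proof -
  have "((\<lambda>g. dv g) ^^ k) f \<in> S" for k
    by (induction k) (use assms in auto)
  then show ?thesis unfolding smooth_def using S by blast
qed

lemma smooth_differentiable: "smooth f \<Longrightarrow> f differentiable at x"
  unfolding smooth_def by (metis funpow_0)

lemma smooth_dv: "smooth f \<Longrightarrow> smooth (dv f)"
  unfolding smooth_def by (metis (no_types, lifting) comp_apply funpow_Suc_right)

lemma smooth_has_dv: "smooth f \<Longrightarrow> (f has_vector_derivative dv f x) (at x)"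
  using smooth_differentiable vector_derivative_works by blast

lemma smooth_continuous: "smooth f \<Longrightarrow> continuous_on S f"
  by (meson continuous_at_imp_continuous_on differentiable_imp_continuous_within smooth_differentiable)

lemma smooth_borel: "smooth f \<Longrightarrow> f \<in> borel_measurable borel"
  by (intro borel_measurable_continuous_onI smooth_continuous)

lemma dv_eqI: "(\<And>x. (f has_vector_derivative f' x) (at x)) \<Longrightarrow> dv f = f'"
  by (rule ext) (rule vector_derivative_at)

lemma smooth_by_derivative:
  assumes "\<And>x. (f has_vector_derivative f' x) (at x)" "smooth f'"
  shows "smooth f"
proof (rule smooth_coinduct[of f "insert f {g. smooth g}"])
  fix g assume "g \<in> insert f {g. smooth g}"
  then show "(\<forall>x. g differentiable at x) \<and> dv g \<in> insert f {g. smooth g}"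
    using assms(2) dv_eqI[OF assms(1)] smooth_dv smooth_differentiable differentiableI_vector[OF assms(1)]
    by auto
qed simp

lemma smooth_const: "smooth (\<lambda>_. c)"
proof -
  have z: "smooth (\<lambda>_. 0)" by (rule smooth_coinduct[of _ "{\<lambda>_. 0}"]) auto
  show ?thesis by (rule smooth_by_derivative[OF has_vector_derivative_const z])
qed

text \<open>Products of smooth functions are not closed under differentiation, but their sums are, which is
  what coinduction needs.\<close>

inductive_set product_sums :: "(real \<Rightarrow> complex) set" where
  prod: "smooth f \<Longrightarrow> smooth g \<Longrightarrow> (\<lambda>x. f x * g x) \<in> product_sums"
| add: "f \<in> product_sums \<Longrightarrow> g \<in> product_sums \<Longrightarrow> (\<lambda>x. f x + g x) \<in> product_sums"

lemma product_sums_smooth: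
  assumes "f \<in> product_sums"
  shows "smooth f"
proof (rule smooth_coinduct[OF assms])
  fix f assume "f \<in> product_sums"
  then have "\<exists>f'\<in>product_sums. \<forall>x. (f has_vector_derivative f' x) (at x)"
  proof induction
    case (prod f g)
    have "((\<lambda>x. f x * g x) has_vector_derivative f x * dv g x + dv f x * g x) (at x)" for x
      by (intro has_vector_derivative_mult smooth_has_dv prod)
    then show ?case
      by (intro bexI[of _ "\<lambda>x. f x * dv g x + dv f x * g x"] product_sums.intros smooth_dv prod) auto
  next
    case (add f g)
    then obtain f' g' where "f' \<in> product_sums" "g' \<in> product_sums"
      "\<forall>x. (f has_vector_derivative f' x) (at x)" "\<forall>x. (g has_vector_derivative g' x) (at x)" by blast
    then show ?case
      by (intro bexI[of _ "\<lambda>x. f' x + g' x"] product_sums.intros allI has_vector_derivative_add) auto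
  qed
  then show "(\<forall>x. f differentiable at x) \<and> dv f \<in> product_sums"
    using dv_eqI by (metis differentiableI_vector)
qed

lemma smooth_mult: "smooth f \<Longrightarrow> smooth g \<Longrightarrow> smooth (\<lambda>x. f x * g x)"
  by (rule product_sums_smooth[OF product_sums.prod])

lemma smooth_add: "smooth f \<Longrightarrow> smooth g \<Longrightarrow> smooth (\<lambda>x. f x + g x)"
  using product_sums.add[OF product_sums.prod[of f "\<lambda>_. 1"] product_sums.prod[of g "\<lambda>_. 1"]]
  by (auto intro!: product_sums_smooth simp: smooth_const)

lemma smooth_cnj:
  assumes "smooth f" shows "smooth (\<lambda>x. cnj (f x))"
proof (rule smooth_coinduct[of _ "(\<lambda>g x. cnj (g x)) ` {g. smooth g}"])
  fix g assume "g \<in> (\<lambda>g x. cnj (g x)) ` {g. smooth g}"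
  then obtain k where k: "smooth k" "g = (\<lambda>x. cnj (k x))" by blast
  then have "(g has_vector_derivative cnj (dv k x)) (at x)" for x
    by (auto intro!: has_vector_derivative_cnj smooth_has_dv)
  then show "(\<forall>x. g differentiable at x) \<and> dv g \<in> (\<lambda>g x. cnj (g x)) ` {g. smooth g}"
    using k smooth_dv dv_eqI[of g "\<lambda>x. cnj (dv k x)"] by (auto intro: differentiableI_vector)
qed (use assms in auto)

text \<open>Each derivative contributes a factor \<open>a\<close>, so the set used for the
  coinduction carries a scalar \<open>c\<close>.\<close>

lemma smooth_affine:
  assumes "smooth f" shows "smooth (\<lambda>x. f (a * x + b))"
proof (rule smooth_coinduct[of _ "(\<lambda>(c, g) x. complex_of_real c * g (a * x + b)) ` {(c, g). smooth g}"])
  fix g assume "g \<in> (\<lambda>(c, g) x. complex_of_real c * g (a * x + b)) ` {(c, g). smooth g}"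
  then obtain c k where k: "smooth k" "g = (\<lambda>x. complex_of_real c * k (a * x + b))" by auto
  have "(g has_vector_derivative complex_of_real (c * a) * dv k (a * x + b)) (at x)" for x
  proof -
    have "((\<lambda>x. a * x + b) has_vector_derivative a) (at x)"
      by (auto intro!: derivative_eq_intros)
    from vector_diff_chain_at[OF this smooth_has_dv[OF k(1), of "a * x + b"]]
    have "((\<lambda>x. k (a * x + b)) has_vector_derivative a *\<^sub>R dv k (a * x + b)) (at x)" by (simp add: o_def)
    from has_vector_derivative_mult_right[OF this, of "complex_of_real c"] show ?thesis
      by (simp add: k(2) scaleR_conv_of_real mult.assoc)
  qed
  then show "(\<forall>x. g differentiable at x) \<and> dv g \<in> (\<lambda>(c, g) x. complex_of_real c * g (a * x + b)) ` {(c, g). smooth g}"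
    using smooth_dv[OF k(1)] dv_eqI[of g "\<lambda>x. complex_of_real (c * a) * dv k (a * x + b)"]
    by (auto intro: differentiableI_vector intro!: image_eqI[of _ _ "(c * a, dv k)"])
qed (use assms in \<open>auto intro!: image_eqI[of _ _ "(1, f)"]\<close>)

text \<open>The functions \<open>p(1/x) exp(-1/x)\<close>, extended by zero to \<open>x \<le> 0\<close>, are closed under
  differentiation; the case \<open>p = 1\<close> is the standard flat function.\<close>

definition flat :: "real poly \<Rightarrow> real \<Rightarrow> real" where
  "flat p x = (if 0 < x then poly p (1 / x) * exp (- (1 / x)) else 0)"

text \<open>The extra power of \<open>t\<close> is what the induction needs, since
  \<open>pCons a p\<close> evaluates to a + t p(t).\<close>

lemma poly_exp_tendsto_0: "((\<lambda>t::real. t ^ k * poly p t * exp (- t)) \<longlongrightarrow> 0) at_top"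
proof (induction p arbitrary: k)
  case 0 then show ?case by simp
next
  case (pCons a p)
  have "((\<lambda>t. a * (t ^ k / exp t) + t ^ Suc k * poly p t * exp (- t)) \<longlongrightarrow> a * 0 + 0) at_top"
    by (intro tendsto_intros tendsto_power_div_exp_0 pCons.IH)
  then show ?case by (simp add: exp_minus field_simps)
qed

lemma flat_tendsto_0: "(flat p \<longlongrightarrow> 0) (at 0)"
proof (rule filterlim_split_at_real)
  show "(flat p \<longlongrightarrow> 0) (at_left 0)"
    by (rule Lim_transform_eventually[of "\<lambda>_. 0"]) (auto simp: eventually_at_filter flat_def)
  have "((\<lambda>x. poly p (inverse x) * exp (- inverse x)) \<longlongrightarrow> 0) (at_right (0::real))"
    using filterlim_compose[OF poly_exp_tendsto_0[of 0 p] filterlim_inverse_at_top_right] by simp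
  then show "(flat p \<longlongrightarrow> 0) (at_right 0)"
    by (rule Lim_transform_eventually) (auto simp: eventually_at_filter flat_def inverse_eq_divide)
qed

text \<open>With t = 1/x one has d/dx = - t^2 d/dt, so the derivative of p(t) exp(-t) is t^2 (p -
  p')(t) exp(-t); \<open>[:0, 0, 1:]\<close> is the polynomial t^2.\<close>

lemma flat_derivative:
  "(flat p has_real_derivative flat ([:0, 0, 1:] * (p - pderiv p)) x) (at x)"
proof -
  consider "x < 0" | "x = 0" | "0 < x" by linarith
  then show ?thesis
  proof cases
    case 1
    have "((\<lambda>_. 0) has_real_derivative 0) (at x)" by simp
    then show ?thesis using 1
      by (subst DERIV_cong_ev[OF refl _ refl, of _ "\<lambda>_. 0"])
        (auto simp: flat_def eventually_nhds intro!: exI[of _ "{..<0}"])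
  next
    case 2
    \<comment> \<open>Dividing by \<open>h\<close> multiplies the polynomial by its variable, so the
      quotient is again flat, with \<open>pCons 0 p\<close>.\<close>
    have "((\<lambda>h. (flat p (0 + h) - flat p 0) / h) \<longlongrightarrow> 0) (at 0)"
      by (rule Lim_transform_eventually[OF flat_tendsto_0[of "pCons 0 p"]])
        (auto simp: eventually_at_filter flat_def)
    then show ?thesis using 2 by (simp add: DERIV_def flat_def)
  next
    case 3
    have "((\<lambda>x. poly p (1 / x) * exp (- (1 / x))) has_real_derivative
        flat ([:0, 0, 1:] * (p - pderiv p)) x) (at x)"
      using 3 by (auto intro!: derivative_eq_intros simp: flat_def field_simps power2_eq_square)
    then show ?thesis using 3
      by (subst DERIV_cong_ev[OF refl _ refl, of _ "\<lambda>x. poly p (1 / x) * exp (- (1 / x))"])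
        (auto simp: flat_def eventually_nhds intro!: exI[of _ "{0<..}"])
  qed
qed

lemma smooth_flat: "smooth (\<lambda>x. complex_of_real (flat p x))"
proof (rule smooth_coinduct[of _ "range (\<lambda>p x. complex_of_real (flat p x))"])
  fix g assume "g \<in> range (\<lambda>p x. complex_of_real (flat p x))"
  then obtain p where p: "g = (\<lambda>x. complex_of_real (flat p x))" by blast
  have "(g has_vector_derivative complex_of_real (flat ([:0, 0, 1:] * (p - pderiv p)) x)) (at x)" for x
    unfolding p
    by (intro has_vector_derivative_of_real) (simp only: flat_derivative has_real_derivative_iff_has_vector_derivative[symmetric])
  from differentiableI_vector[OF this] dv_eqI[OF this]
  show "(\<forall>x. g differentiable at x) \<and> dv g \<in> range (\<lambda>p x. complex_of_real (flat p x))"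
    by blast
qed simp

text \<open>Vanishing integrals pass from intervals to all Borel sets; the bounded support supplies
  the total integral needed for complements. The sets where \<open>f\<close> is positive or negative
  then force the claim.\<close>

lemma AE_eq_0_if_interval_integrals_eq_0:
  fixes f :: "real \<Rightarrow> real"
  assumes f [measurable]: "integrable lborel f" and supp: "\<And>x. x \<notin> {a..b} \<Longrightarrow> f x = 0"
    and zero: "\<And>c d. c \<le> d \<Longrightarrow> (LINT x:{c..d}|lborel. f x) = 0"
  shows "AE x in lborel. f x = 0"
proof -
  have total: "(LINT x|lborel. f x) = 0"
  proof -
    have "(LINT x|lborel. f x) = (LINT x:{min a b..max a b}|lborel. f x)"
      unfolding set_lebesgue_integral_def using supp
      by (intro Bochner_Integration.integral_cong refl) (force simp: indicator_def)
    then show ?thesis using zero[of "min a b" "max a b"] by simp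
  qed
  have int: "set_integrable lborel A f" if "A \<in> sets borel" for A
    unfolding set_integrable_def using that by (intro integrable_mult_indicator[OF _ f]) simp
  have all: "(LINT x:A|lborel. f x) = 0" if "A \<in> sets borel" for A
    using that
  proof (induction A rule: borel_set_induct)
    case (compl A)
    have "(LINT x:A \<union> - A|lborel. f x) = (LINT x:A|lborel. f x) + (LINT x:- A|lborel. f x)"
      using compl by (intro set_integral_Un int) auto
    moreover have "A \<union> - A = UNIV" by auto
    ultimately show ?case using compl total by (simp add: set_lebesgue_integral_def)
  next
    case (union A)
    then have "(LINT x:(\<Union>i. A i)|lborel. f x) = (\<Sum>i. LINT x:A i|lborel. f x)"
      by (intro lebesgue_integral_countable_add int) (auto simp: disjoint_family_on_def)
    then show ?case using union by simp
  qed (auto simp: zero set_lebesgue_integral_def[of _ "{}"])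
  have nonneg: "AE x in lborel. indicator {x. 0 < s * f x} x * (s * f x) = 0" for s
  proof -
    have "(LINT x|lborel. indicator {x. 0 < s * f x} x * (s * f x)) = s * (LINT x:{x. 0 < s * f x}|lborel. f x)"
      unfolding set_lebesgue_integral_def by (subst Bochner_Integration.integral_mult_right_zero[symmetric]) (simp add: mult_ac)
    also have "\<dots> = 0" by (simp add: all)
    finally have "(LINT x|lborel. indicator {x. 0 < s * f x} x * (s * f x)) = 0" .
    moreover have "integrable lborel (\<lambda>x. indicat_real {x. 0 < s * f x} x *\<^sub>R (s * f x))"
      by (intro integrable_mult_indicator integrable_mult_right f) measurable
    moreover have "0 \<le> indicat_real {x. 0 < s * f x} x * (s * f x)" for x
      by (cases "0 < s * f x") auto
    ultimately show ?thesis
      by (subst (asm) integral_nonneg_eq_0_iff_AE) auto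
  qed
  show ?thesis using nonneg[of 1] nonneg[of "-1"]
    by eventually_elim (auto simp: indicator_def split: if_splits)
qed

lemma integrable_mult_square_integrable:
  assumes "square_integrable f" "square_integrable g"
  shows "integrable lborel (\<lambda>x. f x * g x)"
proof -
  have [measurable]: "f \<in> borel_measurable lborel" "g \<in> borel_measurable lborel"
    using assms by (auto simp: square_integrable_def)
  have "integrable lborel (\<lambda>x. (cmod (f x))\<^sup>2 + (cmod (g x))\<^sup>2)"
    using assms by (auto simp: square_integrable_def)
  then show ?thesis
  proof (rule Bochner_Integration.integrable_bound)
    have "cmod (f x * g x) \<le> (cmod (f x))\<^sup>2 + (cmod (g x))\<^sup>2" for x
    proof -
      have "0 \<le> (cmod (f x) - cmod (g x))\<^sup>2" "0 \<le> cmod (f x) * cmod (g x)" by auto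
      then show ?thesis unfolding power2_diff norm_mult by linarith
    qed
    then show "AE x in lborel. norm (f x * g x) \<le> norm ((cmod (f x))\<^sup>2 + (cmod (g x))\<^sup>2)" by auto
  qed measurable
qed

lemma square_integrable_compact_support:
  assumes "continuous_on UNIV f" "\<And>x. x \<notin> {a..b} \<Longrightarrow> f x = 0"
  shows "square_integrable f"
  unfolding square_integrable_def
proof
  show "f \<in> borel_measurable lborel"
    using borel_measurable_continuous_onI[OF assms(1)] by simp
  have "set_integrable lborel {a..b} (\<lambda>x. (cmod (f x))\<^sup>2)"
    by (intro borel_integrable_atLeastAtMost' continuous_intros continuous_on_subset[OF assms(1)]) auto
  moreover have "(\<lambda>x. indicat_real {a..b} x *\<^sub>R (cmod (f x))\<^sup>2) = (\<lambda>x. (cmod (f x))\<^sup>2)"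
    using assms(2) by (force simp: indicator_def)
  ultimately show "integrable lborel (\<lambda>x. (cmod (f x))\<^sup>2)"
    by (simp add: set_integrable_def)
qed

section \<open>Test functions on the interval and the fundamental lemma\<close>

locale interval =
  fixes L :: real
  assumes L: "0 < L"
begin

abbreviation test :: "(real \<Rightarrow> complex) \<Rightarrow> bool" where
  "test \<equiv> test_function L"

lemma test_iff: "test \<eta> \<longleftrightarrow> smooth \<eta> \<and> (\<exists>a b. 0 < a \<and> b < L \<and> (\<forall>x. x \<notin> {a..b} \<longrightarrow> \<eta> x = 0))"
proof (intro iffI conjI)
  assume t: "test \<eta>"
  then show "smooth \<eta>" by (simp add: test_function_def)
  let ?K = "closure {x. \<eta> x \<noteq> 0}"
  have K: "compact ?K" "?K \<subseteq> {0<..<L}" using t by (auto simp: test_function_def)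
  show "\<exists>a b. 0 < a \<and> b < L \<and> (\<forall>x. x \<notin> {a..b} \<longrightarrow> \<eta> x = 0)"
  proof (cases "?K = {}")
    case True
    then have "\<eta> x = 0" for x by auto
    \<comment> \<open>For the zero function the witnesses a = L and b = 0 give an empty interval
      that still satisfies 0 < a and b < L.\<close>
    then show ?thesis using L by (intro exI[of _ L] exI[of _ 0]) auto
  next
    case False
    obtain a where a: "a \<in> ?K" "\<And>x. x \<in> ?K \<Longrightarrow> a \<le> x" using compact_attains_inf[OF K(1) False] by blast
    obtain b where b: "b \<in> ?K" "\<And>x. x \<in> ?K \<Longrightarrow> x \<le> b" using compact_attains_sup[OF K(1) False] by blast
    have "\<eta> x = 0" if "x \<notin> {a..b}" for x
    proof (rule ccontr)
      assume "\<eta> x \<noteq> 0"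
      then have "x \<in> ?K" using closure_subset[of "{x. \<eta> x \<noteq> 0}"] by blast
      then show False using a b that by auto
    qed
    moreover have "0 < a" "b < L" using a(1) b(1) K(2) by auto
    ultimately show ?thesis by blast
  qed
next
  assume "smooth \<eta> \<and> (\<exists>a b. 0 < a \<and> b < L \<and> (\<forall>x. x \<notin> {a..b} \<longrightarrow> \<eta> x = 0))"
  then obtain a b where ab: "smooth \<eta>" "0 < a" "b < L" "\<And>x. x \<notin> {a..b} \<Longrightarrow> \<eta> x = 0" by blast
  have "{x. \<eta> x \<noteq> 0} \<subseteq> {a..b}" using ab(4) by blast
  then have c: "closure {x. \<eta> x \<noteq> 0} \<subseteq> {a..b}" by (intro closure_minimal) auto
  then have "bounded (closure {x. \<eta> x \<noteq> 0})" by (rule bounded_subset[OF bounded_closed_interval])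
  then show "test \<eta>"
    using c ab(1-3) unfolding test_function_def compact_eq_bounded_closed by auto
qed

lemma test_smooth: "test \<eta> \<Longrightarrow> smooth \<eta>"
  by (simp add: test_iff)

lemma test_support: "test \<eta> \<Longrightarrow> x \<notin> {0<..<L} \<Longrightarrow> \<eta> x = 0"
  by (force simp: test_iff)

lemma test_square_integrable: "test \<eta> \<Longrightarrow> square_integrable \<eta>"
  using test_support
  by (intro square_integrable_compact_support[of _ 0 L] smooth_continuous test_smooth) auto

lemma test_add: "test \<eta> \<Longrightarrow> test \<xi> \<Longrightarrow> test (\<lambda>x. \<eta> x + \<xi> x)"
  unfolding test_iff
proof (elim conjE exE, intro conjI smooth_add)
  fix a b c d assume "0 < a" "b < L" "0 < c" "d < L" "\<forall>x. x \<notin> {a..b} \<longrightarrow> \<eta> x = 0" "\<forall>x. x \<notin> {c..d} \<longrightarrow> \<xi> x = 0"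
  then show "\<exists>a b. 0 < a \<and> b < L \<and> (\<forall>x. x \<notin> {a..b} \<longrightarrow> \<eta> x + \<xi> x = 0)"
    by (intro exI[of _ "max b d", THEN exI[of _ "min a c"]]) (auto simp: min_le_iff_disj le_max_iff_disj)
qed

lemma test_scale: "test \<eta> \<Longrightarrow> test (\<lambda>x. c * \<eta> x)"
  using smooth_mult[OF smooth_const, of \<eta> c] by (auto simp: test_iff)

lemma test_cnj: "test \<eta> \<Longrightarrow> test (\<lambda>x. cnj (\<eta> x))"
  using smooth_cnj by (auto simp: test_iff)

lemma test_dv:
  assumes "test \<eta>" shows "test (dv \<eta>)"
proof -
  obtain a b where ab: "smooth \<eta>" "0 < a" "b < L" "\<And>x. x \<notin> {a..b} \<Longrightarrow> \<eta> x = 0"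
    using assms by (auto simp: test_iff)
  have "dv \<eta> x = 0" if "x \<notin> {a..b}" for x
  proof (rule vector_derivative_at)
    show "(\<eta> has_vector_derivative 0) (at x)"
      using ab(4) that
      by (intro has_vector_derivative_transform_within_open[OF has_vector_derivative_const, of "- {a..b}"]) auto
  qed
  then show ?thesis using ab(1-3) smooth_dv unfolding test_iff by blast
qed

lemma dv_add: "test \<eta> \<Longrightarrow> test \<xi> \<Longrightarrow> dv (\<lambda>x. \<eta> x + \<xi> x) = (\<lambda>x. dv \<eta> x + dv \<xi> x)"
  by (intro dv_eqI has_vector_derivative_add smooth_has_dv test_smooth)

lemma dv_scale: "test \<eta> \<Longrightarrow> dv (\<lambda>x. c * \<eta> x) = (\<lambda>x. c * dv \<eta> x)"
  by (intro dv_eqI has_vector_derivative_mult_right smooth_has_dv test_smooth)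

lemma dv_cnj: "test \<eta> \<Longrightarrow> dv (\<lambda>x. cnj (\<eta> x)) = (\<lambda>x. cnj (dv \<eta> x))"
  by (intro dv_eqI has_vector_derivative_cnj smooth_has_dv test_smooth)

lemma test_abs_L2: "test \<eta> \<Longrightarrow> abs_l2 \<eta> \<in> L2_space L"
  unfolding L2_space_def using rep_abs[OF test_square_integrable, of \<eta>] test_support[of \<eta>]
  by (auto elim!: eventually_mono)

text \<open>The cut-off \<open>flat 1 (n (x - c) - 1)\<close> vanishes for \<open>x \<le> c + 1/n\<close> and tends to 1 for \<open>x > c\<close>.\<close>

definition bump :: "real \<Rightarrow> real \<Rightarrow> nat \<Rightarrow> real \<Rightarrow> real" where
  "bump c d n x = flat 1 (real n * (x - c) - 1) * flat 1 (real n * (d - x) - 1)"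

lemma flat_1_bounds: "0 \<le> flat 1 x" "flat 1 x \<le> 1"
  by (auto simp: flat_def)

lemma flat_1_lim:
  assumes "0 < r" shows "(\<lambda>n. flat 1 (real n * r - 1)) \<longlonglongrightarrow> 1"
proof -
  have lin: "filterlim (\<lambda>n. real n * r - 1) at_top sequentially"
    using filterlim_tendsto_add_at_top[OF tendsto_const[of "-1"]
        filterlim_at_top_mult_tendsto_pos[OF tendsto_const assms filterlim_real_sequentially]]
    by (simp add: add.commute)
  have "((\<lambda>t::real. exp (- inverse t)) \<longlongrightarrow> exp (- 0)) at_top"
    by (intro tendsto_intros tendsto_inverse_0_at_top filterlim_ident)
  from filterlim_compose[OF this lin] have "(\<lambda>n. exp (- inverse (real n * r - 1))) \<longlonglongrightarrow> 1" by simp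
  then show ?thesis
  proof (rule Lim_transform_eventually)
    show "\<forall>\<^sub>F n in sequentially. exp (- inverse (real n * r - 1)) = flat 1 (real n * r - 1)"
      using filterlim_at_top_dense[THEN iffD1, OF lin, rule_format, of 0]
      by eventually_elim (simp add: flat_def inverse_eq_divide)
  qed
qed

lemma test_bump:
  assumes "0 \<le> c" "d \<le> L" "0 < n"
  shows "test (\<lambda>x. complex_of_real (bump c d n x))"
  unfolding test_iff
proof
  have "smooth (\<lambda>x. complex_of_real (flat 1 (real n * x + (- real n * c - 1)))
      * complex_of_real (flat 1 (- real n * x + (real n * d - 1))))"
    by (intro smooth_mult smooth_affine[of "\<lambda>x. complex_of_real (flat 1 x)"] smooth_flat)
  also have "(\<lambda>x. complex_of_real (flat 1 (real n * x + (- real n * c - 1)))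
      * complex_of_real (flat 1 (- real n * x + (real n * d - 1)))) = (\<lambda>x. complex_of_real (bump c d n x))"
    by (rule ext) (simp add: bump_def algebra_simps)
  finally show "smooth (\<lambda>x. complex_of_real (bump c d n x))" .
  have "bump c d n x = 0" if "x \<notin> {c + 1 / real n..d - 1 / real n}" for x
    using that assms(3) by (auto simp: bump_def flat_def field_simps not_le)
  moreover have "0 < c + 1 / real n" "d - 1 / real n < L"
    using assms by (auto intro: add_nonneg_pos order_less_le_trans[of _ d])
  ultimately show "\<exists>a b. 0 < a \<and> b < L \<and> (\<forall>x. x \<notin> {a..b} \<longrightarrow> complex_of_real (bump c d n x) = 0)"
    by (metis of_real_0)
qed

lemma bump_lim: "(\<lambda>n. bump c d n x) \<longlonglongrightarrow> indicator {c<..<d} x"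
proof (cases "c < x \<and> x < d")
  case True
  then have "(\<lambda>n. bump c d n x) \<longlonglongrightarrow> 1 * 1"
    unfolding bump_def by (intro tendsto_mult flat_1_lim) auto
  then show ?thesis using True by (simp add: indicator_def)
next
  case False
  then have *: "real n * (x - c) - 1 \<le> 0 \<or> real n * (d - x) - 1 \<le> 0" for n
    by (smt (verit) mult_nonneg_nonpos of_nat_0_le_iff)
  have "bump c d n x = 0" for n using *[of n] by (auto simp: bump_def flat_def)
  moreover have "indicat_real {c<..<d} x = 0" using False by simp
  ultimately show ?thesis by simp
qed

lemma bump_bounds: "\<bar>bump c d n x\<bar> \<le> 1"
  unfolding bump_def abs_mult using flat_1_bounds by (intro mult_le_one) auto

lemma integrable_indicator_rep:
  "integrable lborel (\<lambda>x. indicator {a..b} x * cmod (rep_l2 u x))"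
proof -
  have "integrable lborel (\<lambda>x. (cmod (rep_l2 u x))\<^sup>2 + indicator {a..b} x)"
    by (intro Bochner_Integration.integrable_add integrable_rep_power2 integrable_real_indicator emeasure_bounded_finite) auto
  then show ?thesis
  proof (rule Bochner_Integration.integrable_bound)
    have "t \<le> t\<^sup>2 + 1" for t :: real using zero_le_power2[of "t - 1"] zero_le_power2[of t]
      unfolding power2_diff by (simp; linarith)
    then show "AE x in lborel. norm (indicator {a..b} x * cmod (rep_l2 u x)) \<le> norm ((cmod (rep_l2 u x))\<^sup>2 + indicator {a..b} x)"
      by (auto simp: indicator_def)
  qed measurable
qed

lemma integrable_indicator_inner_rep: "integrable lborel (\<lambda>x. indicator {a..b} x * (rep_l2 u x \<bullet> z))"
  using integrable_mult_left[OF integrable_indicator_rep[of a b u], of "cmod z"]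
proof (rule Bochner_Integration.integrable_bound)
  show "AE x in lborel. norm (indicator {a..b} x * (rep_l2 u x \<bullet> z)) \<le> norm (indicator {a..b} x * cmod (rep_l2 u x) * cmod z)"
    using Cauchy_Schwarz_ineq2[of _ z] by (auto simp: indicator_def)
qed measurable

text \<open>The fundamental lemma of the calculus of variations: bumps converge boundedly to
  indicators of intervals, so every component of \<open>g\<close> integrates to 0 over every
  interval.\<close>

lemma test_dense:
  assumes g: "g \<in> L2_space L" and orth: "\<And>\<eta>. test \<eta> \<Longrightarrow> g \<bullet> abs_l2 \<eta> = 0"
  shows "g = 0"
proof -
  have z: "AE x in lborel. indicator {0..L} x * (rep_l2 g x \<bullet> z) = 0" for z
  proof (rule AE_eq_0_if_interval_integrals_eq_0[OF integrable_indicator_inner_rep, of 0 L])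
    fix c d :: real assume "c \<le> d"
    \<comment> \<open>Clipping to [0, L] makes the bumps admissible; the integrand carries the
      indicator of \<open>{0..L}\<close>, so the integral is unchanged.\<close>
    define c' d' where "c' = max c 0" and "d' = min d L"
    have "(\<lambda>n. LINT x|lborel. rep_l2 g x \<bullet> (z * complex_of_real (bump c' d' (Suc n) x)))
        \<longlonglongrightarrow> (LINT x|lborel. rep_l2 g x \<bullet> (z * complex_of_real (indicator {c'<..<d'} x)))"
    proof (rule integral_dominated_convergence[where w = "\<lambda>x. indicator {0..L} x * cmod (rep_l2 g x) * cmod z"])
      show "(\<lambda>x. rep_l2 g x \<bullet> (z * complex_of_real (bump c' d' (Suc n) x))) \<in> borel_measurable lborel" for n
        using smooth_borel[OF test_smooth[OF test_bump[of c' d' "Suc n"]]]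
        by (auto simp: c'_def d'_def)
      show "integrable lborel (\<lambda>x. indicator {0..L} x * cmod (rep_l2 g x) * cmod z)"
        by (intro integrable_mult_left integrable_indicator_rep)
      show "AE x in lborel. (\<lambda>n. rep_l2 g x \<bullet> (z * complex_of_real (bump c' d' (Suc n) x)))
          \<longlonglongrightarrow> rep_l2 g x \<bullet> (z * complex_of_real (indicator {c'<..<d'} x))"
        by (intro AE_I2 tendsto_intros LIMSEQ_Suc bump_lim)
      show "AE x in lborel. norm (rep_l2 g x \<bullet> (z * complex_of_real (bump c' d' (Suc n) x)))
          \<le> indicator {0..L} x * cmod (rep_l2 g x) * cmod z" for n
      proof (rule AE_I2)
        fix x
        have "cmod (z * complex_of_real (bump c' d' (Suc n) x)) \<le> indicator {0..L} x * cmod z"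
          using bump_bounds[of c' d' "Suc n" x] test_support[OF test_bump[of c' d' "Suc n"], of x]
          by (auto simp: c'_def d'_def indicator_def norm_mult intro: mult_left_le)
        from mult_left_mono[OF this norm_ge_zero[of "rep_l2 g x"]]
        show "norm (rep_l2 g x \<bullet> (z * complex_of_real (bump c' d' (Suc n) x)))
            \<le> indicator {0..L} x * cmod (rep_l2 g x) * cmod z"
          using Cauchy_Schwarz_ineq2[of "rep_l2 g x" "z * complex_of_real (bump c' d' (Suc n) x)"]
          by (simp add: mult_ac)
      qed
    qed measurable
    moreover have "(LINT x|lborel. rep_l2 g x \<bullet> (z * complex_of_real (bump c' d' (Suc n) x))) = 0" for n
    proof -
      have t: "test (\<lambda>x. z * complex_of_real (bump c' d' (Suc n) x))"
        by (intro test_scale test_bump) (auto simp: c'_def d'_def)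
      show ?thesis using orth[OF t] inner_abs[OF test_square_integrable[OF t], of g] by simp
    qed
    ultimately have "(LINT x|lborel. rep_l2 g x \<bullet> (z * complex_of_real (indicator {c'<..<d'} x))) = 0"
      by (simp add: LIMSEQ_const_iff)
    also have "(LINT x|lborel. rep_l2 g x \<bullet> (z * complex_of_real (indicator {c'<..<d'} x)))
        = (LINT x:{c..d}|lborel. indicator {0..L} x * (rep_l2 g x \<bullet> z))"
      unfolding set_lebesgue_integral_def
    proof (rule integral_cong_AE)
      have "AE x in lborel. x \<noteq> c'" "AE x in lborel. x \<noteq> d'" by (rule AE_lborel_singleton)+
      then show "AE x in lborel. rep_l2 g x \<bullet> (z * complex_of_real (indicator {c'<..<d'} x))
          = indicat_real {c..d} x *\<^sub>R (indicator {0..L} x * (rep_l2 g x \<bullet> z))"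
        by eventually_elim (auto simp: c'_def d'_def indicator_def)
    qed measurable
    finally show "(LINT x:{c..d}|lborel. indicator {0..L} x * (rep_l2 g x \<bullet> z)) = 0" .
  qed auto
  \<comment> \<open>The directions 1 and \<i> recover the real and imaginary parts.\<close>
  have "AE x in lborel. rep_l2 g x = rep_l2 0 x"
    using z[of 1] z[of \<i>] g[unfolded L2_space_def, simplified] rep_0
    by eventually_elim (auto simp: indicator_def complex_eq_iff inner_complex_def split: if_splits)
  then show ?thesis by (rule l2_eqI)
qed

end

section \<open>Sobolev spaces on the interval\<close>

text \<open>\<open>L2\<close>, the mean zero space and the weak derivative relation are all
  presented below as orthogonal complements, which makes closedness and real linearity
  automatic.\<close>

lemma closed_subspace_orthogonal:
  fixes G :: "'a::real_inner set"
  shows "closed {f. \<forall>g\<in>G. f \<bullet> g = 0}" "subspace {f. \<forall>g\<in>G. f \<bullet> g = 0}"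
proof -
  have "{f. \<forall>g\<in>G. f \<bullet> g = 0} = (\<Inter>g\<in>G. {f. f \<bullet> g = 0})" by auto
  then show "closed {f. \<forall>g\<in>G. f \<bullet> g = 0}"
    by (auto intro!: closed_INT closed_Collect_eq continuous_intros)
  show "subspace {f. \<forall>g\<in>G. f \<bullet> g = 0}"
    by (rule subspaceI) (auto simp: inner_add_left)
qed

lemma inner_abs_abs:
  assumes "square_integrable f" "square_integrable g"
  shows "abs_l2 f \<bullet> abs_l2 g = (LINT x|lborel. f x \<bullet> g x)"
  unfolding inner_abs[OF assms(2)]
  by (intro integral_cong_AE) (use rep_abs[OF assms(1)] assms in \<open>auto simp: square_integrable_def elim: AE_mp\<close>)

section \<open>Weak derivatives as closed subspaces\<close>

context interval
begin

abbreviation L2 :: "l2 set" where "L2 \<equiv> L2_space L"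
abbreviation H1 :: "l2 set" where "H1 \<equiv> H1_space L"
abbreviation H10 :: "l2 set" where "H10 \<equiv> H10_space L"
abbreviation D :: "l2 \<Rightarrow> l2" where "D \<equiv> Dx L"

definition cst :: "complex \<Rightarrow> l2" where
  "cst c = abs_l2 (\<lambda>x. c * indicator {0<..<L} x)"

text \<open>The part of \<open>g\<close> off (0,L); the orthogonal complement of all such parts will
  be \<open>L2\<close>.\<close>

definition outside :: "l2 \<Rightarrow> l2" where
  "outside g = abs_l2 (\<lambda>x. indicator (- {0<..<L}) x * rep_l2 g x)"

lemma square_integrable_cst: "square_integrable (\<lambda>x. c * indicator {0<..<L} x)"
proof (rule square_integrable_mult)
  have "(\<lambda>x. (cmod (indicator {0<..<L} x))\<^sup>2) = indicat_real {0<..<L}"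
    by (auto simp: indicator_def)
  then show "square_integrable (indicator {0<..<L})"
    unfolding square_integrable_def
    using L integrable_real_indicator[of "{0<..<L}" lborel] by (simp add: borel_measurable_indicator)
qed

lemma square_integrable_outside: "square_integrable (\<lambda>x. indicator (- {0<..<L}) x * rep_l2 g x)"
  unfolding square_integrable_def
proof
  show "integrable lborel (\<lambda>x. (cmod (indicator (- {0<..<L}) x * rep_l2 g x))\<^sup>2)"
    by (rule Bochner_Integration.integrable_bound[OF integrable_rep_power2[of g]])
      (auto simp: indicator_def)
qed measurable

lemma L2_eq: "L2 = {f. \<forall>g\<in>range outside. f \<bullet> g = 0}"
proof (intro set_eqI iffI CollectI ballI)
  fix f g assume f: "f \<in> L2" and "g \<in> range outside"
  then obtain k where g: "g = outside k" by blast
  have "f \<bullet> g = (LINT x|lborel. rep_l2 f x \<bullet> (indicator (- {0<..<L}) x * rep_l2 k x))"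
    unfolding g outside_def by (rule inner_abs[OF square_integrable_outside])
  also have "\<dots> = (LINT x|(lborel::real measure). 0)"
    using f[unfolded L2_space_def, simplified]
    by (intro integral_cong_AE) (auto simp: indicator_def elim!: eventually_mono)
  finally show "f \<bullet> g = 0" by simp
next
  fix f assume f: "f \<in> {f. \<forall>g\<in>range outside. f \<bullet> g = 0}"
  \<comment> \<open>Orthogonality to its own exterior part annihilates the exterior mass of
    \<open>f\<close>.\<close>
  have "0 = f \<bullet> outside f" using f by simp
  also have "\<dots> = (LINT x|lborel. indicator (- {0<..<L}) x * (cmod (rep_l2 f x))\<^sup>2)"
    unfolding outside_def inner_abs[OF square_integrable_outside]
    by (intro Bochner_Integration.integral_cong refl) (auto simp: indicator_def power2_norm_eq_inner)
  finally have "(LINT x|lborel. indicator (- {0<..<L}) x * (cmod (rep_l2 f x))\<^sup>2) = 0" ..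
  moreover have "integrable lborel (\<lambda>x. indicat_real (- {0<..<L}) x *\<^sub>R (cmod (rep_l2 f x))\<^sup>2)"
    by (intro integrable_mult_indicator integrable_rep_power2) simp
  ultimately have "AE x in lborel. indicat_real (- {0<..<L}) x * (cmod (rep_l2 f x))\<^sup>2 = 0"
    by (subst (asm) integral_nonneg_eq_0_iff_AE) auto
  then show "f \<in> L2"
    unfolding L2_space_def by (auto simp: indicator_def elim!: eventually_mono)
qed

lemma inner_cst: "f \<bullet> cst c = (LINT x:{0<..<L}|lborel. rep_l2 f x) \<bullet> c"
proof -
  have "integrable lborel (\<lambda>x. rep_l2 f x * (1 * indicator {0<..<L} x))"
    by (intro integrable_mult_square_integrable square_integrable_rep square_integrable_cst)
  moreover have "(\<lambda>x. rep_l2 f x * (1 * indicator {0<..<L} x)) = (\<lambda>x. indicator {0<..<L} x *\<^sub>R rep_l2 f x)"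
    by (auto simp: indicator_def)
  ultimately have i: "integrable lborel (\<lambda>x. indicat_real {0<..<L} x *\<^sub>R rep_l2 f x)" by simp
  have "f \<bullet> cst c = (LINT x|lborel. rep_l2 f x \<bullet> (c * indicator {0<..<L} x))"
    unfolding cst_def by (rule inner_abs[OF square_integrable_cst])
  also have "\<dots> = (LINT x|lborel. (indicator {0<..<L} x *\<^sub>R rep_l2 f x) \<bullet> c)"
    by (intro Bochner_Integration.integral_cong refl) (auto simp: indicator_def)
  also have "\<dots> = (LINT x:{0<..<L}|lborel. rep_l2 f x) \<bullet> c"
    unfolding set_lebesgue_integral_def using i by (intro integral_inner_left) 
  finally show ?thesis .
qed

text \<open>The inner product is real, so complex constants are needed to detect the complex mean;
  the mean itself, taken as \<open>c\<close>, decides.\<close>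

lemma mean_zero_iff: "f \<in> L2_mean_zero L \<longleftrightarrow> f \<in> L2 \<and> (\<forall>c. f \<bullet> cst c = 0)"
  unfolding L2_mean_zero_def inner_cst by (auto simp: inner_eq_zero_iff dest: spec[of _ "LINT x:{0<..<L}|lborel. rep_l2 f x"])

lemma mean_zero_eq: "L2_mean_zero L = {f. \<forall>g\<in>range outside \<union> range cst. f \<bullet> g = 0}"
  using mean_zero_iff by (auto simp: L2_eq)

lemma subspace_L2: "subspace L2" and closed_L2: "closed L2"
  unfolding L2_eq by (rule closed_subspace_orthogonal)+

lemma subspace_mean_zero: "subspace (L2_mean_zero L)" and closed_mean_zero: "closed (L2_mean_zero L)"
  unfolding mean_zero_eq by (rule closed_subspace_orthogonal)+

lemma cst_L2: "cst c \<in> L2"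
  unfolding L2_space_def cst_def using rep_abs[OF square_integrable_cst[of c]]
  by (auto elim!: eventually_mono)

lemma scaleC_cst: "d *\<^sub>C cst c = cst (d * c)"
  unfolding cst_def by (subst abs_scaleC[symmetric]) (simp_all add: square_integrable_cst mult.assoc)

lemma L2_scaleC: "f \<in> L2 \<Longrightarrow> c *\<^sub>C f \<in> L2"
  unfolding L2_space_def using rep_scaleC[of c f] by (auto elim: eventually_elim2)

lemma mean_zero_scaleC: "f \<in> L2_mean_zero L \<Longrightarrow> c *\<^sub>C f \<in> L2_mean_zero L"
  by (simp add: mean_zero_iff L2_scaleC inner_scaleC_l2 scaleC_cst)

text \<open>Weak derivatives use the bilinear pairing, whereas the inner product conjugates; a
  conjugate on the test function reconciles the two.\<close>

lemma Re_pairing: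
  assumes "test \<eta>"
  shows "Re (LINT x:{0<..<L}|lborel. rep_l2 u x * \<eta> x) = u \<bullet> abs_l2 (\<lambda>x. cnj (\<eta> x))"
proof -
  have "(LINT x:{0<..<L}|lborel. rep_l2 u x * \<eta> x) = (LINT x|lborel. rep_l2 u x * \<eta> x)"
    unfolding set_lebesgue_integral_def using test_support[OF assms]
    by (intro Bochner_Integration.integral_cong refl) (auto simp: indicator_def)
  moreover have "Re (LINT x|lborel. rep_l2 u x * \<eta> x) = (LINT x|lborel. Re (rep_l2 u x * \<eta> x))"
    by (intro integral_bounded_linear[OF bounded_linear_Re, symmetric]
        integrable_mult_square_integrable square_integrable_rep test_square_integrable assms)
  moreover have "u \<bullet> abs_l2 (\<lambda>x. cnj (\<eta> x)) = (LINT x|lborel. rep_l2 u x \<bullet> cnj (\<eta> x))"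
    by (rule inner_abs[OF test_square_integrable[OF test_cnj[OF assms]]])
  ultimately show ?thesis by (simp add: inner_complex_def)
qed

text \<open>Testing with \<open>\<eta>\<close> and \<open>\<i> \<eta>\<close> recovers the complex identity from its real part.\<close>

lemma weak_derivative_iff:
  "weak_derivative L u w \<longleftrightarrow> (\<forall>\<eta>. test \<eta> \<longrightarrow> u \<bullet> abs_l2 (dv \<eta>) = - (w \<bullet> abs_l2 \<eta>))"
proof (intro iffI allI impI)
  fix \<eta> assume W: "weak_derivative L u w" and t: "test \<eta>"
  from W[unfolded weak_derivative_def, rule_format, OF test_cnj[OF t]]
  have "Re (LINT x:{0<..<L}|lborel. rep_l2 u x * dv (\<lambda>x. cnj (\<eta> x)) x)
      = - Re (LINT x:{0<..<L}|lborel. rep_l2 w x * cnj (\<eta> x))" by simp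
  then show "u \<bullet> abs_l2 (dv \<eta>) = - (w \<bullet> abs_l2 \<eta>)"
    by (simp add: Re_pairing test_dv test_cnj t fun_cong[OF dv_cnj[OF t]])
next
  assume W: "\<forall>\<eta>. test \<eta> \<longrightarrow> u \<bullet> abs_l2 (dv \<eta>) = - (w \<bullet> abs_l2 \<eta>)"
  have re: "Re (LINT x:{0<..<L}|lborel. rep_l2 u x * dv \<eta> x)
      = Re (- (LINT x:{0<..<L}|lborel. rep_l2 w x * \<eta> x))" if t: "test \<eta>" for \<eta>
    using W[rule_format, OF test_cnj[OF t]] by (simp add: Re_pairing test_dv t dv_cnj[OF t])
  have scale: "(LINT x:{0<..<L}|lborel. rep_l2 u x * (- \<i> * \<eta> x)) = - \<i> * (LINT x:{0<..<L}|lborel. rep_l2 u x * \<eta> x)"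
    for u \<eta>
  proof -
    have "(LINT x:{0<..<L}|lborel. rep_l2 u x * (- \<i> * \<eta> x)) = (LINT x:{0<..<L}|lborel. - \<i> * (rep_l2 u x * \<eta> x))"
      by (simp add: mult_ac)
    then show ?thesis by (simp only: set_integral_mult_right)
  qed
  show "weak_derivative L u w"
    unfolding weak_derivative_def
  proof (intro allI impI complex_eqI re)
    fix \<eta> assume t: "test \<eta>"
    from re[OF test_scale[OF t, of "- \<i>"]]
    have "Re (- \<i> * (LINT x:{0<..<L}|lborel. rep_l2 u x * dv \<eta> x))
        = Re (- (- \<i> * (LINT x:{0<..<L}|lborel. rep_l2 w x * \<eta> x)))"
      by (simp only: scale fun_cong[OF dv_scale[OF t]])
    then show "Im (LINT x:{0<..<L}|lborel. rep_l2 u x * dv \<eta> x)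
        = Im (- (LINT x:{0<..<L}|lborel. rep_l2 w x * \<eta> x))" by simp
  qed
qed

text \<open>The graph of the maximal derivative, with domain \<open>H1\<close>. \<open>T0\<close> is
  the graph on test functions and its closure \<open>W0\<close> has domain \<open>H10\<close>.
  Graphs replace the definite description in \<open>Dx\<close> by closed subspaces of a
  product.\<close>

definition W :: "(l2 \<times> l2) set" where
  "W = {(u, w). u \<in> L2 \<and> w \<in> L2 \<and> weak_derivative L u w}"

definition T0 :: "(l2 \<times> l2) set" where
  "T0 = {(abs_l2 \<eta>, abs_l2 (dv \<eta>)) | \<eta>. test \<eta>}"

definition W0 :: "(l2 \<times> l2) set" where
  "W0 = closure T0"

lemma W_eq: "W = {p. \<forall>g \<in> (\<lambda>g. (g, 0)) ` range outside \<union> (\<lambda>g. (0, g)) ` range outside \<union>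
    {(abs_l2 (dv \<eta>), abs_l2 \<eta>) | \<eta>. test \<eta>}. p \<bullet> g = 0}"
  unfolding W_def weak_derivative_iff L2_eq
  by (fastforce simp: ball_Un inner_prod_def add_eq_0_iff2 split: prod.splits)

lemma subspace_W: "subspace W" and closed_W: "closed W"
  unfolding W_eq by (rule closed_subspace_orthogonal)+

lemma W_scaleC:
  assumes "(u, w) \<in> W" shows "(c *\<^sub>C u, c *\<^sub>C w) \<in> W"
proof -
  have "weak_derivative L (c *\<^sub>C u) (c *\<^sub>C w)"
    unfolding weak_derivative_iff
  proof (intro allI impI)
    fix \<eta> assume t: "test \<eta>"
    have "u \<bullet> abs_l2 (dv (\<lambda>x. cnj c * \<eta> x)) = - (w \<bullet> abs_l2 (\<lambda>x. cnj c * \<eta> x))"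
      using assms test_scale[OF t] by (auto simp: W_def weak_derivative_iff)
    then show "(c *\<^sub>C u) \<bullet> abs_l2 (dv \<eta>) = - ((c *\<^sub>C w) \<bullet> abs_l2 \<eta>)"
      by (simp add: inner_scaleC_l2 dv_scale t abs_scaleC test_square_integrable test_dv)
  qed
  then show ?thesis using assms by (auto simp: W_def L2_scaleC)
qed

lemma W_unique:
  assumes "(u, w) \<in> W" "(u, w') \<in> W" shows "w = w'"
proof -
  have "(u - u, w - w') \<in> W" using subspace_diff[OF subspace_W assms] by simp
  then have "w - w' = 0"
    by (intro test_dense) (auto simp: W_def weak_derivative_iff)
  then show ?thesis by simp
qed

lemma W_iff: "(u, w) \<in> W \<longleftrightarrow> u \<in> H1 \<and> D u = w"
proof
  assume W: "(u, w) \<in> W"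
  then have "D u = w"
    unfolding Dx_def by (intro the_equality) (auto simp: W_def intro: W_unique[unfolded W_def])
  then show "u \<in> H1 \<and> D u = w" using W by (auto simp: H1_space_def W_def)
next
  assume u: "u \<in> H1 \<and> D u = w"
  then obtain w' where w': "(u, w') \<in> W" by (auto simp: H1_space_def W_def)
  then have "D u = w'"
    unfolding Dx_def by (intro the_equality) (auto simp: W_def intro: W_unique[unfolded W_def])
  then show "(u, w) \<in> W" using w' u by simp
qed

lemma H1_add: "u \<in> H1 \<Longrightarrow> v \<in> H1 \<Longrightarrow> u + v \<in> H1 \<and> D (u + v) = D u + D v"
  using subspace_add[OF subspace_W, of "(u, D u)" "(v, D v)"] by (simp add: W_iff)

lemma H1_diff: "u \<in> H1 \<Longrightarrow> v \<in> H1 \<Longrightarrow> u - v \<in> H1 \<and> D (u - v) = D u - D v"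
  using subspace_diff[OF subspace_W, of "(u, D u)" "(v, D v)"] by (simp add: W_iff)

lemma H1_scaleR: "u \<in> H1 \<Longrightarrow> r *\<^sub>R u \<in> H1 \<and> D (r *\<^sub>R u) = r *\<^sub>R D u"
  using subspace_mul[OF subspace_W, of "(u, D u)"] by (simp add: W_iff)

lemma H1_scaleC: "u \<in> H1 \<Longrightarrow> c *\<^sub>C u \<in> H1 \<and> D (c *\<^sub>C u) = c *\<^sub>C D u"
  using W_scaleC[of u "D u" c] by (simp add: W_iff)

lemma H1_0: "0 \<in> H1 \<and> D 0 = 0"
  using subspace_0[OF subspace_W] by (simp add: W_iff zero_prod_def)

lemma H1_L2: "u \<in> H1 \<Longrightarrow> u \<in> L2" and D_L2: "u \<in> H1 \<Longrightarrow> D u \<in> L2"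
  using W_iff[of u "D u"] by (auto simp: W_def)

lemma H1_closed:
  assumes "\<And>n. u n \<in> H1" "u \<longlonglongrightarrow> a" "(\<lambda>n. D (u n)) \<longlonglongrightarrow> b"
  shows "a \<in> H1 \<and> D a = b"
proof -
  have "(u n, D (u n)) \<in> W" for n using assms(1) by (simp add: W_iff)
  from closed_sequentially[OF closed_W this tendsto_Pair[OF assms(2,3)]] show ?thesis
    by (simp add: W_iff)
qed

lemma integral_derivative_eq_0:
  fixes F :: "real \<Rightarrow> real"
  assumes "\<And>x. (F has_vector_derivative f x) (at x)" "continuous_on UNIV f" "F 0 = F L"
    "\<And>x. x \<notin> {0..L} \<Longrightarrow> f x = 0"
  shows "(LINT x|lborel. f x) = 0"
proof -
  have "(LINT x|lborel. indicator {0..L} x *\<^sub>R f x) = F L - F 0"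
  proof (rule integral_FTC_Icc)
    show "(F has_vector_derivative f x) (at x within {0..L})" for x
      by (rule has_vector_derivative_at_within[OF assms(1)])
    show "continuous_on {0..L} f" by (rule continuous_on_subset[OF assms(2)]) simp
  qed (use L in simp)
  moreover have "(\<lambda>x. indicator {0..L} x *\<^sub>R f x) = f"
    by (rule ext) (metis assms(4) indicator_simps scaleR_one scaleR_zero_left)
  ultimately show ?thesis using assms(3) by simp
qed

lemma test_parts:
  assumes t: "test \<eta>" "test \<xi>"
  shows "abs_l2 \<eta> \<bullet> abs_l2 (dv \<xi>) = - (abs_l2 (dv \<eta>) \<bullet> abs_l2 \<xi>)"
proof -
  note s = test_square_integrable[OF t(1)] test_square_integrable[OF t(2)]
    test_square_integrable[OF test_dv[OF t(1)]] test_square_integrable[OF test_dv[OF t(2)]]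
  have "(LINT x|lborel. \<eta> x \<bullet> dv \<xi> x + dv \<eta> x \<bullet> \<xi> x) = 0"
  proof (rule integral_derivative_eq_0)
    show "((\<lambda>x. \<eta> x \<bullet> \<xi> x) has_vector_derivative \<eta> x \<bullet> dv \<xi> x + dv \<eta> x \<bullet> \<xi> x) (at x)" for x
      by (intro bounded_bilinear.has_vector_derivative[OF bounded_bilinear_inner] smooth_has_dv test_smooth t)
    show "continuous_on UNIV (\<lambda>x. \<eta> x \<bullet> dv \<xi> x + dv \<eta> x \<bullet> \<xi> x)"
      by (intro continuous_intros smooth_continuous test_smooth t test_dv)
  qed (auto simp: test_support[OF t(1)] test_support[OF t(2)])
  moreover have "(LINT x|lborel. \<eta> x \<bullet> dv \<xi> x + dv \<eta> x \<bullet> \<xi> x)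
      = (LINT x|lborel. \<eta> x \<bullet> dv \<xi> x) + (LINT x|lborel. dv \<eta> x \<bullet> \<xi> x)"
    by (intro Bochner_Integration.integral_add integrable_inner_square_integrable s)
  ultimately show ?thesis by (simp add: inner_abs_abs s)
qed

lemma subspace_T0: "subspace T0"
proof (rule subspaceI)
  have z: "test (\<lambda>_. 0)" using L by (auto simp: test_iff smooth_const intro!: exI[of _ "L/2"])
  have "dv (\<lambda>_. 0) = (\<lambda>_. 0)" by (rule dv_eqI) simp
  then show "0 \<in> T0"
    unfolding T0_def using z by (auto simp: zero_prod_def zero_l2_def intro!: exI[of _ "\<lambda>_. 0"])
next
  fix p q assume "p \<in> T0" "q \<in> T0"
  then obtain \<eta> \<xi> where t: "test \<eta>" "test \<xi>"
    and pq: "p = (abs_l2 \<eta>, abs_l2 (dv \<eta>))" "q = (abs_l2 \<xi>, abs_l2 (dv \<xi>))" by (auto simp: T0_def)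
  show "p + q \<in> T0"
    unfolding T0_def pq using t
    by (intro CollectI exI[of _ "\<lambda>x. \<eta> x + \<xi> x"])
      (simp add: test_add dv_add abs_add test_square_integrable test_dv)
next
  fix c and p assume "p \<in> T0"
  then obtain \<eta> where t: "test \<eta>" and p: "p = (abs_l2 \<eta>, abs_l2 (dv \<eta>))" by (auto simp: T0_def)
  show "c *\<^sub>R p \<in> T0"
    unfolding T0_def p using t
    by (intro CollectI exI[of _ "\<lambda>x. complex_of_real c * \<eta> x"])
      (simp add: test_scale dv_scale abs_scaleC test_square_integrable test_dv scaleC_of_real)
qed

lemma T0_W: "T0 \<subseteq> W"
  unfolding T0_def W_def by (auto simp: test_abs_L2 test_dv weak_derivative_iff test_parts)

lemma subspace_W0: "subspace W0" and closed_W0: "closed W0" and W0_W: "W0 \<subseteq> W"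
  unfolding W0_def using subspace_closure[OF subspace_T0] closure_minimal[OF T0_W closed_W] by auto

lemma H1_norm_eq: "(u, w) \<in> W \<Longrightarrow> test \<eta> \<Longrightarrow>
    H1_norm L (u - abs_l2 \<eta>) = dist (abs_l2 \<eta>, abs_l2 (dv \<eta>)) (u, w)"
proof -
  assume u: "(u, w) \<in> W" and "test \<eta>"
  then have "(abs_l2 \<eta>, abs_l2 (dv \<eta>)) \<in> W" using T0_W by (auto simp: T0_def)
  from subspace_diff[OF subspace_W u this]
  have "D (u - abs_l2 \<eta>) = w - abs_l2 (dv \<eta>)" by (simp add: W_iff)
  then show ?thesis
    by (simp only: H1_norm_def dist_Pair_Pair) (simp add: dist_norm norm_minus_commute)
qed

text \<open>The \<open>H1_norm\<close> distance to a test function is the product distance of the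
  graph points, so Sobolev approximation is membership in the closure of \<open>T0\<close>.\<close>

lemma W0_iff: "(u, w) \<in> W0 \<longleftrightarrow> u \<in> H10 \<and> D u = w"
proof -
  have "(u, w) \<in> W0 \<longleftrightarrow> u \<in> H10" if W: "(u, w) \<in> W"
  proof -
    have "(u, w) \<in> W0 \<longleftrightarrow> (\<forall>e>0. \<exists>p\<in>T0. dist p (u, w) < e)"
      by (simp add: W0_def closure_approachable)
    also have "\<dots> \<longleftrightarrow> (\<forall>e>0. \<exists>\<eta>. test \<eta> \<and> dist (abs_l2 \<eta>, abs_l2 (dv \<eta>)) (u, w) < e)"
      unfolding T0_def by blast
    also have "\<dots> \<longleftrightarrow> (\<forall>e>0. \<exists>\<eta>. test \<eta> \<and> H1_norm L (u - abs_l2 \<eta>) < e)"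
      using H1_norm_eq[OF W] by metis
    also have "\<dots> \<longleftrightarrow> u \<in> H10" using W by (simp add: H10_space_def W_iff)
    finally show ?thesis .
  qed
  moreover have "u \<in> H10 \<Longrightarrow> u \<in> H1" by (simp add: H10_space_def)
  ultimately show ?thesis using W0_W W_iff by blast
qed

lemma H10_H1: "u \<in> H10 \<Longrightarrow> u \<in> H1"
  by (simp add: H10_space_def)

lemma H10_add: "u \<in> H10 \<Longrightarrow> v \<in> H10 \<Longrightarrow> u + v \<in> H10"
  using subspace_add[OF subspace_W0, of "(u, D u)" "(v, D v)"] by (simp add: W0_iff)

lemma H10_diff: "u \<in> H10 \<Longrightarrow> v \<in> H10 \<Longrightarrow> u - v \<in> H10"
  using subspace_diff[OF subspace_W0, of "(u, D u)" "(v, D v)"] by (simp add: W0_iff)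

lemma H10_scaleR: "u \<in> H10 \<Longrightarrow> r *\<^sub>R u \<in> H10"
  using subspace_mul[OF subspace_W0, of "(u, D u)"] by (simp add: W0_iff)

lemma H10_0: "0 \<in> H10"
  using subspace_0[OF subspace_W0] by (simp add: W0_iff zero_prod_def)

lemma H10_scaleC:
  assumes u: "u \<in> H10" shows "c *\<^sub>C u \<in> H10"
proof -
  note lim = bounded_linear.tendsto[OF bounded_linear_scaleC[OF norm_scaleC_l2[of c]]]
  have "(u, D u) \<in> W0" using u by (simp add: W0_iff)
  then obtain p where p: "\<And>n. p n \<in> T0" "p \<longlonglongrightarrow> (u, D u)"
    unfolding W0_def closure_sequential by blast
  have "(c *\<^sub>C fst (p n), c *\<^sub>C snd (p n)) \<in> T0" for n
  proof -
    obtain \<eta> where t: "test \<eta>" "p n = (abs_l2 \<eta>, abs_l2 (dv \<eta>))" using p(1)[of n] by (auto simp: T0_def)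
    then show ?thesis
      unfolding T0_def
      by (intro CollectI exI[of _ "\<lambda>x. c * \<eta> x"])
        (simp add: test_scale dv_scale abs_scaleC test_square_integrable test_dv)
  qed
  moreover have "(\<lambda>n. (c *\<^sub>C fst (p n), c *\<^sub>C snd (p n))) \<longlonglongrightarrow> (c *\<^sub>C u, c *\<^sub>C D u)"
    using tendsto_fst[OF p(2)] tendsto_snd[OF p(2)] by (intro tendsto_Pair lim) auto
  ultimately have "(c *\<^sub>C u, c *\<^sub>C D u) \<in> W0"
    unfolding W0_def closure_sequential by (intro exI[of _ "\<lambda>n. (c *\<^sub>C fst (p n), c *\<^sub>C snd (p n))"]) simp
  then show ?thesis by (simp add: W0_iff)
qed

lemma H10_closed:
  assumes "\<And>n. u n \<in> H10" "u \<longlonglongrightarrow> a" "(\<lambda>n. D (u n)) \<longlonglongrightarrow> b"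
  shows "a \<in> H10 \<and> D a = b"
proof -
  have "(u n, D (u n)) \<in> W0" for n using assms(1) by (simp add: W0_iff)
  from closed_sequentially[OF closed_W0 this tendsto_Pair[OF assms(2,3)]] show ?thesis
    by (simp add: W0_iff)
qed

lemma test_H10: "test \<eta> \<Longrightarrow> abs_l2 \<eta> \<in> H10 \<and> D (abs_l2 \<eta>) = abs_l2 (dv \<eta>)"
  using closure_subset[of T0] by (auto simp: W0_iff[symmetric] W0_def T0_def)

text \<open>For test functions this is the weak derivative relation, read as orthogonality of (w, D
  w) to (D u, u); orthogonality survives the closure.\<close>

lemma parts:
  assumes u: "u \<in> H1" and w: "w \<in> H10"
  shows "u \<bullet> D w = - (D u \<bullet> w)"
proof -
  have "W0 \<subseteq> {p. p \<bullet> (D u, u) = 0}"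
    unfolding W0_def
  proof (rule closure_minimal)
    have "weak_derivative L u (D u)" using u W_iff[of u "D u"] by (auto simp: W_def)
    then show "T0 \<subseteq> {p. p \<bullet> (D u, u) = 0}"
      by (auto simp: T0_def weak_derivative_iff inner_prod_def inner_commute)
  qed (intro closed_Collect_eq continuous_intros)
  moreover have "(w, D w) \<in> W0" using w by (simp add: W0_iff)
  ultimately have "(w, D w) \<bullet> (D u, u) = 0" by blast
  then show ?thesis by (simp add: inner_prod_def inner_commute)
qed

text \<open>The maximal derivative is minus the adjoint of the derivative on \<open>H10\<close>; in
  \<open>block_resolvent\<close> regularity is read off from an orthogonality relation in this
  way.\<close>

lemma H1_adjointI:
  assumes "u \<in> L2" "h \<in> L2" "\<And>w. w \<in> H10 \<Longrightarrow> u \<bullet> D w = - (h \<bullet> w)"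
  shows "u \<in> H1 \<and> D u = h"
proof -
  have "u \<bullet> abs_l2 (dv \<eta>) = - (h \<bullet> abs_l2 \<eta>)" if "test \<eta>" for \<eta>
    using assms(3)[of "abs_l2 \<eta>"] test_H10[OF that] by simp
  then have "(u, h) \<in> W"
    using assms(1,2) by (simp add: W_def weak_derivative_iff)
  then show ?thesis by (simp add: W_iff)
qed

text \<open>Integrating \<open>(x |\<eta>|\<^sup>2)'\<close> gives \<open>\<parallel>\<eta>\<parallel>\<^sup>2 = - 2 (x \<eta>, \<eta>')\<close>.\<close>

lemma poincare:
  assumes "w \<in> H10"
  shows "norm w \<le> 2 * L * norm (D w)"
proof -
  have test: "norm (abs_l2 \<eta>) \<le> 2 * L * norm (abs_l2 (dv \<eta>))" if t: "test \<eta>" for \<eta>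
  proof -
    define \<xi> where "\<xi> x = complex_of_real x * \<eta> x" for x
    have c: "continuous_on UNIV \<eta>" "continuous_on UNIV (dv \<eta>)"
      by (intro smooth_continuous test_smooth t test_dv)+
    have s: "square_integrable \<eta>" "square_integrable (dv \<eta>)"
      by (intro test_square_integrable t test_dv)+
    have s\<xi>: "square_integrable \<xi>"
      unfolding \<xi>_def using test_support[OF t]
      by (intro square_integrable_compact_support[of _ 0 L] continuous_intros c) auto
    have "(LINT x|lborel. \<eta> x \<bullet> \<eta> x + 2 * (\<xi> x \<bullet> dv \<eta> x)) = 0"
    proof (rule integral_derivative_eq_0)
      fix x
      have "((\<lambda>x. \<eta> x \<bullet> \<eta> x) has_vector_derivative \<eta> x \<bullet> dv \<eta> x + dv \<eta> x \<bullet> \<eta> x) (at x)"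
        by (intro bounded_bilinear.has_vector_derivative[OF bounded_bilinear_inner] smooth_has_dv test_smooth t)
      from has_vector_derivative_mult[OF has_vector_derivative_id this]
      show "((\<lambda>x. x * (\<eta> x \<bullet> \<eta> x)) has_vector_derivative \<eta> x \<bullet> \<eta> x + 2 * (\<xi> x \<bullet> dv \<eta> x)) (at x)"
        by (simp add: \<xi>_def inner_commute inner_complex_def algebra_simps)
      show "continuous_on UNIV (\<lambda>x. \<eta> x \<bullet> \<eta> x + 2 * (\<xi> x \<bullet> dv \<eta> x))"
        unfolding \<xi>_def by (intro continuous_intros c)
    qed (auto simp: test_support[OF t] \<xi>_def)
    moreover have "(LINT x|lborel. \<eta> x \<bullet> \<eta> x + 2 * (\<xi> x \<bullet> dv \<eta> x))
        = (LINT x|lborel. \<eta> x \<bullet> \<eta> x) + (LINT x|lborel. 2 * (\<xi> x \<bullet> dv \<eta> x))"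
      by (intro Bochner_Integration.integral_add integrable_mult_right integrable_inner_square_integrable s s\<xi>)
    ultimately have "abs_l2 \<eta> \<bullet> abs_l2 \<eta> = - 2 * (abs_l2 \<xi> \<bullet> abs_l2 (dv \<eta>))"
      by (simp add: inner_abs_abs s s\<xi>)
    also have "\<dots> \<le> 2 * (norm (abs_l2 \<xi>) * norm (abs_l2 (dv \<eta>)))"
      using Cauchy_Schwarz_ineq2[of "abs_l2 \<xi>" "abs_l2 (dv \<eta>)"] by linarith
    also have "\<dots> \<le> 2 * (L * norm (abs_l2 \<eta>) * norm (abs_l2 (dv \<eta>)))"
    proof (intro mult_left_mono mult_right_mono)
      have "abs_l2 \<xi> \<bullet> abs_l2 \<xi> = (LINT x|lborel. \<xi> x \<bullet> \<xi> x)" by (simp add: inner_abs_abs s\<xi>)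
      also have "\<dots> \<le> (LINT x|lborel. L\<^sup>2 * (\<eta> x \<bullet> \<eta> x))"
      proof (intro integral_mono integrable_mult_right integrable_inner_square_integrable s s\<xi>)
        fix x
        have "x\<^sup>2 * (\<eta> x \<bullet> \<eta> x) \<le> L\<^sup>2 * (\<eta> x \<bullet> \<eta> x)"
          using test_support[OF t, of x] by (cases "x \<in> {0<..<L}") (auto intro!: mult_right_mono power_mono)
        then show "\<xi> x \<bullet> \<xi> x \<le> L\<^sup>2 * (\<eta> x \<bullet> \<eta> x)"
          by (simp add: \<xi>_def inner_complex_def power2_eq_square algebra_simps)
      qed
      also have "\<dots> = L\<^sup>2 * (abs_l2 \<eta> \<bullet> abs_l2 \<eta>)" by (simp add: inner_abs_abs s)
      finally have "(norm (abs_l2 \<xi>))\<^sup>2 \<le> (L * norm (abs_l2 \<eta>))\<^sup>2"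
        by (simp add: power2_norm_eq_inner power_mult_distrib)
      then show "norm (abs_l2 \<xi>) \<le> L * norm (abs_l2 \<eta>)"
        by (rule power2_le_imp_le) (use L in simp)
    qed auto
    finally have "norm (abs_l2 \<eta>) * norm (abs_l2 \<eta>) \<le> norm (abs_l2 \<eta>) * (2 * L * norm (abs_l2 (dv \<eta>)))"
      by (simp add: norm_eq_sqrt_inner mult_ac)
    then show ?thesis using L by (cases "abs_l2 \<eta> = 0") (auto simp: mult_le_cancel_left)
  qed
  have "W0 \<subseteq> {p. norm (fst p) \<le> 2 * L * norm (snd p)}"
    unfolding W0_def
    by (rule closure_minimal) (auto simp: T0_def test intro!: closed_Collect_le continuous_intros)
  moreover have "(w, D w) \<in> W0" using assms by (simp add: W0_iff)
  ultimately show ?thesis by force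
qed

end

lemma convergent_if_dist_le:
  fixes w :: "nat \<Rightarrow> 'a::banach" and x :: "nat \<Rightarrow> 'b::real_normed_vector"
  assumes le: "\<And>m n. norm (w m - w n) \<le> C * norm (x m - x n)" and C: "0 < C" and x: "x \<longlonglongrightarrow> l"
  obtains v where "w \<longlonglongrightarrow> v"
proof -
  have "Cauchy w"
  proof (rule CauchyI)
    fix e :: real assume e: "0 < e"
    obtain M where M: "\<And>m n. m \<ge> M \<Longrightarrow> n \<ge> M \<Longrightarrow> norm (x m - x n) < e / C"
      using CauchyD[OF LIMSEQ_imp_Cauchy[OF x], of "e / C"] e C by auto
    have "norm (w m - w n) < e" if "m \<ge> M" "n \<ge> M" for m n
      using le[of m n] M[OF that] C by (simp add: field_simps)
    then show "\<exists>M. \<forall>m\<ge>M. \<forall>n\<ge>M. norm (w m - w n) < e" by blast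
  qed
  then show ?thesis using that Cauchy_convergent_iff convergent_def by blast
qed

section \<open>Primitives, constants and the range of the derivative\<close>

context interval
begin

text \<open>An antiderivative is constant on either side of the support; the vanishing integral
  makes the two constants agree, so subtracting one leaves compact support.\<close>

lemma test_primitive:
  assumes t: "test \<phi>" and zero: "(LINT x|lborel. \<phi> x) = 0"
  shows "\<exists>\<eta>. test \<eta> \<and> dv \<eta> = \<phi>"
proof -
  obtain a b where ab: "0 < a" "b < L" "\<And>x. x \<notin> {a..b} \<Longrightarrow> \<phi> x = 0"
    using t by (auto simp: test_iff)
  have c: "continuous_on S \<phi>" for S by (rule smooth_continuous[OF test_smooth[OF t]])
  have "\<exists>F. \<forall>x::real. (-\<infinity>::ereal) < x \<longrightarrow> x < (\<infinity>::ereal) \<longrightarrow> (F has_vector_derivative \<phi> x) (at x)"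
    using c[of UNIV] by (intro einterval_antiderivative) (auto simp: continuous_on_eq_continuous_at)
  then obtain F where F: "\<And>x. (F has_vector_derivative \<phi> x) (at x)" by auto
  have FTC: "(LINT z|lborel. indicator {x..y} z *\<^sub>R \<phi> z) = F y - F x" if "x \<le> y" for x y
    using that by (intro integral_FTC_Icc has_vector_derivative_at_within[OF F] c)
  have const: "F x = F y" if "x \<le> y" "{x..y} \<inter> {a..b} = {}" for x y
  proof -
    have "(\<lambda>z. indicator {x..y} z *\<^sub>R \<phi> z) = (\<lambda>_. 0)"
    proof
      fix z
      have "\<phi> z = 0" if "z \<in> {x..y}" using that \<open>{x..y} \<inter> {a..b} = {}\<close> ab(3)[of z] by blast
      then show "indicator {x..y} z *\<^sub>R \<phi> z = 0" by (cases "z \<in> {x..y}") auto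
    qed
    then show ?thesis using FTC[OF that(1)] by simp
  qed
  have "(\<lambda>z. indicator {0..L} z *\<^sub>R \<phi> z) = \<phi>"
  proof
    fix z show "indicator {0..L} z *\<^sub>R \<phi> z = \<phi> z"
      using test_support[OF t, of z] by (cases "z \<in> {0<..<L}") auto
  qed
  then have FL: "F L = F 0" using FTC[of 0 L] L zero by simp
  define \<eta> where "\<eta> x = F x - F 0" for x
  have \<eta>: "(\<eta> has_vector_derivative \<phi> x) (at x)" for x
    unfolding \<eta>_def using has_vector_derivative_diff[OF F has_vector_derivative_const] by simp
  have "\<eta> x = 0" if x: "x \<notin> {a..b}" for x
  proof -
    consider "x < a" "x \<le> 0" | "x < a" "0 \<le> x" | "b < x" "x \<le> L" | "b < x" "L \<le> x" using x by fastforce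
    then have "F x = F 0"
    proof cases
      case 1 then show ?thesis using ab(1) by (intro const) auto
    next
      case 2 then show ?thesis using ab(1) by (intro const[symmetric]) auto
    next
      case 3 then show ?thesis using ab(2) FL const[of x L] by auto
    next
      case 4 then show ?thesis using ab(2) FL const[of L x] by auto
    qed
    then show ?thesis by (simp add: \<eta>_def)
  qed
  then have "test \<eta>"
    unfolding test_iff using smooth_by_derivative[OF \<eta> test_smooth[OF t]] ab(1,2) by blast
  then show ?thesis using dv_eqI[OF \<eta>] by blast
qed

lemma test_integrable: "test \<eta> \<Longrightarrow> integrable lborel \<eta>"
proof -
  assume t: "test \<eta>"
  have "set_integrable lborel {0..L} \<eta>"
    by (intro borel_integrable_atLeastAtMost' smooth_continuous test_smooth t)
  moreover have "indicator {0..L} x *\<^sub>R \<eta> x = \<eta> x" for x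
    using test_support[OF t, of x] by (cases "x \<in> {0<..<L}") auto
  ultimately show ?thesis by (simp add: set_integrable_def)
qed

lemma cst_test: "test \<eta> \<Longrightarrow> cst c \<bullet> abs_l2 \<eta> = c \<bullet> (LINT x|lborel. \<eta> x)"
proof -
  assume t: "test \<eta>"
  have "cst c \<bullet> abs_l2 \<eta> = (LINT x|lborel. (c * indicator {0<..<L} x) \<bullet> \<eta> x)"
    unfolding cst_def by (rule inner_abs_abs[OF square_integrable_cst test_square_integrable[OF t]])
  also have "\<dots> = (LINT x|lborel. c \<bullet> \<eta> x)"
  proof (intro Bochner_Integration.integral_cong refl)
    fix x show "(c * indicator {0<..<L} x) \<bullet> \<eta> x = c \<bullet> \<eta> x"
      using test_support[OF t, of x] by (cases "x \<in> {0<..<L}") auto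
  qed
  also have "\<dots> = c \<bullet> (LINT x|lborel. \<eta> x)" using test_integrable[OF t] by (intro integral_inner_right)
  finally show ?thesis .
qed

lemma integral_dv: "test \<eta> \<Longrightarrow> (LINT x|lborel. dv \<eta> x) = 0"
proof -
  assume t: "test \<eta>"
  have "(LINT x|lborel. indicator {0..L} x *\<^sub>R dv \<eta> x) = \<eta> L - \<eta> 0"
    using L by (intro integral_FTC_Icc has_vector_derivative_at_within[OF smooth_has_dv] smooth_continuous
        test_smooth test_dv t) auto
  moreover have "(\<lambda>z. indicator {0..L} z *\<^sub>R dv \<eta> z) = dv \<eta>"
  proof
    fix z show "indicator {0..L} z *\<^sub>R dv \<eta> z = dv \<eta> z"
      using test_support[OF test_dv[OF t], of z] by (cases "z \<in> {0<..<L}") auto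
  qed
  ultimately show ?thesis using test_support[OF t, of 0] test_support[OF t, of L] by simp
qed

lemma cst_H1: "cst c \<in> H1 \<and> D (cst c) = 0"
proof -
  have "(cst c, 0) \<in> W"
    unfolding W_def weak_derivative_iff
    using cst_L2 subspace_0[OF subspace_L2] by (auto simp: cst_test test_dv integral_dv)
  then show ?thesis by (simp add: W_iff)
qed

text \<open>Integration by parts against constants, whose derivative vanishes. In \<open>A_X\<close>
  this keeps the velocity components in the mean zero space.\<close>

lemma D_H10_mean_zero: "w \<in> H10 \<Longrightarrow> D w \<in> L2_mean_zero L"
  unfolding mean_zero_iff using parts[of "cst _" w] cst_H1 D_L2[OF H10_H1]
  by (simp add: inner_commute[of "D w"])

text \<open>The du Bois-Reymond lemma: a test function minus its integral times a fixed
  \<open>\<xi>\<close> of integral 1 is the derivative of a test function, so \<open>h\<close> sees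
  only the integral.\<close>

lemma eq_cst:
  assumes h: "h \<in> L2" and orth: "\<And>\<eta>. test \<eta> \<Longrightarrow> h \<bullet> abs_l2 (dv \<eta>) = 0"
  shows "\<exists>a. h = cst a"
proof -
  \<comment> \<open>Existence by density: otherwise the constant 1 would be orthogonal to all test
    functions.\<close>
  obtain \<xi>0 where \<xi>0: "test \<xi>0" "(LINT x|lborel. \<xi>0 x) \<noteq> 0"
  proof (rule ccontr)
    assume "\<not> thesis"
    then have "\<And>\<eta>. test \<eta> \<Longrightarrow> cst 1 \<bullet> abs_l2 \<eta> = 0" using that cst_test by fastforce
    then have "cst 1 = 0" using test_dense[OF cst_L2] by blast
    then have "cst 1 \<bullet> cst 1 = 0" by simp
    moreover have "cst 1 \<bullet> cst 1 = (LINT x|lborel. indicat_real {0<..<L} x)"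
      unfolding cst_def inner_abs_abs[OF square_integrable_cst square_integrable_cst]
      by (intro Bochner_Integration.integral_cong refl) (auto simp: indicator_def inner_complex_def)
    ultimately have "(LINT x|lborel. indicat_real {0<..<L} x) = 0" by simp
    then show False using L by simp
  qed
  define \<xi> where "\<xi> x = inverse (LINT x|lborel. \<xi>0 x) * \<xi>0 x" for x
  have \<xi>: "test \<xi>" "(LINT x|lborel. \<xi> x) = 1"
    using \<xi>0 by (auto simp: \<xi>_def[abs_def] test_scale)
  \<comment> \<open>Represents the real linear functional sending z to the inner product of
    \<open>h\<close> with z times \<open>\<xi>\<close>, read off at z = 1 and z = \<i>.\<close>
  define a where "a = Complex (h \<bullet> abs_l2 \<xi>) (h \<bullet> (\<i> *\<^sub>C abs_l2 \<xi>))"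
  have az: "h \<bullet> (z *\<^sub>C abs_l2 \<xi>) = a \<bullet> z" for z
  proof -
    have "z *\<^sub>C abs_l2 \<xi> = (complex_of_real (Re z) + complex_of_real (Im z) * \<i>) *\<^sub>C abs_l2 \<xi>"
      by (metis complex_eq mult.commute)
    also have "\<dots> = Re z *\<^sub>R abs_l2 \<xi> + Im z *\<^sub>R (\<i> *\<^sub>C abs_l2 \<xi>)"
      by (simp only: scaleC_add_left scaleC_scaleC[symmetric] scaleC_of_real)
    finally show ?thesis
      by (simp only: inner_add_right inner_scaleR_right) (simp add: a_def inner_complex_def)
  qed
  have "(h - cst a) \<bullet> abs_l2 \<phi> = 0" if t: "test \<phi>" for \<phi>
  proof -
    define z where "z = (LINT x|lborel. \<phi> x)"
    have t': "test (\<lambda>x. \<phi> x + (- z) * \<xi> x)" by (intro test_add test_scale t \<xi>)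
    have "(LINT x|lborel. \<phi> x + (- z) * \<xi> x) = z + (- z) * (LINT x|lborel. \<xi> x)"
      unfolding z_def using test_integrable[OF t] test_integrable[OF \<xi>(1)] by (subst Bochner_Integration.integral_add) auto
    then obtain \<eta> where "test \<eta>" "dv \<eta> = (\<lambda>x. \<phi> x + (- z) * \<xi> x)"
      using test_primitive[OF t'] \<xi>(2) by auto
    with orth[of \<eta>] have "h \<bullet> abs_l2 (\<lambda>x. \<phi> x + (- z) * \<xi> x) = 0" by simp
    also have "abs_l2 (\<lambda>x. \<phi> x + (- z) * \<xi> x) = abs_l2 \<phi> + (- z) *\<^sub>C abs_l2 \<xi>"
      using t \<xi>(1) by (simp only: abs_add abs_scaleC test_square_integrable test_scale)
    finally have "h \<bullet> abs_l2 \<phi> = a \<bullet> z" by (simp only: inner_add_right az) simp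
    then show ?thesis by (simp add: inner_diff_left cst_test t z_def)
  qed
  then have "h - cst a = 0"
    by (intro test_dense subspace_diff[OF subspace_L2] h cst_L2)
  then show ?thesis by auto
qed

text \<open>The Poincare inequality makes the range closed; what is orthogonal to it is constant by
  \<open>eq_cst\<close>, and a constant of mean zero is 0.\<close>

lemma D_H10_surj:
  assumes g: "g \<in> L2_mean_zero L" shows "\<exists>w\<in>H10. D w = g"
proof -
  have sub: "subspace (D ` H10)"
  proof (rule subspaceI)
    show "0 \<in> D ` H10" using H10_0 H1_0 by (metis imageI)
    show "x + y \<in> D ` H10" if "x \<in> D ` H10" "y \<in> D ` H10" for x y
      using that by (auto simp: H10_add H10_H1 H1_add[THEN conjunct2, symmetric])
    show "c *\<^sub>R x \<in> D ` H10" if "x \<in> D ` H10" for c x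
      using that by (auto simp: H10_scaleR H10_H1 H1_scaleR[THEN conjunct2, symmetric])
  qed
  have "closed (D ` H10)"
    unfolding closed_sequential_limits
  proof (intro allI impI, elim conjE)
    fix x l assume x: "\<forall>n. x n \<in> D ` H10" "x \<longlonglongrightarrow> l"
    then have "\<forall>n. \<exists>w. w \<in> H10 \<and> x n = D w" by blast
    then obtain w where w: "\<And>n. w n \<in> H10" "\<And>n. x n = D (w n)" by metis
    have "norm (w m - w n) \<le> 2 * L * norm (x m - x n)" for m n
      using poincare[OF H10_diff[OF w(1) w(1), of m n]] H1_diff[OF H10_H1[OF w(1)] H10_H1[OF w(1)], of m n]
      by (simp add: w(2))
    then obtain v where "w \<longlonglongrightarrow> v" using convergent_if_dist_le[OF _ _ x(2)] L by (metis mult_pos_pos zero_less_numeral)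
    then have "v \<in> H10 \<and> D v = l" using x(2) w by (intro H10_closed[of w]) (auto simp: w(2)[symmetric])
    then show "l \<in> D ` H10" by blast
  qed
  from hilbert_projection[OF sub this, of g]
  obtain w where w: "w \<in> H10" "\<And>v. v \<in> H10 \<Longrightarrow> (g - D w) \<bullet> D v = 0" by auto
  have mz: "g - D w \<in> L2_mean_zero L"
    by (intro subspace_diff[OF subspace_mean_zero] g D_H10_mean_zero w)
  then obtain a where a: "g - D w = cst a"
    using eq_cst[of "g - D w"] w(2) test_H10 by (fastforce simp: mean_zero_iff)
  then have "(g - D w) \<bullet> (g - D w) = 0" using mz by (simp add: mean_zero_iff)
  then show ?thesis using w(1) by auto
qed

text \<open>The Poincare inequality for mean zero functions is dual to the one on \<open>H\<^sub>0\<^sup>1\<close>: write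
  \<open>u = w'\<close> with \<open>w \<in> H\<^sub>0\<^sup>1\<close> and integrate by parts.\<close>

lemma poincare_mean_zero:
  assumes u: "u \<in> H1" "u \<in> L2_mean_zero L"
  shows "norm u \<le> 2 * L * norm (D u)"
proof -
  obtain w where w: "w \<in> H10" "D w = u" using D_H10_surj[OF u(2)] by blast
  have "norm u * norm u = u \<bullet> D w" by (simp add: w norm_eq_sqrt_inner)
  also have "\<dots> = - (D u \<bullet> w)" by (rule parts[OF u(1) w(1)])
  also have "\<dots> \<le> norm (D u) * norm w" using Cauchy_Schwarz_ineq2[of "D u" w] by linarith
  also have "\<dots> \<le> norm (D u) * (2 * L * norm u)"
    using poincare[OF w(1)] by (intro mult_left_mono) (auto simp: w)
  finally have "norm u * norm u \<le> norm u * (2 * L * norm (D u))" by (simp add: mult_ac)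
  then show ?thesis using L by (cases "u = 0") (auto simp: mult_le_cancel_left)
qed

text \<open>Von Neumann's argument: for a closed operator \<open>T\<close> with graph \<open>G\<close>, the orthogonal projection of
  \<open>(g, -f)\<close> onto \<open>G\<close> is \<open>(s, T s)\<close> where \<open>s + T\<^sup>* z = g\<close> and \<open>z - T s = f\<close>.\<close>

lemma block_resolvent:
  assumes k: "k1 \<noteq> 0" "k3 \<noteq> 0" and f: "f \<in> L2" "g \<in> L2" "h \<in> L2" "r \<in> L2"
  obtains z s y p where "z \<in> H1" "s \<in> H10" "y \<in> H10" "p \<in> H1"
    "z - (k1 *\<^sub>R D s - k2 *\<^sub>R D y) = f" "s - k1 *\<^sub>R D z = g"
    "y + (k3 *\<^sub>R D p + k2 *\<^sub>R D z) = h" "p + k3 *\<^sub>R D y = r"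
proof -
  \<comment> \<open>Here T (s, y) = (k1 D s - k2 D y, - k3 D y). Its triangular form recovers D y
    and then D s by division by k3 and k1, which makes the graph closed.\<close>
  define G where "G = {((s, y), (k1 *\<^sub>R D s - k2 *\<^sub>R D y, - k3 *\<^sub>R D y)) | s y. s \<in> H10 \<and> y \<in> H10}"
  note HD = H1_add[OF H10_H1 H10_H1, THEN conjunct2] H1_scaleR[OF H10_H1, THEN conjunct2]
  have sub: "subspace G"
  proof (rule subspaceI)
    show "0 \<in> G" unfolding G_def using H10_0 H1_0 by (auto simp: zero_prod_def intro!: exI[of _ 0])
    fix p q assume "p \<in> G" "q \<in> G"
    then obtain s y s' y' where "s \<in> H10" "y \<in> H10" "s' \<in> H10" "y' \<in> H10"
      "p = ((s, y), (k1 *\<^sub>R D s - k2 *\<^sub>R D y, - k3 *\<^sub>R D y))"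
      "q = ((s', y'), (k1 *\<^sub>R D s' - k2 *\<^sub>R D y', - k3 *\<^sub>R D y'))" unfolding G_def by blast
    then show "p + q \<in> G"
      unfolding G_def
      by (intro CollectI exI[of _ "s + s'"] exI[of _ "y + y'"])
        (auto simp: HD H10_add scaleR_add_right)
  next
    fix c p assume "p \<in> G"
    then obtain s y where "s \<in> H10" "y \<in> H10" "p = ((s, y), (k1 *\<^sub>R D s - k2 *\<^sub>R D y, - k3 *\<^sub>R D y))"
      unfolding G_def by blast
    then show "c *\<^sub>R p \<in> G"
      unfolding G_def
      by (intro CollectI exI[of _ "c *\<^sub>R s"] exI[of _ "c *\<^sub>R y"])
        (auto simp: HD H10_scaleR scaleR_diff_right mult.commute)
  qed
  have "closed G"
    unfolding closed_sequential_limits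
  proof (intro allI impI, elim conjE)
    fix x l assume x: "\<forall>n. x n \<in> G" and lim: "x \<longlonglongrightarrow> l"
    have "\<exists>s y. s \<in> H10 \<and> y \<in> H10 \<and> x n = ((s, y), (k1 *\<^sub>R D s - k2 *\<^sub>R D y, - k3 *\<^sub>R D y))" for n
      using x unfolding G_def by blast
    then obtain s y where sy: "\<And>n. s n \<in> H10" "\<And>n. y n \<in> H10"
      "\<And>n. x n = ((s n, y n), (k1 *\<^sub>R D (s n) - k2 *\<^sub>R D (y n), - k3 *\<^sub>R D (y n)))" by metis
    obtain s0 y0 a c where l: "l = ((s0, y0), (a, c))" by (metis surj_pair)
    have s: "s \<longlonglongrightarrow> s0" and y: "y \<longlonglongrightarrow> y0"
      and a: "(\<lambda>n. k1 *\<^sub>R D (s n) - k2 *\<^sub>R D (y n)) \<longlonglongrightarrow> a" and c: "(\<lambda>n. - k3 *\<^sub>R D (y n)) \<longlonglongrightarrow> c"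
      using tendsto_fst[OF tendsto_fst[OF lim]] tendsto_snd[OF tendsto_fst[OF lim]]
        tendsto_fst[OF tendsto_snd[OF lim]] tendsto_snd[OF tendsto_snd[OF lim]]
      by (simp_all add: sy(3) l)
    have "(\<lambda>n. (- 1 / k3) *\<^sub>R (- k3 *\<^sub>R D (y n))) \<longlonglongrightarrow> (- 1 / k3) *\<^sub>R c"
      by (intro tendsto_intros c)
    then have Dy: "(\<lambda>n. D (y n)) \<longlonglongrightarrow> (- 1 / k3) *\<^sub>R c" using k by simp
    have "(\<lambda>n. (1 / k1) *\<^sub>R ((k1 *\<^sub>R D (s n) - k2 *\<^sub>R D (y n)) + k2 *\<^sub>R D (y n)))
        \<longlonglongrightarrow> (1 / k1) *\<^sub>R (a + k2 *\<^sub>R ((- 1 / k3) *\<^sub>R c))"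
      by (intro tendsto_intros a Dy)
    then have Ds: "(\<lambda>n. D (s n)) \<longlonglongrightarrow> (1 / k1) *\<^sub>R (a + k2 *\<^sub>R ((- 1 / k3) *\<^sub>R c))" using k by simp
    have "y0 \<in> H10" "D y0 = (- 1 / k3) *\<^sub>R c" using H10_closed[OF sy(2) y Dy] by auto
    moreover have "s0 \<in> H10" "D s0 = (1 / k1) *\<^sub>R (a + k2 *\<^sub>R ((- 1 / k3) *\<^sub>R c))"
      using H10_closed[OF sy(1) s Ds] by auto
    ultimately show "l \<in> G" unfolding G_def l using k by auto
  qed
  from hilbert_projection[OF sub this, of "((g, h), (- f, - r))"]
  obtain s y where sy: "s \<in> H10" "y \<in> H10"
    and orth: "\<And>q. q \<in> G \<Longrightarrow>
      (((g, h), (- f, - r)) - ((s, y), (k1 *\<^sub>R D s - k2 *\<^sub>R D y, - k3 *\<^sub>R D y))) \<bullet> q = 0"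
    unfolding G_def by blast
  \<comment> \<open>The residual of the projection up to signs. By definition \<open>z1\<close> and
    \<open>z2\<close> solve the first and fourth equations; orthogonality to the graph will give the
    other two.\<close>
  define p1 p2 z1 z2 where "p1 = g - s" and "p2 = h - y"
    and "z1 = f + (k1 *\<^sub>R D s - k2 *\<^sub>R D y)" and "z2 = r - k3 *\<^sub>R D y"
  have orth': "p1 \<bullet> s' + p2 \<bullet> y' - z1 \<bullet> (k1 *\<^sub>R D s' - k2 *\<^sub>R D y') + z2 \<bullet> (k3 *\<^sub>R D y') = 0"
    if "s' \<in> H10" "y' \<in> H10" for s' y'
    using orth[of "((s', y'), (k1 *\<^sub>R D s' - k2 *\<^sub>R D y', - k3 *\<^sub>R D y'))"] that
    by (auto simp: G_def inner_prod_def p1_def p2_def z1_def z2_def inner_diff_left inner_diff_right inner_add_left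
        algebra_simps)
  note L2s = subspace_diff[OF subspace_L2] subspace_add[OF subspace_L2] subspace_mul[OF subspace_L2]
    H1_L2[OF H10_H1] D_L2[OF H10_H1]
  have pL2: "p1 \<in> L2" "p2 \<in> L2" "z1 \<in> L2" "z2 \<in> L2"
    unfolding p1_def p2_def z1_def z2_def using f sy by (auto intro!: L2s(1-3) intro: L2s(4-5))
  have z1': "k1 *\<^sub>R z1 \<in> H1 \<and> D (k1 *\<^sub>R z1) = - p1"
  proof (rule H1_adjointI)
    fix w assume w: "w \<in> H10"
    have "p1 \<bullet> w - z1 \<bullet> (k1 *\<^sub>R D w) = 0" using orth'[OF w H10_0] by (simp add: H1_0)
    then show "k1 *\<^sub>R z1 \<bullet> D w = - (- p1 \<bullet> w)" by simp
  qed (use pL2 subspace_neg[OF subspace_L2] in \<open>auto intro!: L2s(1-3)\<close>)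
  have z1: "z1 \<in> H1 \<and> k1 *\<^sub>R D z1 = - p1"
    using H1_scaleR[OF conjunct1[OF z1'], of "1 / k1"] z1' k by auto
  \<comment> \<open>Orthogonality controls only this combination; \<open>z1\<close> is already known
    to lie in \<open>H1\<close>, so \<open>z2\<close> follows by subtraction.\<close>
  have z2': "k2 *\<^sub>R z1 + k3 *\<^sub>R z2 \<in> H1 \<and> D (k2 *\<^sub>R z1 + k3 *\<^sub>R z2) = p2"
  proof (rule H1_adjointI)
    fix w assume w: "w \<in> H10"
    have "p2 \<bullet> w + z1 \<bullet> (k2 *\<^sub>R D w) + z2 \<bullet> (k3 *\<^sub>R D w) = 0"
      using orth'[OF H10_0 w] by (simp add: H1_0)
    then show "(k2 *\<^sub>R z1 + k3 *\<^sub>R z2) \<bullet> D w = - (p2 \<bullet> w)" by (simp add: inner_add_left)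
  qed (use pL2 in \<open>auto intro!: L2s(1-3)\<close>)
  have z2'': "k3 *\<^sub>R z2 \<in> H1 \<and> D (k3 *\<^sub>R z2) = p2 - k2 *\<^sub>R D z1"
    using H1_diff[OF conjunct1[OF z2'] conjunct1[OF H1_scaleR[of z1 k2]]] z1 z2' H1_scaleR[of z1 k2] by auto
  have z2: "z2 \<in> H1 \<and> k3 *\<^sub>R D z2 = p2 - k2 *\<^sub>R D z1"
    using H1_scaleR[OF conjunct1[OF z2''], of "1 / k3"] z2'' k by auto
  show ?thesis
  proof (rule that[of z1 s y z2])
    show "s - k1 *\<^sub>R D z1 = g" using z1 by (simp add: p1_def)
    show "y + (k3 *\<^sub>R D z2 + k2 *\<^sub>R D z1) = h" using z2 by (simp add: p2_def)
  qed (use z1 z2 sy in \<open>auto simp: z1_def z2_def\<close>)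
qed

corollary block_resolvent_2:
  assumes "k \<noteq> 0" "f \<in> L2" "g \<in> L2"
  obtains z s where "z \<in> H1" "s \<in> H10" "z - k *\<^sub>R D s = f" "s - k *\<^sub>R D z = g"
proof -
  have z: "0 \<in> L2" by (rule subspace_0[OF subspace_L2])
  from block_resolvent[OF assms(1) one_neq_zero assms(2,3) z z, of 0]
  obtain z s where "z \<in> H1" "s \<in> H10" "z - (k *\<^sub>R D s - 0) = f" "s - k *\<^sub>R D z = g"
    by (metis scaleR_zero_left)
  then show ?thesis using that[of z s] by simp
qed

end

text \<open>A solution is a fixed point of the map sending x to the resolvent of \<open>B\<close>
  applied to y + l P x. That resolvent is nonexpansive, so the map contracts with factor l
  M.\<close>

lemma perturbed_range:
  fixes Z :: "'h::{real_inner,banach} set"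
  assumes Z: "subspace Z" "closed Z" and DB: "subspace DB" "DB \<subseteq> Z"
    and B: "\<And>x y. x \<in> DB \<Longrightarrow> y \<in> DB \<Longrightarrow> B (x - y) = B x - B y" "\<And>x. x \<in> DB \<Longrightarrow> B x \<bullet> x \<le> 0"
    and range: "\<And>y. y \<in> Z \<Longrightarrow> \<exists>x\<in>DB. x - l *\<^sub>R B x = y"
    and P: "\<And>x y. P (x - y) = P x - P y" "\<And>x. norm (P x) \<le> M * norm x" "\<And>x. x \<in> Z \<Longrightarrow> P x \<in> Z"
    and l: "0 < l" "l * M < 1" "0 \<le> M" and y: "y \<in> Z"
  shows "\<exists>x\<in>DB. x - l *\<^sub>R (B x + P x) = y"
proof -
  have "\<exists>w\<in>DB. w - l *\<^sub>R B w = y + l *\<^sub>R P x" if "x \<in> Z" for x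
    using that Z y by (intro range subspace_add subspace_mul P) auto
  then obtain f where f: "\<And>x. x \<in> Z \<Longrightarrow> f x \<in> DB" "\<And>x. x \<in> Z \<Longrightarrow> f x - l *\<^sub>R B (f x) = y + l *\<^sub>R P x" by metis
  have "\<exists>!x\<in>Z. f x = x"
  proof (rule Banach_fix[where c = "l * M"])
    show "complete Z" using Z(2) complete_eq_closed by blast
    show "Z \<noteq> {}" using y by blast
    show "f ` Z \<subseteq> Z" using f(1) DB(2) by auto
    fix x x' assume x: "x \<in> Z" "x' \<in> Z"
    let ?d = "f x - f x'"
    have d: "?d \<in> DB" using f(1) x DB(1) subspace_diff by blast
    have "norm ?d * norm ?d \<le> (?d - l *\<^sub>R B ?d) \<bullet> ?d"
      using mult_nonneg_nonpos[OF less_imp_le[OF l(1)] B(2)[OF d]]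
      by (simp add: inner_diff_left[of "?d"] norm_eq_sqrt_inner)
    also have "\<dots> \<le> norm (?d - l *\<^sub>R B ?d) * norm ?d" by (rule norm_cauchy_schwarz)
    finally have "norm ?d \<le> norm (?d - l *\<^sub>R B ?d)" by (cases "?d = 0") auto
    also have "?d - l *\<^sub>R B ?d = (f x - l *\<^sub>R B (f x)) - (f x' - l *\<^sub>R B (f x'))"
      using x by (simp add: B f(1) scaleR_diff_right)
    also have "\<dots> = l *\<^sub>R P (x - x')" using x by (simp add: f(2) P(1) scaleR_diff_right)
    also have "norm \<dots> \<le> l * (M * norm (x - x'))" using P(2)[of "x - x'"] l(1) by simp
    finally show "dist (f x) (f x') \<le> l * M * dist x x'" by (simp add: dist_norm mult.assoc)
  qed (use l in auto)
  then obtain x where x: "x \<in> Z" "f x = x" by blast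
  then have "x - l *\<^sub>R (B x + P x) = y" using f(2)[OF x(1)] by (simp add: algebra_simps)
  then show ?thesis using f(1)[OF x(1)] x by auto
qed

section \<open>The thermoelastic system\<close>

lemma scaleC_diff_right: "c *\<^sub>C (x - y) = c *\<^sub>C x - c *\<^sub>C (y::'a::complex_vector)"
  using scaleC_add_right[of c "x - y" y] by simp

lemma scaleC_minus_right: "c *\<^sub>C (- x) = - (c *\<^sub>C (x::'a::complex_vector))"
  using scaleC_diff_right[of c 0 x] scaleC_diff_right[of c x x] by simp

lemma scaleR_scaleC_commute: "r *\<^sub>R (c *\<^sub>C x) = c *\<^sub>C (r *\<^sub>R (x::'a::complex_vector))"
  by (simp add: scaleC_of_real[symmetric] scaleC_scaleC mult.commute)

lemma norm_scaleC_prod: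
  fixes x :: "'a::{real_normed_vector,complex_vector}" and y :: "'b::{real_normed_vector,complex_vector}"
  assumes "norm (c *\<^sub>C x) = cmod c * norm x" "norm (c *\<^sub>C y) = cmod c * norm y"
  shows "norm (c *\<^sub>C (x, y)) = cmod c * norm (x, y)"
proof -
  have "norm (c *\<^sub>C (x, y)) = sqrt ((cmod c)\<^sup>2 * ((norm x)\<^sup>2 + (norm y)\<^sup>2))"
    by (simp add: scaleC_prod_def norm_Pair assms power_mult_distrib distrib_left)
  then show ?thesis by (simp add: norm_Pair real_sqrt_mult)
qed

context interval
begin

abbreviation H1z :: "l2 set" where "H1z \<equiv> H1_mean_zero L"
abbreviation L2z :: "l2 set" where "L2z \<equiv> L2_mean_zero L"

lemma subspace_H1: "subspace H1" and subspace_H10: "subspace H10"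
  by (rule subspaceI; simp add: H1_0 H1_add H1_scaleR H10_0 H10_add H10_scaleR)+

lemma subspace_H1z: "subspace H1z"
  unfolding H1_mean_zero_def by (intro subspace_inter subspace_H1 subspace_mean_zero)

lemma H1z_H1: "u \<in> H1z \<Longrightarrow> u \<in> H1" and H1z_mean_zero: "u \<in> H1z \<Longrightarrow> u \<in> L2z"
  by (auto simp: H1_mean_zero_def)

lemma H1z_scaleC: "u \<in> H1z \<Longrightarrow> c *\<^sub>C u \<in> H1z"
  by (simp add: H1_mean_zero_def H1_scaleC mean_zero_scaleC)

lemma H1z_eq_0: "u \<in> H1z \<Longrightarrow> D u = 0 \<Longrightarrow> u = 0"
  using poincare_mean_zero[of u] by (simp add: H1z_H1 H1z_mean_zero)

lemma H10_eq_0: "u \<in> H10 \<Longrightarrow> D u = 0 \<Longrightarrow> u = 0"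
  using poincare[of u] by simp

text \<open>By the Poincare inequality, convergence of the derivatives alone forces convergence of
  the functions.\<close>

lemma H1z_complete:
  assumes u: "\<And>n. u n \<in> H1z" and lim: "(\<lambda>n. D (u n)) \<longlonglongrightarrow> w"
  obtains v where "v \<in> H1z" "u \<longlonglongrightarrow> v" "D v = w"
proof -
  have "norm (u m - u n) \<le> 2 * L * norm (D (u m) - D (u n))" for m n
    using poincare_mean_zero[of "u m - u n"] subspace_diff[OF subspace_H1z u u, of m n] H1_diff[of "u m" "u n"] u
    by (simp add: H1z_H1 H1z_mean_zero)
  then obtain v where v: "u \<longlonglongrightarrow> v"
    by (rule convergent_if_dist_le[OF _ _ lim]) (use L in simp)
  have "v \<in> H1 \<and> D v = w" by (rule H1_closed[OF H1z_H1[OF u] v lim])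
  moreover have "v \<in> L2z" by (rule closed_sequentially[OF closed_mean_zero H1z_mean_zero[OF u] v])
  ultimately have "v \<in> H1z" "D v = w" by (simp_all add: H1_mean_zero_def)
  then show ?thesis using that v by blast
qed

lemma H10_complete:
  assumes u: "\<And>n. u n \<in> H10" and lim: "(\<lambda>n. D (u n)) \<longlonglongrightarrow> w"
  obtains v where "v \<in> H10" "u \<longlonglongrightarrow> v" "D v = w"
proof -
  have "norm (u m - u n) \<le> 2 * L * norm (D (u m) - D (u n))" for m n
    using poincare[OF H10_diff[OF u u, of m n]] H1_diff[of "u m" "u n"] u by (simp add: H10_H1)
  then obtain v where v: "u \<longlonglongrightarrow> v"
    by (rule convergent_if_dist_le[OF _ _ lim]) (use L in simp)
  then show ?thesis using that H10_closed[OF u v lim] by blast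
qed

end

section \<open>The system in energy coordinates\<close>

type_synonym model = "l2 \<times> l2 \<times> l2 \<times> l2 \<times> l2 \<times> l2 \<times> l2 \<times> l2 \<times> l2"

lemma state_cases [case_names fields]:
  obtains u v \<phi> \<Phi> \<psi> \<Psi> \<theta> q where "(x::state) = (u, v, \<phi>, \<Phi>, \<psi>, \<Psi>, \<theta>, q)"
  by (metis surj_pair)

lemma model_cases [case_names fields]:
  obtains v u \<Phi> \<Psi> \<psi> d \<phi> \<theta> q where "(x::model) = (v, u, \<Phi>, \<Psi>, \<psi>, d, \<phi>, \<theta>, q)"
  by (metis surj_pair)

text \<open>The parameters \<open>r, r1, r2, r3, a, k, b, t, e\<close> are the square roots of
  \<open>\<rho>, \<rho>\<^sub>1, \<rho>\<^sub>2, \<rho>\<^sub>3, \<alpha>, \<kappa>, b, \<tau>, \<beta>\<close>; \<open>s\<close> and \<open>g\<close> are \<open>\<sigma>\<close> and \<open>\<gamma>\<close> themselves.\<close>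

locale thermo = interval L for L +
  fixes r r1 r2 r3 a k b t s e g m :: real
  assumes pos: "0 < r" "0 < r1" "0 < r2" "0 < r3" "0 < a" "0 < k" "0 < b" "0 < t" "0 < e" "0 < s" "0 < g"
begin

abbreviation X :: "state set" where "X \<equiv> state_space L"
abbreviation dom :: "state set" where "dom \<equiv> A1_domain L"
abbreviation A :: "state \<Rightarrow> state" where
  "A \<equiv> A1 L (r\<^sup>2) (r1\<^sup>2) (r2\<^sup>2) (r3\<^sup>2) (a\<^sup>2) (k\<^sup>2) (b\<^sup>2) (t\<^sup>2) s (e\<^sup>2) g m"
abbreviation N :: "state \<Rightarrow> real" where
  "N \<equiv> state_norm L (r\<^sup>2) (r1\<^sup>2) (r2\<^sup>2) (r3\<^sup>2) (a\<^sup>2) (k\<^sup>2) (b\<^sup>2) (t\<^sup>2) (e\<^sup>2)"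

text \<open>The components follow the terms of the energy norm in order. In tuples of type
  \<open>model\<close>, the names u, \<psi>, d, \<phi> stand for the scaled u_x, \<psi>_x, \<phi> -
  u and \<phi>_x + \<psi>.\<close>

definition J :: "state \<Rightarrow> model" where
  "J = (\<lambda>(u, v, \<phi>, \<Phi>, \<psi>, \<Psi>, \<theta>, q).
    (r *\<^sub>R v, a *\<^sub>R D u, r1 *\<^sub>R \<Phi>, r2 *\<^sub>R \<Psi>, b *\<^sub>R D \<psi>, e *\<^sub>R (\<phi> - u), k *\<^sub>R (D \<phi> + \<psi>), r3 *\<^sub>R \<theta>, t *\<^sub>R q))"

text \<open>In these coordinates the operator is the sum of a skew-symmetric first-order part \<open>B\<close> and a
  bounded dissipative part \<open>P\<close>.\<close>

definition B :: "model \<Rightarrow> model" where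
  "B = (\<lambda>(v, u, \<Phi>, \<Psi>, \<psi>, d, \<phi>, \<theta>, q).
    ((a / r) *\<^sub>R D u, (a / r) *\<^sub>R D v, (k / r1) *\<^sub>R D \<phi> - (m / (r1 * r3)) *\<^sub>R D \<theta>, (b / r2) *\<^sub>R D \<psi>, (b / r2) *\<^sub>R D \<Psi>,
     0, (k / r1) *\<^sub>R D \<Phi>, - ((1 / (r3 * t)) *\<^sub>R D q + (m / (r1 * r3)) *\<^sub>R D \<Phi>), - ((1 / (r3 * t)) *\<^sub>R D \<theta>)))"

definition P :: "model \<Rightarrow> model" where
  "P = (\<lambda>(v, u, \<Phi>, \<Psi>, \<psi>, d, \<phi>, \<theta>, q).
    ((e / r) *\<^sub>R d - (g / r\<^sup>2) *\<^sub>R v, 0, - ((e / r1) *\<^sub>R d), (m / (r2 * r3)) *\<^sub>R \<theta> - (k / r2) *\<^sub>R \<phi>, 0,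
     (e / r1) *\<^sub>R \<Phi> - (e / r) *\<^sub>R v, (k / r2) *\<^sub>R \<Psi>, - ((m / (r2 * r3)) *\<^sub>R \<Psi>), - ((s / t\<^sup>2) *\<^sub>R q)))"

text \<open>Of any two components coupled by a derivative in \<open>B\<close>, one lies in
  \<open>H1\<close> and the other in \<open>H10\<close>, so the boundary terms vanish. Mean zero
  conditions are left out here and recovered in \<open>A_range\<close>.\<close>

definition DB :: "model set" where
  "DB = H1 \<times> H10 \<times> H1 \<times> H10 \<times> H1 \<times> L2 \<times> H10 \<times> H10 \<times> H1"

definition Z :: "model set" where
  "Z = L2 \<times> L2 \<times> L2 \<times> L2 \<times> L2 \<times> L2 \<times> L2 \<times> L2 \<times> L2"

lemma ZDB: "subspace Z" "closed Z" "subspace DB" "DB \<subseteq> Z"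
  unfolding Z_def DB_def
  by (intro subspace_Times closed_Times subspace_L2 closed_L2 subspace_H1 subspace_H10)+
    (auto dest: H1_L2 H10_H1[THEN H1_L2])

lemma B_diff: "x \<in> DB \<Longrightarrow> y \<in> DB \<Longrightarrow> B (x - y) = B x - B y"
  by (cases x rule: model_cases, cases y rule: model_cases) (auto simp: DB_def B_def H1_diff H10_H1 scaleR_diff_right)

text \<open>Integration by parts cancels each of the couplings v-u, \<Phi>-\<phi>, \<Phi>-\<theta>,
  \<Psi>-\<psi> and \<theta>-q against its counterpart.\<close>

lemma B_skew: "x \<in> DB \<Longrightarrow> B x \<bullet> x = 0"
  using parts
  by (cases x rule: model_cases) (auto simp: DB_def B_def inner_diff_left inner_diff_right inner_add_left algebra_simps
      inner_commute[of _ "D _"])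

lemma P_diff: "P (x - y) = P x - P y"
  by (cases x rule: model_cases, cases y rule: model_cases) (auto simp: P_def algebra_simps)

lemma P_Z: "x \<in> Z \<Longrightarrow> P x \<in> Z"
  by (cases x rule: model_cases) (auto simp: P_def Z_def intro!: subspace_diff[OF subspace_L2] subspace_neg[OF subspace_L2]
      subspace_mul[OF subspace_L2] subspace_0[OF subspace_L2])

lemma P_bounded: "bounded_linear P"
  unfolding P_def case_prod_unfold
  by (intro bounded_linear_Pair bounded_linear_sub bounded_linear_minus bounded_linear_zero
      bounded_linear_compose[OF bounded_linear_scaleR_right] bounded_linear_compose[OF bounded_linear_fst]
      bounded_linear_compose[OF bounded_linear_snd] bounded_linear_fst bounded_linear_snd)

text \<open>The zero order couplings cancel in pairs; only the friction \<open>g\<close> on v and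
  the relaxation \<open>s\<close> on q remain.\<close>

lemma P_dissipative: "P x \<bullet> x \<le> 0"
proof (cases x rule: model_cases)
  case (fields v u \<Phi> \<Psi> \<psi> d \<phi> \<theta> q)
  have "P x \<bullet> x = - (g / r\<^sup>2) * (v \<bullet> v) - (s / t\<^sup>2) * (q \<bullet> q)"
    unfolding fields P_def
    by (simp add: inner_diff_left inner_diff_right inner_add_left inner_commute algebra_simps)
  moreover have "0 \<le> (g / r\<^sup>2) * (v \<bullet> v)" "0 \<le> (s / t\<^sup>2) * (q \<bullet> q)" using pos by simp_all
  ultimately show ?thesis by linarith
qed

text \<open>\<open>B\<close> splits into the pairs (v, u) and (\<psi>, \<Psi>) and the block
  (\<Phi>, \<phi>, \<theta>, q); in the component d it vanishes, so there the datum is the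
  solution.\<close>

lemma B_range:
  assumes l: "0 < l" and y: "y \<in> Z"
  shows "\<exists>x\<in>DB. x - l *\<^sub>R B x = y"
proof -
  obtain f1 f2 f3 f4 f5 f6 f7 f8 f9 where y': "y = (f1, f2, f3, f4, f5, f6, f7, f8, f9)" by (cases y rule: model_cases)
  have f: "f1 \<in> L2" "f2 \<in> L2" "f3 \<in> L2" "f4 \<in> L2" "f5 \<in> L2" "f6 \<in> L2" "f7 \<in> L2" "f8 \<in> L2" "f9 \<in> L2"
    using y by (auto simp: y' Z_def)
  obtain v u where vu: "v \<in> H1" "u \<in> H10" "v - l *\<^sub>R (a / r) *\<^sub>R D u = f1" "u - l *\<^sub>R (a / r) *\<^sub>R D v = f2"
    using block_resolvent_2[of "l * (a / r)" f1 f2] l pos f by auto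
  obtain \<psi> \<Psi> where \<psi>: "\<psi> \<in> H1" "\<Psi> \<in> H10" "\<psi> - l *\<^sub>R (b / r2) *\<^sub>R D \<Psi> = f5" "\<Psi> - l *\<^sub>R (b / r2) *\<^sub>R D \<psi> = f4"
    using block_resolvent_2[of "l * (b / r2)" f5 f4] l pos f by auto
  obtain \<Phi> \<phi> \<theta> q where \<Phi>: "\<Phi> \<in> H1" "\<phi> \<in> H10" "\<theta> \<in> H10" "q \<in> H1"
    "\<Phi> - ((l * (k / r1)) *\<^sub>R D \<phi> - (l * (m / (r1 * r3))) *\<^sub>R D \<theta>) = f3" "\<phi> - (l * (k / r1)) *\<^sub>R D \<Phi> = f7"
    "\<theta> + ((l * (1 / (r3 * t))) *\<^sub>R D q + (l * (m / (r1 * r3))) *\<^sub>R D \<Phi>) = f8" "q + (l * (1 / (r3 * t))) *\<^sub>R D \<theta> = f9"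
    by (rule block_resolvent[of "l * (k / r1)" "l * (1 / (r3 * t))" f3 f7 f8 f9 "l * (m / (r1 * r3))"])
      (use l pos f in auto)
  have "(v, u, \<Phi>, \<Psi>, \<psi>, f6, \<phi>, \<theta>, q) \<in> DB" using vu \<psi> \<Phi> f by (simp add: DB_def)
  moreover have "(v, u, \<Phi>, \<Psi>, \<psi>, f6, \<phi>, \<theta>, q) - l *\<^sub>R B (v, u, \<Phi>, \<Psi>, \<psi>, f6, \<phi>, \<theta>, q) = y"
    unfolding y' B_def using vu(3,4) \<psi>(3,4) \<Phi>(5-8)
    by (simp add: scaleR_add_right scaleR_diff_right del: minus_add_distrib)
  ultimately show ?thesis by blast
qed

lemma BP_range: "\<exists>\<delta>>0. \<forall>l y. 0 < l \<longrightarrow> l < \<delta> \<longrightarrow> y \<in> Z \<longrightarrow> (\<exists>x\<in>DB. x - l *\<^sub>R (B x + P x) = y)"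
proof -
  obtain M where M: "0 \<le> M" "\<And>x. norm (P x) \<le> norm x * M"
    using bounded_linear.nonneg_bounded[OF P_bounded] by blast
  \<comment> \<open>The bound 1/(M + 1) yields l M < 1 and remains meaningful for M = 0.\<close>
  have "\<exists>x\<in>DB. x - l *\<^sub>R (B x + P x) = y" if "0 < l" "l < 1 / (M + 1)" "y \<in> Z" for l y
  proof (rule perturbed_range[OF ZDB B_diff _ B_range _ _ P_Z _ _ _ that(3)])
    have "l * (M + 1) < 1" using that M by (simp add: field_simps)
    then show "l * M < 1" using that(1) by (simp add: distrib_left)
    show "norm (P x) \<le> M * norm x" for x using M(2)[of x] by (simp add: mult.commute)
    show "B x \<bullet> x \<le> 0" if "x \<in> DB" for x using B_skew[OF that] by simp
  qed (use that M P_diff in auto)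
  then show ?thesis using M by (intro exI[of _ "1 / (M + 1)"]) auto
qed

lemma mem_X: "(u, v, \<phi>, \<Phi>, \<psi>, \<Psi>, \<theta>, q) \<in> X \<longleftrightarrow>
    u \<in> H1z \<and> v \<in> L2z \<and> \<phi> \<in> H1z \<and> \<Phi> \<in> L2z \<and> \<psi> \<in> H10 \<and> \<Psi> \<in> L2 \<and> \<theta> \<in> L2 \<and> q \<in> L2"
  by (simp add: state_space_def)

lemma mem_dom: "(u, v, \<phi>, \<Phi>, \<psi>, \<Psi>, \<theta>, q) \<in> dom \<longleftrightarrow>
    u \<in> H1z \<and> v \<in> H1z \<and> \<phi> \<in> H1z \<and> \<Phi> \<in> H1z \<and> \<psi> \<in> H10 \<and> \<Psi> \<in> H10 \<and> \<theta> \<in> H10 \<and> q \<in> H1 \<and>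
    D u \<in> H10 \<and> D \<phi> \<in> H10 \<and> D \<psi> \<in> H1"
  by (auto simp: A1_domain_def mem_X H2_space_def H10_H1 H1_L2 H1z_mean_zero)

lemma X_add: "x \<in> X \<Longrightarrow> y \<in> X \<Longrightarrow> x + y \<in> X"
  by (cases x rule: state_cases, cases y rule: state_cases)
    (auto simp: mem_X H10_add subspace_add[OF subspace_H1z] subspace_add[OF subspace_mean_zero]
      subspace_add[OF subspace_L2])

lemma X_scaleC: "x \<in> X \<Longrightarrow> c *\<^sub>C x \<in> X"
  by (cases x rule: state_cases) (auto simp: scaleC_prod_def mem_X H10_scaleC H1z_scaleC mean_zero_scaleC L2_scaleC)

lemma X_0: "0 \<in> X"
  by (simp add: zero_prod_def mem_X H10_0 subspace_0[OF subspace_H1z] subspace_0[OF subspace_mean_zero]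
      subspace_0[OF subspace_L2])

lemma dom_add: "x \<in> dom \<Longrightarrow> y \<in> dom \<Longrightarrow> x + y \<in> dom"
  by (cases x rule: state_cases, cases y rule: state_cases)
    (auto simp: mem_dom H10_add subspace_add[OF subspace_H1z] H1_add H1z_H1 H10_H1)

lemma dom_scaleC: "x \<in> dom \<Longrightarrow> c *\<^sub>C x \<in> dom"
  by (cases x rule: state_cases) (auto simp: scaleC_prod_def mem_dom H10_scaleC H1z_scaleC H1_scaleC H1z_H1 H10_H1)

lemma dom_0: "0 \<in> dom"
  by (simp add: zero_prod_def mem_dom H10_0 subspace_0[OF subspace_H1z] H1_0)

lemma dom_X: "dom \<subseteq> X"
  by (auto simp: A1_domain_def)

lemma J_add: "x \<in> X \<Longrightarrow> y \<in> X \<Longrightarrow> J (x + y) = J x + J y"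
  by (cases x rule: state_cases, cases y rule: state_cases) (auto simp: J_def mem_X H1_add H1z_H1 H10_H1 algebra_simps)

lemma J_scaleC: "x \<in> X \<Longrightarrow> J (c *\<^sub>C x) = c *\<^sub>C J x"
  by (cases x rule: state_cases)
    (auto simp: J_def scaleC_prod_def mem_X H1_scaleC H1z_H1 H10_H1 scaleR_scaleC_commute
      scaleC_diff_right[symmetric] scaleC_add_right[symmetric])

lemma J_inj: "x \<in> X \<Longrightarrow> J x = 0 \<Longrightarrow> x = 0"
  using pos H1z_eq_0 H10_eq_0 by (cases x rule: state_cases) (auto simp: J_def mem_X zero_prod_def)

lemma N_J: "N x = norm (J x)"
  using pos by (cases x rule: state_cases) (simp add: J_def state_norm_def norm_Pair power_mult_distrib add_ac)

text \<open>This is completeness of the state space. The limits of u_x and \<psi>_x determine u and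
  \<psi> by the Poincare inequalities; subtracting \<psi> from \<phi>_x + \<psi> then gives \<phi>_x
  and hence \<phi>.\<close>

lemma J_closed: "closed (J ` X)"
  unfolding closed_sequential_limits
proof (intro allI impI, elim conjE)
  fix y l assume y: "\<forall>n. y n \<in> J ` X" and lim: "y \<longlonglongrightarrow> l"
  then have "\<forall>n. \<exists>x. x \<in> X \<and> y n = J x" by blast
  then obtain x where x: "\<And>n. x n \<in> X" "\<And>n. y n = J (x n)" by metis
  define u v \<phi> \<Phi> \<psi> \<Psi> \<theta> q where "u n = fst (x n)" and "v n = fst (snd (x n))" and "\<phi> n = fst (snd (snd (x n)))"
    and "\<Phi> n = fst (snd (snd (snd (x n))))" and "\<psi> n = fst (snd (snd (snd (snd (x n)))))"
    and "\<Psi> n = fst (snd (snd (snd (snd (snd (x n))))))" and "\<theta> n = fst (snd (snd (snd (snd (snd (snd (x n)))))))"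
    and "q n = snd (snd (snd (snd (snd (snd (snd (x n)))))))" for n
  have xn: "x n = (u n, v n, \<phi> n, \<Phi> n, \<psi> n, \<Psi> n, \<theta> n, q n)" for n
    by (simp add: u_def v_def \<phi>_def \<Phi>_def \<psi>_def \<Psi>_def \<theta>_def q_def)
  have mem: "u n \<in> H1z" "v n \<in> L2z" "\<phi> n \<in> H1z" "\<Phi> n \<in> L2z" "\<psi> n \<in> H10" "\<Psi> n \<in> L2" "\<theta> n \<in> L2" "q n \<in> L2" for n
    using x(1)[of n] by (auto simp: xn mem_X)
  obtain l1 l2 l3 l4 l5 l6 l7 l8 l9 where l: "l = (l1, l2, l3, l4, l5, l6, l7, l8, l9)" by (cases l rule: model_cases)
  have yn: "y = (\<lambda>n. (r *\<^sub>R v n, a *\<^sub>R D (u n), r1 *\<^sub>R \<Phi> n, r2 *\<^sub>R \<Psi> n, b *\<^sub>R D (\<psi> n), e *\<^sub>R (\<phi> n - u n),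
      k *\<^sub>R (D (\<phi> n) + \<psi> n), r3 *\<^sub>R \<theta> n, t *\<^sub>R q n))"
    by (rule ext) (simp add: x(2) xn J_def)
  note lim' = lim[unfolded yn l]
  have lims: "(\<lambda>n. r *\<^sub>R v n) \<longlonglongrightarrow> l1" "(\<lambda>n. a *\<^sub>R D (u n)) \<longlonglongrightarrow> l2" "(\<lambda>n. r1 *\<^sub>R \<Phi> n) \<longlonglongrightarrow> l3"
    "(\<lambda>n. r2 *\<^sub>R \<Psi> n) \<longlonglongrightarrow> l4" "(\<lambda>n. b *\<^sub>R D (\<psi> n)) \<longlonglongrightarrow> l5" "(\<lambda>n. e *\<^sub>R (\<phi> n - u n)) \<longlonglongrightarrow> l6"
    "(\<lambda>n. k *\<^sub>R (D (\<phi> n) + \<psi> n)) \<longlonglongrightarrow> l7" "(\<lambda>n. r3 *\<^sub>R \<theta> n) \<longlonglongrightarrow> l8" "(\<lambda>n. t *\<^sub>R q n) \<longlonglongrightarrow> l9"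
    using tendsto_fst[OF lim']
      tendsto_fst[OF tendsto_snd[OF lim']]
      tendsto_fst[OF tendsto_snd[OF tendsto_snd[OF lim']]]
      tendsto_fst[OF tendsto_snd[OF tendsto_snd[OF tendsto_snd[OF lim']]]]
      tendsto_fst[OF tendsto_snd[OF tendsto_snd[OF tendsto_snd[OF tendsto_snd[OF lim']]]]]
      tendsto_fst[OF tendsto_snd[OF tendsto_snd[OF tendsto_snd[OF tendsto_snd[OF tendsto_snd[OF lim']]]]]]
      tendsto_fst[OF tendsto_snd[OF tendsto_snd[OF tendsto_snd[OF tendsto_snd[OF tendsto_snd[OF tendsto_snd[OF lim']]]]]]]
      tendsto_fst[OF tendsto_snd[OF tendsto_snd[OF tendsto_snd[OF tendsto_snd[OF tendsto_snd[OF tendsto_snd[OF tendsto_snd[OF lim']]]]]]]] tendsto_snd[OF tendsto_snd[OF tendsto_snd[OF tendsto_snd[OF tendsto_snd[OF tendsto_snd[OF tendsto_snd[OF tendsto_snd[OF lim']]]]]]]] by simp_all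
  have div: "f \<longlonglongrightarrow> (1 / c) *\<^sub>R z" if "(\<lambda>n. c *\<^sub>R f n) \<longlonglongrightarrow> z" "0 < c" for f :: "nat \<Rightarrow> l2" and c z
    using tendsto_scaleR[OF tendsto_const[of "1 / c"] that(1)] that(2) by simp
  obtain u0 where u0: "u0 \<in> H1z" "u \<longlonglongrightarrow> u0" "D u0 = (1 / a) *\<^sub>R l2"
    using H1z_complete[OF mem(1) div[OF lims(2) pos(5)]] .
  obtain \<psi>0 where \<psi>0: "\<psi>0 \<in> H10" "\<psi> \<longlonglongrightarrow> \<psi>0" "D \<psi>0 = (1 / b) *\<^sub>R l5"
    using H10_complete[OF mem(5) div[OF lims(5) pos(7)]] .
  have "(\<lambda>n. (D (\<phi> n) + \<psi> n) - \<psi> n) \<longlonglongrightarrow> (1 / k) *\<^sub>R l7 - \<psi>0"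
    by (intro tendsto_diff div[OF lims(7) pos(6)] \<psi>0)
  then have "(\<lambda>n. D (\<phi> n)) \<longlonglongrightarrow> (1 / k) *\<^sub>R l7 - \<psi>0" by simp
  then obtain \<phi>0 where \<phi>0: "\<phi>0 \<in> H1z" "\<phi> \<longlonglongrightarrow> \<phi>0" "D \<phi>0 = (1 / k) *\<^sub>R l7 - \<psi>0"
    using H1z_complete[where u = \<phi>, OF mem(3)] by blast
  have d: "\<phi>0 - u0 = (1 / e) *\<^sub>R l6"
    using LIMSEQ_unique[OF tendsto_diff[OF \<phi>0(2) u0(2)] div[OF lims(6) pos(9)]] .
  define U where "U = (u0, (1 / r) *\<^sub>R l1, \<phi>0, (1 / r1) *\<^sub>R l3, \<psi>0, (1 / r2) *\<^sub>R l4, (1 / r3) *\<^sub>R l8, (1 / t) *\<^sub>R l9)"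
  have "(1 / r) *\<^sub>R l1 \<in> L2z"
    using closed_sequentially[OF closed_mean_zero mem(2) div[OF lims(1) pos(1)]] .
  moreover have "(1 / r1) *\<^sub>R l3 \<in> L2z"
    using closed_sequentially[OF closed_mean_zero mem(4) div[OF lims(3) pos(2)]] .
  moreover have "(1 / r2) *\<^sub>R l4 \<in> L2"
    using closed_sequentially[OF closed_L2 mem(6) div[OF lims(4) pos(3)]] .
  moreover have "(1 / r3) *\<^sub>R l8 \<in> L2"
    using closed_sequentially[OF closed_L2 mem(7) div[OF lims(8) pos(4)]] .
  moreover have "(1 / t) *\<^sub>R l9 \<in> L2"
    using closed_sequentially[OF closed_L2 mem(8) div[OF lims(9) pos(8)]] .
  ultimately have "U \<in> X" using u0 \<psi>0 \<phi>0 by (simp add: U_def mem_X)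
  moreover have "J U = l"
    unfolding U_def J_def l using pos u0 \<psi>0 \<phi>0 d by simp
  ultimately show "l \<in> J ` X" by blast
qed

lemma A_add: "x \<in> dom \<Longrightarrow> y \<in> dom \<Longrightarrow> A (x + y) = A x + A y"
  by (cases x rule: state_cases, cases y rule: state_cases)
    (auto simp: A1_def mem_dom H1_add H1z_H1 H10_H1 algebra_simps)

lemma A_scaleC: "x \<in> dom \<Longrightarrow> A (c *\<^sub>C x) = c *\<^sub>C A x"
  by (cases x rule: state_cases)
    (auto simp: A1_def scaleC_prod_def mem_dom H1_scaleC H1_add H1z_H1 H10_H1 scaleR_scaleC_commute[symmetric]
      scaleC_diff_right scaleC_add_right scaleC_minus_right)

text \<open>The delicate point is the mean: u_x, \<phi>_x + \<psi> and \<theta> lie in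
  \<open>H10\<close>, so their derivatives have mean zero.\<close>

lemma A_X: "x \<in> dom \<Longrightarrow> A x \<in> X"
proof (cases x rule: state_cases)
  case (fields u v \<phi> \<Phi> \<psi> \<Psi> \<theta> q)
  assume x: "x \<in> dom"
  note L2zs = subspace_add[OF subspace_mean_zero] subspace_diff[OF subspace_mean_zero]
    subspace_mul[OF subspace_mean_zero]
  note L2s = subspace_add[OF subspace_L2] subspace_diff[OF subspace_L2]
    subspace_mul[OF subspace_L2] subspace_neg[OF subspace_L2]
  have x': "u \<in> H1z" "v \<in> H1z" "\<phi> \<in> H1z" "\<Phi> \<in> H1z" "\<psi> \<in> H10" "\<Psi> \<in> H10" "\<theta> \<in> H10" "q \<in> H1"
    "D u \<in> H10" "D \<phi> \<in> H10" "D \<psi> \<in> H1"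
    using x by (auto simp: fields mem_dom)
  have "D (D u) \<in> L2z" "D (D \<phi> + \<psi>) \<in> L2z" "D \<theta> \<in> L2z"
    using x' by (auto intro!: D_H10_mean_zero H10_add)
  moreover have "u \<in> L2z" "v \<in> L2z" "\<phi> \<in> L2z" "\<Phi> \<in> L2z"
    using x' by (auto intro!: H1z_mean_zero)
  moreover have "D (D \<psi>) \<in> L2" "D q \<in> L2" "D \<theta> \<in> L2" "D \<Phi> \<in> L2" "\<theta> \<in> L2" "\<Psi> \<in> L2" "q \<in> L2" "D \<phi> \<in> L2" "\<psi> \<in> L2"
    using x' by (simp_all add: D_L2 H1_L2 H10_H1 H1z_H1)
  ultimately show ?thesis
    unfolding fields A1_def prod.case mem_X using x'(2,4,6)
    by (intro conjI L2zs L2s)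
qed

lemma J_A: "x \<in> dom \<Longrightarrow> J (A x) = B (J x) + P (J x) \<and> J x \<in> DB"
proof (cases x rule: state_cases)
  case (fields u v \<phi> \<Phi> \<psi> \<Psi> \<theta> q)
  assume x: "x \<in> dom"
  have x': "u \<in> H1" "v \<in> H1" "\<phi> \<in> H1" "\<Phi> \<in> H1" "\<psi> \<in> H10" "\<Psi> \<in> H10" "\<theta> \<in> H10" "q \<in> H1"
    "D u \<in> H10" "D \<phi> \<in> H10" "D \<psi> \<in> H1"
    using x by (auto simp: fields mem_dom H1z_H1)
  have "J x \<in> DB"
    unfolding fields J_def DB_def using x'
    by (auto intro!: H10_scaleR H10_add H1_scaleR[THEN conjunct1] H1_diff[THEN conjunct1] H1_L2)
  moreover have "J (A x) = B (J x) + P (J x)"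
    unfolding fields J_def A1_def B_def P_def prod.case
    using x' pos
    by (simp add: H1_scaleR H1_add H10_H1 power2_eq_square algebra_simps)
  ultimately show ?thesis by blast
qed

lemma A_dissipative: "x \<in> dom \<Longrightarrow> J (A x) \<bullet> J x \<le> 0"
  using J_A[of x] B_skew[of "J x"] P_dissipative[of "J x"] by (simp add: inner_add_left)

text \<open>\<open>w\<close> is known only in the large product and must be shown to come from a
  state. The data \<open>J y\<close> satisfy the relations between the derived coordinates, and the
  resolvent equation passes these on to \<open>w\<close>.\<close>

lemma A_range:
  assumes l: "0 < l" and y: "y \<in> X" and w: "w \<in> DB" "w - l *\<^sub>R (B w + P w) = J y"
  shows "\<exists>x\<in>dom. x - l *\<^sub>R A x = y"
proof -
  obtain f1 f2 f3 f4 f5 f6 f7 f8 where y': "y = (f1, f2, f3, f4, f5, f6, f7, f8)" by (cases y rule: state_cases)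
  obtain w1 w2 w3 w4 w5 w6 w7 w8 w9 where w': "w = (w1, w2, w3, w4, w5, w6, w7, w8, w9)" by (cases w rule: model_cases)
  have f: "f1 \<in> H1z" "f2 \<in> L2z" "f3 \<in> H1z" "f4 \<in> L2z" "f5 \<in> H10" "f6 \<in> L2" "f7 \<in> L2" "f8 \<in> L2"
    using y by (auto simp: y' mem_X)
  have wm: "w1 \<in> H1" "w2 \<in> H10" "w3 \<in> H1" "w4 \<in> H10" "w5 \<in> H1" "w6 \<in> L2" "w7 \<in> H10" "w8 \<in> H10" "w9 \<in> H1"
    using w(1) by (auto simp: w' DB_def)
  have eqs: "w1 - l *\<^sub>R ((a / r) *\<^sub>R D w2 + ((e / r) *\<^sub>R w6 - (g / r\<^sup>2) *\<^sub>R w1)) = r *\<^sub>R f2"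
    "w2 - l *\<^sub>R (a / r) *\<^sub>R D w1 = a *\<^sub>R D f1"
    "w3 - l *\<^sub>R ((k / r1) *\<^sub>R D w7 - (m / (r1 * r3)) *\<^sub>R D w8 + - ((e / r1) *\<^sub>R w6)) = r1 *\<^sub>R f4"
    "w5 - l *\<^sub>R (b / r2) *\<^sub>R D w4 = b *\<^sub>R D f5"
    "w6 - l *\<^sub>R ((e / r1) *\<^sub>R w3 - (e / r) *\<^sub>R w1) = e *\<^sub>R (f3 - f1)"
    "w7 - l *\<^sub>R ((k / r1) *\<^sub>R D w3 + (k / r2) *\<^sub>R w4) = k *\<^sub>R (D f3 + f5)"
    using w(2) by (simp_all add: w' y' B_def P_def J_def)
  \<comment> \<open>Pairing the equations for w1, w3 and w6 with a constant removes all derivatives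
    of \<open>H10\<close> functions and leaves a homogeneous 3 by 3 system.\<close>
  have mz: "w1 \<bullet> cst c = 0 \<and> w3 \<bullet> cst c = 0" for c
  proof -
    define x1 x3 x6 where "x1 = w1 \<bullet> cst c" and "x3 = w3 \<bullet> cst c" and "x6 = w6 \<bullet> cst c"
    have D: "D w2 \<bullet> cst c = 0" "D w7 \<bullet> cst c = 0" "D w8 \<bullet> cst c = 0"
      using wm D_H10_mean_zero mean_zero_iff by blast+
    have F: "f2 \<bullet> cst c = 0" "f4 \<bullet> cst c = 0" "f3 \<bullet> cst c = 0" "f1 \<bullet> cst c = 0"
      using f H1z_mean_zero mean_zero_iff by blast+
    have e1: "x1 - l * ((e / r) * x6 - (g / r\<^sup>2) * x1) = 0"
      using arg_cong[OF eqs(1), of "\<lambda>z. z \<bullet> cst c"]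
      by (simp add: inner_diff_left inner_add_left D F x1_def x6_def)
    have e3: "x3 + l * ((e / r1) * x6) = 0"
      using arg_cong[OF eqs(3), of "\<lambda>z. z \<bullet> cst c"]
      by (simp add: inner_diff_left inner_add_left D F x3_def x6_def)
    have e6: "x6 - l * ((e / r1) * x3 - (e / r) * x1) = 0"
      using arg_cong[OF eqs(5), of "\<lambda>z. z \<bullet> cst c"]
      by (simp add: inner_diff_left inner_add_left F x1_def x3_def x6_def)
    \<comment> \<open>The energy identity of that system: skew terms cancel and the friction term is
      nonnegative, so only the zero solution remains.\<close>
    have eq: "x1 * (x1 - l * ((e / r) * x6 - (g / r\<^sup>2) * x1)) + x3 * (x3 + l * ((e / r1) * x6))
        + x6 * (x6 - l * ((e / r1) * x3 - (e / r) * x1)) = x1\<^sup>2 + x3\<^sup>2 + x6\<^sup>2 + l * (g / r\<^sup>2) * x1\<^sup>2"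
      by (simp add: algebra_simps power2_eq_square)
    have "x1\<^sup>2 + x3\<^sup>2 + x6\<^sup>2 + l * (g / r\<^sup>2) * x1\<^sup>2 = 0"
      unfolding eq[symmetric] e1 e3 e6 by simp
    moreover have "0 \<le> l * (g / r\<^sup>2) * x1\<^sup>2" using l pos by simp
    ultimately have "x1\<^sup>2 = 0 \<and> x3\<^sup>2 = 0"
      using zero_le_power2[of x1] zero_le_power2[of x3] zero_le_power2[of x6] by linarith
    then show ?thesis by (simp add: x1_def x3_def)
  qed
  define v \<Phi> \<Psi> \<theta> q where "v = (1 / r) *\<^sub>R w1" and "\<Phi> = (1 / r1) *\<^sub>R w3" and "\<Psi> = (1 / r2) *\<^sub>R w4"
    and "\<theta> = (1 / r3) *\<^sub>R w8" and "q = (1 / t) *\<^sub>R w9"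
  \<comment> \<open>Forced by the kinematic rows u - l v = f1, \<phi> - l \<Phi> = f3 and \<psi> - l
    \<Psi> = f5 of the resolvent equation.\<close>
  define u \<phi> \<psi> where "u = l *\<^sub>R v + f1" and "\<phi> = l *\<^sub>R \<Phi> + f3" and "\<psi> = l *\<^sub>R \<Psi> + f5"
  define x where "x = (u, v, \<phi>, \<Phi>, \<psi>, \<Psi>, \<theta>, q)"
  have vm: "v \<in> H1z" "\<Phi> \<in> H1z"
    using mz wm H1_L2 by (auto simp: v_def \<Phi>_def H1_mean_zero_def mean_zero_iff H1_scaleR
        subspace_mul[OF subspace_L2])
  have um: "u \<in> H1z" "\<phi> \<in> H1z" "\<psi> \<in> H10" "\<Psi> \<in> H10" "\<theta> \<in> H10" "q \<in> H1"
    using vm f wm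
    by (auto simp: u_def \<phi>_def \<psi>_def \<Psi>_def \<theta>_def q_def H1_scaleR
        intro!: subspace_add[OF subspace_H1z] subspace_mul[OF subspace_H1z] H10_add H10_scaleR)
  have Du: "D u = (l / r) *\<^sub>R D w1 + D f1" "D \<phi> = (l / r1) *\<^sub>R D w3 + D f3" "D \<psi> = (l / r2) *\<^sub>R D w4 + D f5"
    using f wm by (simp_all add: u_def \<phi>_def \<psi>_def v_def \<Phi>_def \<Psi>_def H1_add H1_scaleR H1z_H1 H10_H1)
  have "w2 = a *\<^sub>R D u"
    using eqs(2) by (simp add: Du scaleR_add_right algebra_simps)
  moreover have "w5 = b *\<^sub>R D \<psi>"
    using eqs(4) by (simp add: Du scaleR_add_right algebra_simps)
  moreover have "w7 = k *\<^sub>R (D \<phi> + \<psi>)"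
    using eqs(6) by (simp add: Du \<psi>_def \<Psi>_def scaleR_add_right algebra_simps)
  moreover have "w6 = e *\<^sub>R (\<phi> - u)"
    using eqs(5) by (simp add: \<phi>_def u_def v_def \<Phi>_def scaleR_add_right algebra_simps)
  ultimately have w2: "w2 = a *\<^sub>R D u" and w5: "w5 = b *\<^sub>R D \<psi>" and w7: "w7 = k *\<^sub>R (D \<phi> + \<psi>)"
    and w6: "w6 = e *\<^sub>R (\<phi> - u)" by auto
  have "D u = (1 / a) *\<^sub>R w2" "D \<psi> = (1 / b) *\<^sub>R w5" "D \<phi> = (1 / k) *\<^sub>R w7 - \<psi>"
    using pos by (simp_all add: w2 w5 w7)
  then have "x \<in> dom"
    using um vm wm by (auto simp: x_def mem_dom H10_scaleR H10_diff H1_scaleR)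
  moreover have Jx: "J x = w"
    using pos by (simp add: x_def J_def w' w2 w5 w6 w7 v_def \<Phi>_def \<Psi>_def \<theta>_def q_def)
  have "x - l *\<^sub>R A x = y"
  proof -
    \<comment> \<open>The residual, written with complex scalars because \<open>J\<close> is known
      to respect \<open>scaleC\<close>; its image vanishes by the equation for \<open>w\<close>, and
      \<open>J\<close> is injective.\<close>
    let ?d = "x + complex_of_real (- l) *\<^sub>C A x + complex_of_real (- 1) *\<^sub>C y"
    have xX: "x \<in> X" "A x \<in> X" using \<open>x \<in> dom\<close> dom_X A_X by auto
    have "J ?d = w + complex_of_real (- l) *\<^sub>C J (A x) + complex_of_real (- 1) *\<^sub>C J y"
      using xX y by (simp only: J_add J_scaleC X_add X_scaleC Jx)
    also have "\<dots> = w - l *\<^sub>R (B w + P w) - J y"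
      using J_A[OF \<open>x \<in> dom\<close>] unfolding scaleC_of_real Jx by simp
    finally have "J ?d = 0" using w(2) by simp
    moreover have "?d \<in> X" using xX y by (intro X_add X_scaleC)
    ultimately have "?d = 0" by (intro J_inj)
    then show ?thesis unfolding scaleC_of_real by simp
  qed
  ultimately show ?thesis by blast
qed

lemma norm_scaleC_model: "norm (c *\<^sub>C (x::model)) = cmod c * norm x"
  by (cases x rule: model_cases) (simp only: norm_scaleC_prod norm_scaleC_l2)

theorem well_posed: "well_posed_on X N dom A"
proof -
  obtain \<delta> where \<delta>: "0 < \<delta>" "\<And>l y. 0 < l \<Longrightarrow> l < \<delta> \<Longrightarrow> y \<in> Z \<Longrightarrow> \<exists>x\<in>DB. x - l *\<^sub>R (B x + P x) = y"
    using BP_range by blast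
  have JZ: "J y \<in> Z" if "y \<in> X" for y
    using that by (cases y rule: state_cases) (auto simp: J_def Z_def mem_X H1z_H1 H10_H1
        intro!: subspace_mul[OF subspace_L2] subspace_diff[OF subspace_L2] subspace_add[OF subspace_L2] D_L2
        intro: H1_L2 H10_H1 H1z_H1 simp: mean_zero_iff)
  interpret isometric_model X dom N A \<delta> J
  proof
    show "\<exists>x\<in>dom. x - l *\<^sub>R A x = y" if "0 < l" "l < \<delta>" "y \<in> X" for l y
      using \<delta>(2)[OF that(1,2) JZ[OF that(3)]] A_range[OF that(1,3)] by blast
  qed (use \<delta>(1) dom_X in \<open>auto simp: X_0 X_add X_scaleC J_add J_scaleC J_inj N_J J_closed norm_scaleC_model
      dom_0 dom_add dom_scaleC A_add A_scaleC A_X A_dissipative\<close>)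
  show ?thesis by (rule well_posed)
qed

end

theorem theorem2p1:
  fixes L \<rho> \<rho>\<^sub>1 \<rho>\<^sub>2 \<rho>\<^sub>3 \<alpha> \<kappa> b \<tau> \<sigma> \<beta> \<gamma> m :: real
  assumes "L > 0" "\<rho> > 0" "\<rho>\<^sub>1 > 0" "\<rho>\<^sub>2 > 0" "\<rho>\<^sub>3 > 0" "\<alpha> > 0" "\<kappa> > 0" "b > 0"
    "\<tau> > 0" "\<sigma> > 0" "\<beta> > 0" "\<gamma> > 0" "m \<noteq> 0"
  shows
    "let X = state_space L;
         N = state_norm L \<rho> \<rho>\<^sub>1 \<rho>\<^sub>2 \<rho>\<^sub>3 \<alpha> \<kappa> b \<tau> \<beta>;
         D = A1_domain L;
         A = A1 L \<rho> \<rho>\<^sub>1 \<rho>\<^sub>2 \<rho>\<^sub>3 \<alpha> \<kappa> b \<tau> \<sigma> \<beta> \<gamma> m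
     in \<exists>T. C0_contraction_semigroup X N T \<and> infinitesimal_generator X N T D A \<and>
          (\<forall>U\<^sub>0\<in>X.
             mild_solution X N D A U\<^sub>0 (\<lambda>t. T t U\<^sub>0) \<and>
             (\<forall>V. mild_solution X N D A U\<^sub>0 V \<longrightarrow> (\<forall>t\<ge>0. V t = T t U\<^sub>0)) \<and>
             continuous_into {0..} X N (\<lambda>t. T t U\<^sub>0)) \<and>
          (\<forall>U\<^sub>0\<in>D.
             classical_solution X N D A U\<^sub>0 (\<lambda>t. T t U\<^sub>0) \<and>
             continuous_into {0..} D (graph_norm N A) (\<lambda>t. T t U\<^sub>0) \<and>
             C1_into {0..} X N (\<lambda>t. T t U\<^sub>0))"
proof -
  \<comment> \<open>Square roots as parameters keep roots out of the algebra; squaring them restores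
    the physical constants.\<close>
  interpret thermo L "sqrt \<rho>" "sqrt \<rho>\<^sub>1" "sqrt \<rho>\<^sub>2" "sqrt \<rho>\<^sub>3" "sqrt \<alpha>" "sqrt \<kappa>" "sqrt b" "sqrt \<tau>" \<sigma> "sqrt \<beta>" \<gamma> m
    by unfold_locales (use assms in auto)
  have "(sqrt \<rho>)\<^sup>2 = \<rho>" "(sqrt \<rho>\<^sub>1)\<^sup>2 = \<rho>\<^sub>1" "(sqrt \<rho>\<^sub>2)\<^sup>2 = \<rho>\<^sub>2" "(sqrt \<rho>\<^sub>3)\<^sup>2 = \<rho>\<^sub>3" "(sqrt \<alpha>)\<^sup>2 = \<alpha>"
    "(sqrt \<kappa>)\<^sup>2 = \<kappa>" "(sqrt b)\<^sup>2 = b" "(sqrt \<tau>)\<^sup>2 = \<tau>" "(sqrt \<beta>)\<^sup>2 = \<beta>"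
    using assms by auto
  from well_posed[unfolded this well_posed_on_def] show ?thesis by (simp only: Let_def)
qed

end
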